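(* Let $X$ be a dendro-minimal dendrite. Suppose that $X$ admits some free arc but is not reduced to an arc (i.e. $X$ is not homeomorphic to $[0,1]$). Then $\mathrm{Homeo}(X)$ decomposes as a permutational wreath product $$\mathrm{Homeo}(X)\ \cong\ \Big(\prod_{I\in \mathrm{Free}(X)} \mathrm{Homeo}_+(I)\Big) \rtimes \mathrm{Aut}(\mathrm{Free}(X)).$$
   Context: A dendrite is a locally connected, connected, compact metrisable space containing no simple closed curve. A sub-dendrite of $X$ is a non-empty closed connected subset. $X$ is dendro-minimal if there is no proper sub-dendrite of $X$ invariant under the group $\mathrm{Homeo}(X)$ of all homeomorphisms of $X$. A free arc of $X$ is an arc $I\subseteq X$ (a homeomorphic copy of $[0,1]$, not reduced to a point) whose interior (the arc without its two extremities) is open in $X$. Any free arc is contained in a maximal free arc, and $\mathrm{Free}(X)$ denotes the (countable) set of all maximal free arcs of $X$. $\mathrm{Homeo}_+(I)$ is the group of orientation-preserving homeomorphisms of the arc $I$. $\mathrm{Homeo}(X)$ acts on the set $\mathrm{Free}(X)$, and $\mathrm{Aut}(\mathrm{Free}(X))$ denotes the image of $\mathrm{Homeo}(X)$ in the group of permutations of $\mathrm{Free}(X)$. In the semi-direct product, $\mathrm{Aut}(\mathrm{Free}(X))$ acts on the product by automorphisms permuting the factors according to its action on $\mathrm{Free}(X)$: an element $a$ carries the factor $\mathrm{Homeo}_+(I)$ to the factor $\mathrm{Homeo}_+(aI)$. *)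

theory Defs
  imports "HOL-Analysis.Analysis" "HOL-Algebra.Bij" "HOL-Algebra.Product_Groups"
begin

section \<open>Dendrites\<close>

definition simple_closed_curve_in :: "'a topology \<Rightarrow> 'a set \<Rightarrow> bool" where
  "simple_closed_curve_in X C \<longleftrightarrow>
     C \<subseteq> topspace X \<and> subtopology X C homeomorphic_space top_of_set (sphere (0::complex) 1)"

definition dendrite :: "'a topology \<Rightarrow> bool" where
  "dendrite X \<longleftrightarrow>
     locally_connected_space X \<and> connected_space X \<and> compact_space X \<and> metrizable_space X \<and>
     (\<nexists>C. simple_closed_curve_in X C)"

definition subdendrite :: "'a topology \<Rightarrow> 'a set \<Rightarrow> bool" where
  "subdendrite X Y \<longleftrightarrow> Y \<noteq> {} \<and> closedin X Y \<and> connectedin X Y"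

text \<open>As in \<^const>\<open>BijGroup\<close>, group elements are extensional functions, so that each
  homeomorphism is represented exactly once; the product is composition.\<close>

definition homeo_group :: "'a topology \<Rightarrow> ('a \<Rightarrow> 'a) monoid" where
  "homeo_group X = BijGroup (topspace X)
     \<lparr>carrier := {h \<in> Bij (topspace X). homeomorphic_map X X h}\<rparr>"

definition dendro_minimal :: "'a topology \<Rightarrow> bool" where
  "dendro_minimal X \<longleftrightarrow>
     (\<nexists>Y. subdendrite X Y \<and> Y \<noteq> topspace X \<and> (\<forall>h \<in> carrier (homeo_group X). h ` Y = Y))"

section \<open>Free arcs\<close>

definition arc_param :: "'a topology \<Rightarrow> 'a set \<Rightarrow> (real \<Rightarrow> 'a) \<Rightarrow> bool" where
  "arc_param X I g \<longleftrightarrow>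
     I \<subseteq> topspace X \<and> homeomorphic_map (top_of_set {0..1}) (subtopology X I) g"

text \<open>The extremities of \<open>I\<close> are \<open>g 0\<close> and \<open>g 1\<close>, whatever the parametrisation \<open>g\<close>.\<close>

definition free_arc :: "'a topology \<Rightarrow> 'a set \<Rightarrow> bool" where
  "free_arc X I \<longleftrightarrow> (\<exists>g. arc_param X I g \<and> openin X (I - {g 0, g 1}))"

definition max_free_arcs :: "'a topology \<Rightarrow> 'a set set" where
  "max_free_arcs X = {I. free_arc X I \<and> (\<forall>J. free_arc X J \<and> I \<subseteq> J \<longrightarrow> J = I)}"

text \<open>A homeomorphism of an arc preserves orientation if it is increasing when read in a
  parametrisation; this does not depend on the parametrisation.\<close>

definition homeo_plus :: "'a topology \<Rightarrow> 'a set \<Rightarrow> ('a \<Rightarrow> 'a) monoid" where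
  "homeo_plus X I = BijGroup I
     \<lparr>carrier := {h \<in> Bij I. homeomorphic_map (subtopology X I) (subtopology X I) h \<and>
        (\<exists>g. arc_param X I g \<and> strict_mono_on {0..1} (inv_into {0..1} g \<circ> h \<circ> g))}\<rparr>"

definition aut_free :: "'a topology \<Rightarrow> ('a set \<Rightarrow> 'a set) monoid" where
  "aut_free X = BijGroup (max_free_arcs X)
     \<lparr>carrier := (\<lambda>h. \<lambda>I\<in>max_free_arcs X. h ` I) ` carrier (homeo_group X)\<rparr>"

section \<open>The permutational wreath product\<close>

definition semidirect_product ::
  "('n, 'c) monoid_scheme \<Rightarrow> ('h, 'd) monoid_scheme \<Rightarrow> ('h \<Rightarrow> 'n \<Rightarrow> 'n) \<Rightarrow> ('n \<times> 'h) monoid" where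
  "semidirect_product N H \<theta> =
     \<lparr>carrier = carrier N \<times> carrier H,
      monoid.mult = (\<lambda>(n, h) (n', h'). (n \<otimes>\<^bsub>N\<^esub> \<theta> h n', h \<otimes>\<^bsub>H\<^esub> h')),
      one = (\<one>\<^bsub>N\<^esub>, \<one>\<^bsub>H\<^esub>)\<rparr>"

abbreviation homeo_plus_product :: "'a topology \<Rightarrow> ('a set \<Rightarrow> 'a \<Rightarrow> 'a) monoid" where
  "homeo_plus_product X \<equiv> product_group (max_free_arcs X) (homeo_plus X)"

text \<open>Each \<open>a\<close> carries the factor indexed by \<open>I\<close> isomorphically onto the factor indexed by \<open>a I\<close>:
  the coordinate at \<open>a I\<close> of the image of \<open>f\<close> is the image of the coordinate \<open>f I\<close>. The
  isomorphisms between factors cannot be required to come from a fixed identification of all the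
  factors with one group, because an \<open>a\<close> with \<open>a I = I\<close> may be induced by homeomorphisms of
  \<open>X\<close> that exchange the extremities of \<open>I\<close>.\<close>

definition factor_permuting_action ::
  "'a topology \<Rightarrow> (('a set \<Rightarrow> 'a set) \<Rightarrow> ('a set \<Rightarrow> 'a \<Rightarrow> 'a) \<Rightarrow> ('a set \<Rightarrow> 'a \<Rightarrow> 'a)) \<Rightarrow> bool" where
  "factor_permuting_action X \<theta> \<longleftrightarrow>
     \<theta> \<in> hom (aut_free X) (AutoGroup (homeo_plus_product X)) \<and>
     (\<forall>a \<in> carrier (aut_free X). \<forall>I \<in> max_free_arcs X.
        \<exists>\<phi> \<in> iso (homeo_plus X I) (homeo_plus X (a I)).
          \<forall>f \<in> carrier (homeo_plus_product X). \<theta> a f (a I) = \<phi> (f I))"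

end

theory Submission
  imports Defs "HOL-Probability.Discrete_Topology"
begin

text \<open>
A homeomorphism of \<open>X\<close> permutes the maximal free arcs. By definition \<open>Aut(Free(X))\<close> is the image of this
action, so the claim is that the action has kernel \<open>\<Prod> Homeo\<^sub>+(I)\<close> and that the resulting extension
splits.

The topological input is that two points \<open>x\<close>, \<open>y\<close> of a dendrite are joined by an arc that lies in every
connected set containing both (\<open>dendrite_arcs\<close>). Such an arc exists even in a connected open subset,
because locally connected compact sets are locally path-connected; if it could be avoided, there would be
a second arc, and two arcs with the same ends contain a simple closed curve. Hence intersections of
connected sets are connected, and dendrites can be handled through the segments \<open>seg x y\<close> alone: each
point inside a segment separates its ends, and any three points have a median.

Three facts about free arcs follow. Every free arc lies in a maximal one, and the interior of a maximal
free arc misses every other maximal free arc (\<open>free_arc_in_max_free_arc\<close>, \<open>oseg_disjoint_max_free_arc\<close>):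
a maximal free arc is the closure of a component of the set of all interior points of free arcs.
Connected sets that meet pairwise in at most one point form a null family: near a given point only
finitely many of them are large (\<open>null_family\<close>). Finally, the free arcs are dense (\<open>free_arcs_dense\<close>).
Indeed, the smallest sub-dendrite that contains all free arcs is invariant, so it is \<open>X\<close> by
dendro-minimality. If a segment avoids the closure \<open>F\<close> of the free arcs, then every branch leaving it
must reach \<open>F\<close>, for otherwise it could be cut off; as the branches form a null family, there are only
finitely many, and a piece of the segment between two branch points is a free arc, which is absurd.

For the kernel, let \<open>h\<close> preserve every maximal free arc. As \<open>X\<close> is not an arc, density provides at least
two maximal free arcs. Removing the interior of \<open>I\<close> leaves two disjoint closed pieces, one at each
extremity; a homeomorphism that exchanged the extremities would exchange the pieces and could not
preserve a second maximal free arc, which lies in one of them (\<open>kernel_fixes_extremities\<close>). So \<open>h\<close>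
restricts to an element of each \<open>Homeo\<^sub>+(I)\<close>, and by density it is determined by these restrictions.
Conversely, any family in \<open>\<Prod> Homeo\<^sub>+(I)\<close> glues to a homeomorphism of \<open>X\<close> that is the identity elsewhere;
continuity is where the null family property is used (\<open>homeomorphic_map_glue\<close>).

For the splitting, fix a parametrisation of each maximal free arc and call a homeomorphism affine if it
carries each parametrisation to the parametrisation of the image arc or to its reverse. Every
homeomorphism can be corrected by an element of the kernel so as to become affine
(\<open>affine_homeo_exists\<close>), and only in one way, because the kernel preserves orientations
(\<open>affine_homeo_unique\<close>). Products of affine homeomorphisms are affine, so choosing the affine
representative of each class is a homomorphic section. The action \<open>\<theta>\<close> is conjugation by this section,
and it carries the factor of \<open>I\<close> to the factor of \<open>a I\<close> by conjugation with the affine map from \<open>I\<close> to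
\<open>a I\<close>.
\<close>

section \<open>Paths in locally connected compact sets\<close>

text \<open>A Lebesgue number of a cover of \<open>S\<close> by small connected open sets serves all pairs of points at once.\<close>

lemma uniformly_locally_connected:
  fixes S :: "'a::metric_space set"
  assumes "compact S" and lc: "locally_connected_space (top_of_set S)" and "0 < e"
  obtains d where "0 < d"
    "\<And>x y. \<lbrakk>x \<in> S; y \<in> S; dist x y < d\<rbrakk> \<Longrightarrow>
       \<exists>C. connected C \<and> C \<subseteq> S \<and> x \<in> C \<and> y \<in> C \<and> (\<forall>z\<in>C. dist x z < e)"
proof -
  define \<G> where "\<G> = {T. open T \<and> connected (T \<inter> S) \<and> (\<forall>u\<in>T \<inter> S. \<forall>v\<in>T \<inter> S. dist u v < e)}"
  have "\<exists>T\<in>\<G>. x \<in> T" if "x \<in> S" for x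
  proof -
    have "openin (top_of_set S) (S \<inter> ball x (e/2))" by (simp add: openin_open_Int)
    moreover have "x \<in> S \<inter> ball x (e/2)" using that \<open>0 < e\<close> by simp
    ultimately obtain U where U: "openin (top_of_set S) U" "connected U" "x \<in> U" "U \<subseteq> S \<inter> ball x (e/2)"
      using lc unfolding locally_connected_space by (metis connectedin_iff_connected connectedin_subtopology)
    then obtain T where "open T" "U = S \<inter> T" by (auto simp: openin_open)
    moreover have "dist u v < e" if "u \<in> U" "v \<in> U" for u v
      using U(4) that dist_triangle_half_r[of x u e v] by (auto simp: subset_iff)
    ultimately show ?thesis
      using U by (auto simp: \<G>_def Int_commute)
  qed
  then have "S \<subseteq> \<Union>\<G>" by blast
  moreover have "\<And>T. T \<in> \<G> \<Longrightarrow> open T" by (simp add: \<G>_def)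
  ultimately obtain d where d: "0 < d" "\<forall>x\<in>S. \<exists>T\<in>\<G>. ball x d \<subseteq> T"
    using Heine_Borel_lemma[OF \<open>compact S\<close>] by metis
  show ?thesis
  proof
    show "0 < d" by fact
    fix x y assume xy: "x \<in> S" "y \<in> S" "dist x y < d"
    then obtain T where T: "T \<in> \<G>" "ball x d \<subseteq> T" using d by blast
    then have "x \<in> T \<inter> S" "y \<in> T \<inter> S" using xy d(1) by auto
    with T show "\<exists>C. connected C \<and> C \<subseteq> S \<and> x \<in> C \<and> y \<in> C \<and> (\<forall>z\<in>C. dist x z < e)"
      by (intro exI[of _ "T \<inter> S"]) (auto simp: \<G>_def)
  qed
qed

text \<open>The number of steps does not depend on the connected set: the chain only has to pass from ball to ball
  in a fixed finite cover of \<open>S\<close>, and a ball that can be reached at all is reached in at most as many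
  steps as there are pairs of balls. With this uniformity all gaps between consecutive points of a chain
  can be subdivided into equally many parts, so that refined chains can be parametrised by equidistant
  times.\<close>

lemma uniform_chains:
  fixes S :: "'a::metric_space set"
  assumes "compact S" and "0 < d"
  obtains N where "2 \<le> N"
    "\<And>C x y. \<lbrakk>connected C; C \<subseteq> S; x \<in> C; y \<in> C\<rbrakk> \<Longrightarrow>
       \<exists>p::nat \<Rightarrow> 'a. p 0 = x \<and> p N = y \<and> (\<forall>i. p i \<in> C) \<and> (\<forall>i. dist (p i) (p (Suc i)) < d)"
proof -
  obtain K where K: "finite K" "S \<subseteq> (\<Union>k\<in>K. ball k (d/2))"
    using compact_eq_totally_bounded[of S] assms by (meson half_gt_zero)
  define N where "N = Suc (Suc (card (K \<times> K)))"
  show ?thesis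
  proof
    show "2 \<le> N" by (simp add: N_def)
    fix C x y assume C: "connected C" "C \<subseteq> S" "x \<in> C" "y \<in> C"
    \<comment> \<open>Adjacency of balls means meeting inside \<open>C\<close>. As \<open>C\<close> is connected, every ball that
        meets \<open>C\<close> can be reached from the ball around \<open>k\<close> that contains \<open>x\<close>.\<close>
    define r where "r = {(k,l). k \<in> K \<and> l \<in> K \<and> ball k (d/2) \<inter> ball l (d/2) \<inter> C \<noteq> {}}"
    have "r \<subseteq> K \<times> K" by (auto simp: r_def)
    then have fr: "finite r" "card r \<le> card (K \<times> K)"
      using K(1) by (meson finite_SigmaI finite_subset, meson K(1) card_mono finite_SigmaI)
    obtain k where k: "k \<in> K" "x \<in> ball k (d/2)" using K C by blast
    define A where "A = (\<Union>l\<in>{l \<in> K. (k,l) \<in> r\<^sup>*}. ball l (d/2))"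
    define B where "B = (\<Union>l\<in>{l \<in> K. (k,l) \<notin> r\<^sup>*}. ball l (d/2))"
    have "x \<in> A" unfolding A_def using k by blast
    then have "A \<inter> C \<noteq> {}" using C by blast
    moreover have "C \<subseteq> A \<union> B" 
    proof
      fix z assume "z \<in> C"
      then obtain l where "l \<in> K" "z \<in> ball l (d/2)" using K C by blast
      then show "z \<in> A \<union> B" unfolding A_def B_def by (cases "(k,l) \<in> r\<^sup>*") blast+
    qed
    moreover have "A \<inter> B \<inter> C = {}"
    proof (rule ccontr)
      assume "A \<inter> B \<inter> C \<noteq> {}"
      then obtain z where z: "z \<in> A" "z \<in> B" "z \<in> C" by blast
      obtain l where "l \<in> K" "(k,l) \<in> r\<^sup>*" "z \<in> ball l (d/2)"
        using z(1) unfolding A_def by blast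
      moreover obtain m where "m \<in> K" "(k,m) \<notin> r\<^sup>*" "z \<in> ball m (d/2)"
        using z(2) unfolding B_def by blast
      ultimately have "(l,m) \<in> r" using z(3) unfolding r_def by blast
      with \<open>(k,l) \<in> r\<^sup>*\<close> have "(k,m) \<in> r\<^sup>*" by (rule rtrancl_into_rtrancl)
      with \<open>(k,m) \<notin> r\<^sup>*\<close> show False by contradiction
    qed
    moreover have "open A" "open B" by (auto simp: A_def B_def)
    ultimately have "B \<inter> C = {}" using connectedD[OF C(1), of A B] by blast
    then have "y \<in> A" using \<open>C \<subseteq> A \<union> B\<close> C by blast
    then obtain l where l: "l \<in> K" "(k,l) \<in> r\<^sup>*" "y \<in> ball l (d/2)" by (auto simp: A_def)
    then obtain n where n: "n \<le> card r" "(k,l) \<in> r ^^ n"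
      using rtrancl_finite_eq_relpow[OF fr(1)] by auto
    then obtain f where f: "f 0 = k" "f n = l" "\<forall>i<n. (f i, f (Suc i)) \<in> r"
      by (auto simp: relpow_fun_conv)
    then have "\<forall>i<n. \<exists>c. c \<in> ball (f i) (d/2) \<inter> ball (f (Suc i)) (d/2) \<inter> C"
      by (fastforce simp: r_def)
    then obtain c where c: "\<And>i. i < n \<Longrightarrow> c i \<in> ball (f i) (d/2) \<inter> ball (f (Suc i)) (d/2) \<inter> C"
      by metis
    \<comment> \<open>The constant tail \<open>y\<close> pads the chain to the common length \<open>N\<close>.\<close>
    define p where "p i = (if i = 0 then x else if i \<le> n then c (i - 1) else y)" for i
    have "p 0 = x" "p N = y" using n fr by (auto simp: p_def N_def)
    moreover have "p i \<in> C" for i using c C by (auto simp: p_def Suc_le_eq)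
    moreover have "dist (p i) (p (Suc i)) < d" for i
    proof -
      have *: "dist u v < d" if "u \<in> ball q (d/2)" "v \<in> ball q (d/2)" for u v q
        using that dist_triangle_half_r[of q u d v] by simp
      have L: "p i \<in> ball (f i) (d/2)" if "i \<le> n"
      proof (cases i)
        case 0 then show ?thesis using k f by (simp add: p_def)
      next
        case (Suc j) then show ?thesis using c[of j] that by (simp add: p_def)
      qed
      have R: "p (Suc i) \<in> ball (f i) (d/2)" if "i \<le> n"
        using c[of i] that l f by (cases "i = n") (auto simp: p_def)
      show ?thesis
      proof (cases "i \<le> n")
        case True with L R * show ?thesis by blast
      next
        case False then show ?thesis using \<open>0 < d\<close> by (simp add: p_def)
      qed
    qed
    ultimately show "\<exists>p. p 0 = x \<and> p N = y \<and> (\<forall>i. p i \<in> C) \<and> (\<forall>i. dist (p i) (p (Suc i)) < d)"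
      by blast
  qed
qed

definition joined_within :: "'a::metric_space set \<Rightarrow> real \<Rightarrow> 'a \<Rightarrow> 'a \<Rightarrow> bool" where
  "joined_within S e x y \<longleftrightarrow>
     (\<exists>C. connected C \<and> C \<subseteq> S \<and> x \<in> C \<and> y \<in> C \<and> (\<forall>z\<in>C. dist x z < e))"

lemma joined_within_refl: "\<lbrakk>x \<in> S; 0 < e\<rbrakk> \<Longrightarrow> joined_within S e x x"
  unfolding joined_within_def by (rule exI[of _ "{x}"]) auto

text \<open>Start with the two points \<open>x\<close>, \<open>y\<close> and fill each gap of generation \<open>k\<close> with \<open>N k\<close> smaller ones.
  Read as step functions on the unit interval, the generations form a uniform Cauchy sequence. Its limit
  is continuous although the step functions are not, because their jumps tend to zero.\<close>

lemma refinement_path: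
  fixes S :: "'a::metric_space set" and e0 :: real
  assumes "compact S" and e0: "0 < e0"
    and N: "\<And>k. (2::nat) \<le> N k"
    and ref: "\<And>k x y. joined_within S (e0 / 2^k) x y \<Longrightarrow>
       \<exists>p::nat \<Rightarrow> 'a. p 0 = x \<and> p (N k) = y \<and> (\<forall>i. dist x (p i) < e0 / 2^k) \<and>
           (\<forall>i. joined_within S (e0 / 2^Suc k) (p i) (p (Suc i)))"
    and xy: "joined_within S e0 x y"
  obtains g where "path g" "path_image g \<subseteq> S \<inter> cball x (3 * e0)" "pathstart g = x" "pathfinish g = y"
proof -
  define E where "E k = e0 / 2^k" for k :: nat
  have E: "0 < E k" "2 * E (Suc k) = E k" for k using e0 by (auto simp: E_def)
  have inS: "x \<in> S \<and> y \<in> S" if "joined_within S e x y" for e x y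
    using that by (auto simp: joined_within_def)
  have "\<forall>k x y. \<exists>p::nat \<Rightarrow> 'a. joined_within S (E k) x y \<longrightarrow> p 0 = x \<and> p (N k) = y \<and>
      (\<forall>i. dist x (p i) < E k) \<and> (\<forall>i. joined_within S (E (Suc k)) (p i) (p (Suc i)))"
    using ref unfolding E_def by blast
  then obtain R :: "nat \<Rightarrow> 'a \<Rightarrow> 'a \<Rightarrow> nat \<Rightarrow> 'a"
    where R: "\<And>k x y. joined_within S (E k) x y \<Longrightarrow> R k x y 0 = x \<and> R k x y (N k) = y \<and>
      (\<forall>i. dist x (R k x y i) < E k) \<and> (\<forall>i. joined_within S (E (Suc k)) (R k x y i) (R k x y (Suc i)))"
    by metis
  \<comment> \<open>Generation \<open>Suc k\<close> puts the indices \<open>q * N k\<close> up to \<open>q * N k + N k\<close> into the gap between the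
      points \<open>q\<close> and \<open>Suc q\<close> of generation \<open>k\<close>. All natural numbers serve as indices, so that no
      bounds have to be carried along; only those up to \<open>M k\<close> enter the path.\<close>
  define f :: "nat \<Rightarrow> nat \<Rightarrow> 'a" where
    "f = rec_nat (\<lambda>i. if i = 0 then x else y)
           (\<lambda>k h i. R k (h (i div N k)) (h (Suc (i div N k))) (i mod N k))"
  have f0: "f 0 i = (if i = 0 then x else y)" for i by (simp add: f_def)
  have fS: "f (Suc k) i = R k (f k (i div N k)) (f k (Suc (i div N k))) (i mod N k)" for k i
    by (simp add: f_def)
  have J: "joined_within S (E k) (f k i) (f k (Suc i))" for k i
  proof (induction k arbitrary: i)
    case 0
    then show ?case using xy inS[OF xy] e0 joined_within_refl by (auto simp: f0 E_def)
  next
    case (Suc k)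
    note r = R[OF Suc.IH]
    show ?case
    proof (cases "Suc (i mod N k) = N k")
      case True
      then have 1: "Suc i div N k = Suc (i div N k)" "Suc i mod N k = 0"
        by (auto simp: div_Suc mod_Suc)
      then have "f (Suc k) (Suc i) = f k (Suc (i div N k))" using r by (simp add: fS)
      also have "\<dots> = R k (f k (i div N k)) (f k (Suc (i div N k))) (Suc (i mod N k))"
        using True r by simp
      finally show ?thesis using r by (simp add: fS)
    next
      case False
      then have "Suc i div N k = i div N k" "Suc i mod N k = Suc (i mod N k)"
        by (auto simp: div_Suc mod_Suc)
      then show ?thesis using r by (simp add: fS)
    qed
  qed
  define M where "M k = (\<Prod>j<k. N j)" for k
  have M0: "M 0 = 1" and MS: "M (Suc k) = M k * N k" for k by (auto simp: M_def)
  have Mge: "2^k \<le> M k" for k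
  proof (induction k)
    case (Suc k) then show ?case using mult_le_mono[OF Suc N[of k]] by (simp add: MS)
  qed (simp add: M0)
  define F where "F k t = f k (nat \<lfloor>t * real (M k)\<rfloor>)" for k and t :: real
  \<comment> \<open>Dividing the index of \<open>t\<close> in generation \<open>Suc k\<close> by \<open>N k\<close> gives its index in generation \<open>k\<close>.\<close>
  have step: "dist (F k t) (F (Suc k) t) < E k" for k t
  proof -
    have Np: "0 < N k" using N[of k] by linarith
    have "\<lfloor>t * real (M (Suc k))\<rfloor> div int (N k) = \<lfloor>t * real (M (Suc k)) / real (N k)\<rfloor>"
      using floor_divide_real_eq_div[of "int (N k)" "t * real (M (Suc k))"] by simp
    also have "t * real (M (Suc k)) / real (N k) = t * real (M k)"
      using Np by (simp add: MS)
    finally have "nat \<lfloor>t * real (M (Suc k))\<rfloor> div N k = nat \<lfloor>t * real (M k)\<rfloor>"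
      by (metis nat_div_distrib' nat_int of_nat_0_le_iff)
    then show ?thesis unfolding F_def fS using R[OF J] by simp
  qed
  have FS: "F k t \<in> S" for k t using inS[OF J] by (auto simp: F_def)
  have tail: "dist (F k t) (F (k + m) t) \<le> 2 * E k - 2 * E (k + m)" for k m t
  proof (induction m)
    case (Suc m)
    have "dist (F k t) (F (k + Suc m) t) \<le> dist (F k t) (F (k + m) t) + dist (F (k + m) t) (F (Suc (k + m)) t)"
      by (simp add: dist_triangle)
    with Suc step[of "k + m" t] E(2)[of "k + m"] show ?case by simp
  qed simp
  have tail': "dist (F k t) (F m t) < 2 * E k" if "k \<le> m" for k m t
    using tail[of k t "m - k"] E(1)[of m] that by simp
  have Elim: "\<exists>k. c * E k < e" if ec: "0 < e" "0 < c" for e c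
  proof -
    obtain k where "(1/2)^k < e / (c * e0)" using real_arch_pow_inv[of "e/(c*e0)" "1/2"] ec e0 by auto
    then show ?thesis using ec e0 by (intro exI[of _ k]) (simp add: E_def field_simps)
  qed
  have "Cauchy (\<lambda>k. F k t)" for t
  proof (rule metric_CauchyI)
    fix e :: real assume "0 < e"
    then obtain k where k: "4 * E k < e" using Elim[of e 4] by auto
    have "dist (F m t) (F n t) < e" if "k \<le> m" "k \<le> n" for m n
      using tail'[OF that(1), of t] tail'[OF that(2), of t] k dist_triangle3[of "F m t" "F n t" "F k t"] by linarith
    then show "\<exists>M. \<forall>m\<ge>M. \<forall>n\<ge>M. dist (F m t) (F n t) < e" by blast
  qed
  then have "\<exists>l\<in>S. (\<lambda>k. F k t) \<longlonglongrightarrow> l" for t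
    using compact_imp_complete[OF \<open>compact S\<close>, unfolded complete_def, rule_format, of "\<lambda>k. F k t"] FS
    by simp
  then obtain g where g: "\<And>t. g t \<in> S" "\<And>t. (\<lambda>k. F k t) \<longlonglongrightarrow> g t" by metis
  have Fg: "dist (F k t) (g t) \<le> 2 * E k" for k t
  proof (rule tendsto_upperbound)
    show "(\<lambda>m. dist (F k t) (F m t)) \<longlonglongrightarrow> dist (F k t) (g t)"
      by (intro tendsto_intros g)
    show "\<forall>\<^sub>F m in sequentially. dist (F k t) (F m t) \<le> 2 * E k"
      using tail' by (metis (mono_tags, lifting) eventually_sequentially less_imp_le)
  qed simp
  have cont: "continuous_on {0..1} g"
  proof (rule continuous_on_iff[THEN iffD2], intro ballI allI impI)
    fix t e :: real assume t: "t \<in> {0..1}" and "0 < e"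
    then obtain k where k: "5 * E k < e" using Elim[of e 5] by auto
    have Mp: "0 < M k" using Mge[of k] by (meson less_le_trans zero_less_numeral zero_less_power)
    \<comment> \<open>Times that differ by less than \<open>1 / M k\<close> belong to the same or to neighbouring indices.\<close>
    have *: "dist (F k s) (F k t) < E k" if "s \<le> t" "t - s < 1 / M k" "0 \<le> s" for s t
    proof -
      have "t * M k < s * M k + 1" using that(2) Mp by (simp add: field_simps)
      then have "\<lfloor>t * M k\<rfloor> \<le> \<lfloor>s * M k\<rfloor> + 1" by linarith
      moreover have "\<lfloor>s * M k\<rfloor> \<le> \<lfloor>t * M k\<rfloor>" using that by (intro floor_mono mult_right_mono) auto
      moreover have "0 \<le> \<lfloor>s * M k\<rfloor>" using that by simp
      ultimately have "nat \<lfloor>t * M k\<rfloor> = nat \<lfloor>s * M k\<rfloor> \<or> nat \<lfloor>t * M k\<rfloor> = Suc (nat \<lfloor>s * M k\<rfloor>)"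
        by linarith
      then show ?thesis
      proof
        assume "nat \<lfloor>t * M k\<rfloor> = nat \<lfloor>s * M k\<rfloor>" then show ?thesis using E(1) by (simp add: F_def)
      next
        assume "nat \<lfloor>t * M k\<rfloor> = Suc (nat \<lfloor>s * M k\<rfloor>)"
        then show ?thesis using J[of k "nat \<lfloor>s * M k\<rfloor>"] unfolding F_def joined_within_def by auto
      qed
    qed
    show "\<exists>d>0. \<forall>s\<in>{0..1}. dist s t < d \<longrightarrow> dist (g s) (g t) < e"
    proof (intro exI[of _ "1 / M k"] conjI ballI impI)
      show "0 < 1 / real (M k)" using Mp by simp
      fix s :: real assume s: "s \<in> {0..1}" "dist s t < 1 / M k"
      have "dist (F k s) (F k t) < E k"
      proof (cases "s \<le> t")
        case True with * s show ?thesis by (auto simp: dist_real_def)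
      next
        case False with *[of t s] s t show ?thesis by (auto simp: dist_real_def dist_commute)
      qed
      moreover have "dist (g s) (g t) \<le> dist (F k s) (g s) + dist (F k s) (F k t) + dist (F k t) (g t)"
        using dist_triangle[of "g s" "g t" "F k s"] dist_triangle[of "F k s" "g t" "F k t"]
        by (simp add: dist_commute)
      ultimately show "dist (g s) (g t) < e" using Fg[of k s] Fg[of k t] k by linarith
    qed
  qed
  have f00: "f k 0 = x" for k
    by (induction k) (use R[OF J] in \<open>auto simp: f0 fS\<close>)
  have f1: "f k (M k) = y" for k
  proof (induction k)
    case (Suc k)
    have "0 < N k" using N[of k] by linarith
    then show ?case using Suc R[OF J[of k "M k"]] by (simp add: fS MS)
  qed (simp add: f0 M0)
  show ?thesis
  proof
    show "path g" using cont by (simp add: path_def)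
    have "dist x (g t) \<le> 3 * e0" for t
    proof -
      have "F 0 t = x \<or> F 0 t = y" by (simp add: F_def f0)
      moreover have "dist x y < e0" using xy by (auto simp: joined_within_def)
      ultimately have "dist x (F 0 t) \<le> e0" using e0 by auto
      then show ?thesis using Fg[of 0 t] dist_triangle[of x "g t" "F 0 t"] by (simp add: E_def)
    qed
    then show "path_image g \<subseteq> S \<inter> cball x (3 * e0)" using g(1) by (auto simp: path_image_def)
    have "(\<lambda>k. F k 0) \<longlonglongrightarrow> x" "(\<lambda>k. F k 1) \<longlonglongrightarrow> y" by (simp_all add: F_def f00 f1)
    then show "pathstart g = x" "pathfinish g = y"
      using g(2) LIMSEQ_unique unfolding pathstart_def pathfinish_def by blast+
  qed
qed

text \<open>The essential part of the arc theorem of Mazurkiewicz and Moore. The control on the size of the path in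
  \<open>refinement_path\<close> is what makes the conclusion local.\<close>

lemma locally_connected_imp_locally_path_connected_compact:
  fixes S :: "'a::metric_space set"
  assumes "compact S" and lc: "locally_connected_space (top_of_set S)"
  shows "locally path_connected S"
proof -
  have paths: "\<exists>d>0. \<forall>x\<in>S. \<forall>y\<in>S. dist x y < d \<longrightarrow>
      (\<exists>g. path g \<and> path_image g \<subseteq> S \<inter> cball x (3 * e0) \<and> pathstart g = x \<and> pathfinish g = y)"
    if e0: "0 < e0" for e0
  proof -
    have "\<forall>k. \<exists>d>0. \<forall>x\<in>S. \<forall>y\<in>S. dist x y < d \<longrightarrow> joined_within S (e0/2^k) x y"
      unfolding joined_within_def using uniformly_locally_connected[OF assms]  e0
      by (metis divide_pos_pos zero_less_numeral zero_less_power)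
    then obtain d where d: "\<And>k. 0 < d k"
       "\<And>k x y. \<lbrakk>x\<in>S; y\<in>S; dist x y < d k\<rbrakk> \<Longrightarrow> joined_within S (e0/2^k) x y"
      by metis
    have "\<forall>k. \<exists>N\<ge>2. \<forall>C x y. connected C \<and> C \<subseteq> S \<and> x \<in> C \<and> y \<in> C \<longrightarrow>
       (\<exists>p::nat \<Rightarrow> 'a. p 0 = x \<and> p N = y \<and> (\<forall>i. p i \<in> C) \<and> (\<forall>i. dist (p i) (p (Suc i)) < d (Suc k)))"
      using uniform_chains[OF \<open>compact S\<close> d(1)] by metis
    then obtain N where N: "\<And>k. 2 \<le> N k" "\<And>k C x y. \<lbrakk>connected C; C \<subseteq> S; x \<in> C; y \<in> C\<rbrakk> \<Longrightarrow>
       \<exists>p::nat \<Rightarrow> 'a. p 0 = x \<and> p (N k) = y \<and> (\<forall>i. p i \<in> C) \<and> (\<forall>i. dist (p i) (p (Suc i)) < d (Suc k))"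
      by metis
    have ref: "\<exists>p::nat \<Rightarrow> 'a. p 0 = x \<and> p (N k) = y \<and> (\<forall>i. dist x (p i) < e0 / 2^k) \<and>
           (\<forall>i. joined_within S (e0 / 2^Suc k) (p i) (p (Suc i)))"
      if xy: "joined_within S (e0 / 2^k) x y" for k x y
    proof -
      obtain C where C: "connected C" "C \<subseteq> S" "x \<in> C" "y \<in> C" "\<forall>z\<in>C. dist x z < e0/2^k"
        using xy unfolding joined_within_def by blast
      obtain p where p: "p 0 = x" "p (N k) = y" "\<forall>i. p i \<in> C" "\<forall>i. dist (p i) (p (Suc i)) < d (Suc k)"
        using N(2)[OF C(1-4), of k] by blast
      have "p i \<in> S" for i using p(3) C(2) by blast
      then have "joined_within S (e0 / 2^Suc k) (p i) (p (Suc i))" for i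
        using d(2) p(4) by blast
      with C(5) p show ?thesis by (intro exI[of _ p]) simp
    qed
    have "\<exists>g. path g \<and> path_image g \<subseteq> S \<inter> cball x (3 * e0) \<and> pathstart g = x \<and> pathfinish g = y"
      if "x \<in> S" "y \<in> S" "dist x y < d 0" for x y
    proof -
      have "joined_within S e0 x y" using d(2)[OF that] by simp
      from refinement_path[OF \<open>compact S\<close> e0 N(1) ref this] show ?thesis by blast
    qed
    with d(1) show ?thesis by blast
  qed
  show ?thesis
    unfolding locally_path_connected_im_kleinen
  proof (intro allI impI, elim conjE)
    fix v x assume v: "openin (top_of_set S) v" and "x \<in> v"
    then obtain e where e: "0 < e" "S \<inter> ball x e \<subseteq> v"
      by (metis Int_commute openin_contains_ball)
    obtain d where d: "0 < d" "\<forall>x\<in>S. \<forall>y\<in>S. dist x y < d \<longrightarrow>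
      (\<exists>g. path g \<and> path_image g \<subseteq> S \<inter> cball x (3 * (e/6)) \<and> pathstart g = x \<and> pathfinish g = y)"
      using paths[of "e/6"] e by auto
    have xS: "x \<in> S" using v \<open>x \<in> v\<close> openin_imp_subset by blast
    have sub: "S \<inter> cball x (3 * (e/6)) \<subseteq> v" using e by (force simp: subset_iff)
    show "\<exists>u. openin (top_of_set S) u \<and> x \<in> u \<and> u \<subseteq> v \<and>
          (\<forall>y. y \<in> u \<longrightarrow> (\<exists>p. path p \<and> path_image p \<subseteq> v \<and> pathstart p = x \<and> pathfinish p = y))"
    proof (intro exI[of _ "S \<inter> ball x (min e d)"] conjI allI impI)
      show "openin (top_of_set S) (S \<inter> ball x (min e d))" by (simp add: openin_open_Int)
      show "x \<in> S \<inter> ball x (min e d)" using e d xS by simp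
      show "S \<inter> ball x (min e d) \<subseteq> v" using e by auto
      fix y assume "y \<in> S \<inter> ball x (min e d)"
      then have "y \<in> S" "dist x y < d" by auto
      then show "\<exists>p. path p \<and> path_image p \<subseteq> v \<and> pathstart p = x \<and> pathfinish p = y"
        using d(2) xS sub by (meson order_trans)
    qed
  qed
qed

section \<open>Arcs inside connected sets\<close>

text \<open>An excursion of \<open>g\<close> away from \<open>h\<close>, from the last point on \<open>h\<close> to the first point back on \<open>h\<close>, closes up
  along \<open>h\<close> to a simple loop.\<close>

lemma arc_image_subset_if_no_loop:
  fixes g h :: "real \<Rightarrow> 'a::real_normed_vector"
  assumes g: "arc g" and h: "arc h" and ends: "pathstart g = pathstart h" "pathfinish g = pathfinish h"
    and no_loop: "\<And>\<gamma>. \<lbrakk>simple_path \<gamma>; pathfinish \<gamma> = pathstart \<gamma>;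
                        path_image \<gamma> \<subseteq> path_image g \<union> path_image h\<rbrakk> \<Longrightarrow> False"
  shows "path_image g \<subseteq> path_image h"
proof (rule ccontr)
  assume "\<not> path_image g \<subseteq> path_image h"
  then obtain t where t: "t \<in> {0..1}" "g t \<notin> path_image h" unfolding path_image_def by blast
  have cg: "continuous_on {0..1} g" using g by (simp add: arc_def path_def)
  have cH: "closed (path_image h)" using h by (simp add: closed_path_image arc_imp_path)
  define A where "A = {0..t} \<inter> g -` path_image h"
  define B where "B = {t..1} \<inter> g -` path_image h"
  have "continuous_on {0..t} g" "continuous_on {t..1} g"
    using cg t by (auto elim: continuous_on_subset)
  then have "compact A" "compact B"
    unfolding A_def B_def compact_eq_bounded_closed using cH
    by (auto intro: continuous_closed_preimage bounded_Int)
  moreover have "0 \<in> A" "1 \<in> B"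
    using t ends h by (auto simp: A_def B_def pathstart_def pathfinish_def path_image_def)
  ultimately obtain a b where a: "a \<in> A" "\<And>s. s \<in> A \<Longrightarrow> s \<le> a" and b: "b \<in> B" "\<And>s. s \<in> B \<Longrightarrow> b \<le> s"
    using compact_attains_sup[of A] compact_attains_inf[of B] by blast
  have ab: "0 \<le> a" "a < t" "t < b" "b \<le> 1"
    using a(1) b(1) t unfolding A_def B_def by (auto simp: order_less_le)
  obtain u v where u: "u \<in> {0..1}" "g a = h u" and v: "v \<in> {0..1}" "g b = h v"
    using a(1) b(1) by (auto simp: A_def B_def path_image_def)
  have "g a \<noteq> g b"
    using g ab t inj_onD[of g "{0..1}" a b] by (auto simp: arc_def)
  then have "u \<noteq> v" using u v by auto
  define \<gamma> where "\<gamma> = subpath a b g +++ subpath v u h"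
  have arcs: "arc (subpath a b g)" "arc (subpath v u h)"
    using g h u v ab t \<open>u \<noteq> v\<close> by (auto intro!: arc_subpath_arc)
  have im: "path_image (subpath a b g) = g ` {a..b}" "path_image (subpath v u h) \<subseteq> path_image h"
    using ab u v path_image_subpath_subset[of v u h] by (auto simp: path_image_subpath)
  have "path_image (subpath a b g) \<inter> path_image (subpath v u h) \<subseteq> {g a, g b}"
  proof
    fix z assume z: "z \<in> path_image (subpath a b g) \<inter> path_image (subpath v u h)"
    then obtain s where s: "a \<le> s" "s \<le> b" "z = g s" using im by auto
    then have "g s \<in> path_image h" using z im by blast
    with s have "s \<in> A \<or> s \<in> B" using ab by (auto simp: A_def B_def)
    then have "s \<le> a \<or> b \<le> s" using a(2) b(2) by blast
    then show "z \<in> {g a, g b}" using s by auto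
  qed
  then have "simple_path \<gamma>"
    unfolding \<gamma>_def using arcs u v by (intro simple_path_join_loop) auto
  moreover have "pathfinish \<gamma> = pathstart \<gamma>" using u by (simp add: \<gamma>_def)
  moreover have "path_image \<gamma> \<subseteq> path_image g \<union> path_image h"
    unfolding \<gamma>_def using im ab by (subst path_image_join) (use v in \<open>auto simp: path_image_def\<close>)
  ultimately show False by (rule no_loop)
qed

lemma path_connected_if_locally_path_connected:
  assumes "locally path_connected U" and "connected U"
  shows "path_connected U"
  using assms by (simp add: path_connected_component connected_iff_connected_component
      path_component_eq_connected_component)

text \<open>If \<open>z\<close> lies on the arc but not in \<open>C\<close>, then \<open>C\<close> lies in a component of \<open>S - {z}\<close>. This component is
  open in \<open>S\<close>, hence path-connected, and so it contains a second arc with the same ends.\<close>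

lemma arc_subset_connected:
  fixes S :: "'a::{complete_space,real_normed_vector} set"
  assumes S: "locally path_connected S"
    and no_loop: "\<And>\<gamma>. \<lbrakk>simple_path \<gamma>; pathfinish \<gamma> = pathstart \<gamma>; path_image \<gamma> \<subseteq> S\<rbrakk> \<Longrightarrow> False"
    and g: "arc g" "path_image g \<subseteq> S"
    and C: "connected C" "C \<subseteq> S" "pathstart g \<in> C" "pathfinish g \<in> C"
  shows "path_image g \<subseteq> C"
proof
  fix z assume z: "z \<in> path_image g"
  show "z \<in> C"
  proof (rule ccontr)
    assume "z \<notin> C"
    define U where "U = connected_component_set (S - {z}) (pathstart g)"
    have CU: "C \<subseteq> U"
      unfolding U_def using C \<open>z \<notin> C\<close> by (intro connected_component_maximal) auto
    have "openin (top_of_set S) (S - {z})"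
      by (simp add: openin_delete)
    then have "openin (top_of_set S) U"
      using S[THEN locally_path_connected_imp_locally_connected] C \<open>z \<notin> C\<close>
      unfolding locally_connected_open_connected_component U_def by blast
    then have "locally path_connected U" using S by (metis locally_open_subset)
    then have "path_connected U"
      using path_connected_if_locally_path_connected U_def by auto
    moreover have "pathstart g \<noteq> pathfinish g" using arc_distinct_ends[OF g(1)] by simp
    ultimately obtain k where k: "arc k" "path_image k \<subseteq> U" "pathstart k = pathstart g" "pathfinish k = pathfinish g"
      using CU C unfolding path_connected_arcwise by blast
    have US: "U \<subseteq> S - {z}" unfolding U_def by (rule connected_component_subset)
    have "path_image g \<union> path_image k \<subseteq> S" using g(2) k(2) US by blast
    then have "path_image g \<subseteq> path_image k"
      using no_loop k(3,4)
      by (intro arc_image_subset_if_no_loop[OF g(1) k(1)]) (simp, simp, meson order_trans)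
    then show False using z k US by blast
  qed
qed

text \<open>The embedding of Frechet and Kuratowski, which sends a point to its distance function. It places \<open>X\<close>
  inside a complete normed space, where every path contains an arc. The arguments of the distance
  functions carry the discrete topology, so their continuity holds trivially.\<close>

lemma metrizable_compact_embeds_bcontfun:
  fixes X :: "'a topology"
  assumes "metrizable_space X" "compact_space X"
  obtains S :: "('a discrete \<Rightarrow>\<^sub>C real) set" and f where "homeomorphic_map X (top_of_set S) f"
proof -
  obtain M d where "Metric_space M d" and X: "X = Metric_space.mtopology M d"
    using assms unfolding metrizable_space_def by blast
  interpret Metric_space M d by fact
  show ?thesis
  proof -
    \<comment> \<open>Subtracting the distance to a base point makes the distance functions bounded.\<close>
    define o0 where "o0 = (SOME z. z \<in> M)"
    have o0: "o0 \<in> M" if "x \<in> M" for x using that unfolding o0_def by (rule someI)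
    define k where "k x i = (if of_discrete i \<in> M then d x (of_discrete i) - d o0 (of_discrete i) else 0)"
      for x and i :: "'a discrete"
    have kb: "k x \<in> bcontfun" if "x \<in> M" for x
    proof (rule bcontfun_normI)
      show "continuous_on UNIV (k x)"
        using open_discrete by (auto simp: continuous_on_open_vimage)
      show "norm (k x i) \<le> d x o0" for i
        using that o0[OF that] mdist_reverse_triangle[of x "of_discrete i" o0] triangle[of x o0 "of_discrete i"]
           triangle[of o0 x "of_discrete i"] by (auto simp: k_def commute[of o0 x])
    qed
    define \<phi> where "\<phi> x = Bcontfun (k x)" for x
    have \<phi>: "apply_bcontfun (\<phi> x) = k x" if "x \<in> M" for x
      unfolding \<phi>_def using kb[OF that] by (rule Bcontfun_inverse)
    have le: "dist (\<phi> x) (\<phi> y) \<le> d x y" if "x \<in> M" "y \<in> M" for x y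
    proof (rule dist_bound)
      fix i
      show "dist (apply_bcontfun (\<phi> x) i) (apply_bcontfun (\<phi> y) i) \<le> d x y"
        using that triangle[of x y "of_discrete i"] triangle[of y x "of_discrete i"] commute[of x y]
        by (auto simp: \<phi> k_def dist_real_def)
    qed
    have "inj_on \<phi> M"
    proof (rule inj_onI)
      fix x y assume xy: "x \<in> M" "y \<in> M" "\<phi> x = \<phi> y"
      then have "k x (discrete y) = k y (discrete y)" by (metis \<phi>)
      then show "x = y" using xy by (simp add: k_def discrete_inverse)
    qed
    moreover have "continuous_map X (top_of_set (\<phi> ` M)) \<phi>"
    proof -
      have "openin mtopology {x \<in> M. \<phi> x \<in> U}" if "open U" for U
        unfolding openin_mtopology
      proof (intro conjI allI impI)
        fix x assume "x \<in> {x \<in> M. \<phi> x \<in> U}"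
        then obtain e where "0 < e" "ball (\<phi> x) e \<subseteq> U" "x \<in> M"
          using \<open>open U\<close> open_contains_ball by blast
        with le show "\<exists>r>0. mball x r \<subseteq> {x \<in> M. \<phi> x \<in> U}"
          by (intro exI[of _ e]) (force simp: subset_iff)
      qed auto
      then have "continuous_map X euclidean \<phi>" by (auto simp: X continuous_map_def)
      then show ?thesis by (auto simp: X continuous_map_in_subtopology)
    qed
    ultimately have "homeomorphic_map X (top_of_set (\<phi> ` M)) \<phi>"
      using assms by (intro continuous_imp_homeomorphic_map) (auto simp: X Hausdorff_space_subtopology)
    then show ?thesis by (rule that)
  qed
qed

text \<open>The only consequence of the absence of simple closed curves that the rest of the argument uses.\<close>

theorem dendrite_arcs:
  fixes X :: "'a topology"
  assumes X: "dendrite X" and xy: "x \<in> topspace X" "y \<in> topspace X" "x \<noteq> y"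
  obtains I g where "arc_param X I g" "g 0 = x" "g 1 = y"
    "\<And>C. \<lbrakk>connectedin X C; x \<in> C; y \<in> C\<rbrakk> \<Longrightarrow> I \<subseteq> C"
proof -
  have lc: "locally_connected_space X" and con: "connected_space X" and cpt: "compact_space X"
    and met: "metrizable_space X" and no_circle: "\<And>C. \<not> simple_closed_curve_in X C"
    using X by (auto simp: dendrite_def)
  obtain S :: "('a discrete \<Rightarrow>\<^sub>C real) set" and f where f: "homeomorphic_map X (top_of_set S) f"
    using metrizable_compact_embeds_bcontfun[OF met cpt] .
  obtain h where fh_maps: "homeomorphic_maps X (top_of_set S) f h"
    using f homeomorphic_map_maps by blast
  then have h: "homeomorphic_map (top_of_set S) X h"
    by (simp add: homeomorphic_maps_map)
  have hf: "h (f x) = x" if "x \<in> topspace X" for x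
    using fh_maps that by (simp add: homeomorphic_maps_def)
  have fh: "f (h s) = s" if "s \<in> S" for s
    using fh_maps that by (simp add: homeomorphic_maps_def)
  have homS: "X homeomorphic_space top_of_set S"
    using f homeomorphic_map_imp_homeomorphic_space by blast
  have "compact_space (top_of_set S)" "connected_space (top_of_set S)"
    and lcS: "locally_connected_space (top_of_set S)"
    using homeomorphic_compact_space[OF homS] homeomorphic_connected_space[OF homS]
      homeomorphic_locally_connected_space[OF homS] cpt con lc by blast+
  then have "compactin euclidean S" "connectedin euclidean S"
    by (simp_all add: compactin_subspace connectedin_def)
  then have "compact S" "connected S" by simp_all
  then have lpc: "locally path_connected S"
    using locally_connected_imp_locally_path_connected_compact lcS by blast
  then have "path_connected S" using \<open>connected S\<close> using path_connected_if_locally_path_connected by auto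
  have hS: "h ` S = topspace X" using homeomorphic_imp_surjective_map[OF h] by simp
  have fX: "f ` topspace X = S" using homeomorphic_imp_surjective_map[OF f] by simp
  have no_loop: False if \<gamma>: "simple_path \<gamma>" "pathfinish \<gamma> = pathstart \<gamma>" "path_image \<gamma> \<subseteq> S" for \<gamma>
  proof -
    have "path_image \<gamma> homeomorphic sphere (0::complex) 1"
      using \<gamma> by (intro homeomorphic_simple_path_image_circle) auto
    then obtain u v where uv: "homeomorphism (path_image \<gamma>) (sphere (0::complex) 1) u v"
      unfolding homeomorphic_def by blast
    have "homeomorphic_maps (top_of_set (path_image \<gamma>)) (top_of_set (sphere (0::complex) 1)) u v"
      using uv unfolding homeomorphism_def homeomorphic_maps_def by auto
    then have 1: "top_of_set (path_image \<gamma>) homeomorphic_space top_of_set (sphere (0::complex) 1)"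
      unfolding homeomorphic_space_def by blast
    have "homeomorphic_map (subtopology (top_of_set S) (path_image \<gamma>)) (subtopology X (h ` path_image \<gamma>)) h"
      using h by (rule homeomorphic_map_subtopologies) (use \<gamma>(3) hS in auto)
    moreover have "subtopology (top_of_set S) (path_image \<gamma>) = top_of_set (path_image \<gamma>)"
      using \<gamma>(3) by (simp add: subtopology_subtopology inf_absorb2)
    ultimately have "top_of_set (path_image \<gamma>) homeomorphic_space subtopology X (h ` path_image \<gamma>)"
      using homeomorphic_map_imp_homeomorphic_space by metis
    then have "subtopology X (h ` path_image \<gamma>) homeomorphic_space top_of_set (sphere (0::complex) 1)"
      using 1 by (metis homeomorphic_space_sym homeomorphic_space_trans)
    then have "simple_closed_curve_in X (h ` path_image \<gamma>)"
      unfolding simple_closed_curve_in_def using hS \<gamma>(3) by blast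
    with no_circle show False by blast
  qed
  have "f x \<in> S" "f y \<in> S" using xy fX by auto
  moreover have "f x \<noteq> f y" using hf[OF xy(1)] hf[OF xy(2)] xy(3) by auto
  ultimately obtain p where p: "arc p" "path_image p \<subseteq> S" "pathstart p = f x" "pathfinish p = f y"
    using \<open>path_connected S\<close> unfolding path_connected_arcwise by blast
  show ?thesis
  proof
    have contp: "continuous_map (top_of_set {0..1}) (top_of_set S) p"
      using p by (auto simp: arc_def path_def path_image_def)
    have "continuous_map (top_of_set {0..1}) X (h \<circ> p)"
      using contp homeomorphic_imp_continuous_map[OF h] by (rule continuous_map_compose)
    moreover have "inj_on (h \<circ> p) {0..1}"
    proof (rule inj_onI)
      fix s t assume st: "s \<in> {0..1}" "t \<in> {0..1}" "(h \<circ> p) s = (h \<circ> p) t"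
      then have "p s \<in> S" "p t \<in> S" using p(2) unfolding path_image_def by blast+
      then have "p s = p t" using st(3) fh by (metis comp_apply)
      then show "s = t" using p(1) st(1,2) unfolding arc_def inj_on_def by blast
    qed
    moreover have sub: "h ` path_image p \<subseteq> topspace X" using p(2) hS by blast
    moreover have "Hausdorff_space (subtopology X (h ` path_image p))"
      using met by (intro Hausdorff_space_subtopology metrizable_imp_Hausdorff_space)
    moreover have "(h \<circ> p) ` {0..1} = h ` path_image p" by (simp add: path_image_def image_comp)
    moreover have "compact_space (top_of_set {0..1::real})"
      by (simp add: compact_space_subtopology)
    ultimately have "homeomorphic_map (top_of_set {0..1}) (subtopology X (h ` path_image p)) (h \<circ> p)"
      by (intro continuous_imp_homeomorphic_map)
        (simp_all add: continuous_map_in_subtopology inf_absorb2 flip: image_subset_iff_funcset)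
    then show "arc_param X (h ` path_image p) (h \<circ> p)"
      using sub by (simp add: arc_param_def)
    show "(h \<circ> p) 0 = x" "(h \<circ> p) 1 = y"
      using p(3,4) hf xy(1,2) by (simp_all add: pathstart_def pathfinish_def)
    fix C assume C: "connectedin X C" "x \<in> C" "y \<in> C"
    have CX: "C \<subseteq> topspace X" using C connectedin_subset_topspace by blast
    have "connectedin (top_of_set S) (f ` C)"
      using C(1) homeomorphic_map_connectedness_eq[OF f] by blast
    then have "connected (f ` C)" "f ` C \<subseteq> S"
      by (simp_all add: connectedin_subtopology)
    moreover have "pathstart p \<in> f ` C" "pathfinish p \<in> f ` C" using p(3,4) C(2,3) by simp_all
    ultimately have "path_image p \<subseteq> f ` C"
      by (intro arc_subset_connected[OF lpc _ p(1,2)]) (rule no_loop, simp_all)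
    then show "h ` path_image p \<subseteq> C"
    proof (rule order_trans[OF image_mono])
      show "h ` f ` C \<subseteq> C" using hf CX by fastforce
    qed
  qed
qed

section \<open>Segments of a dendrite\<close>

locale dendrite_space =
  fixes X :: "'a topology"
  assumes dendrite_X: "dendrite X"
begin

abbreviation "T \<equiv> topspace X"

lemma Hausdorff_X: "Hausdorff_space X"
  and compact_X: "compact_space X"
  and connected_X: "connected_space X"
  and locally_connected_X: "locally_connected_space X"
  using dendrite_X by (auto simp: dendrite_def metrizable_imp_Hausdorff_space)

text \<open>For distinct points of a dendrite this is the arc between them (\<open>seg_arc\<close>). As an intersection of all
  connected sets containing both points it needs no choice of a parametrisation.\<close>

definition seg :: "'a \<Rightarrow> 'a \<Rightarrow> 'a set" where
  "seg x y = \<Inter>{C. connectedin X C \<and> x \<in> C \<and> y \<in> C}"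

lemma seg_commute: "seg x y = seg y x"
  unfolding seg_def by (rule arg_cong[where f=Inter]) auto

lemma seg_subset_connected: "\<lbrakk>connectedin X C; x \<in> C; y \<in> C\<rbrakk> \<Longrightarrow> seg x y \<subseteq> C"
  by (auto simp: seg_def)

lemma ends_in_seg [simp]: "x \<in> seg x y" "y \<in> seg x y"
  by (auto simp: seg_def)

lemma seg_refl: "x \<in> T \<Longrightarrow> seg x x = {x}"
  using seg_subset_connected[of "{x}" x x] by auto

lemma connectedin_arc: "arc_param X I g \<Longrightarrow> connectedin X I"
proof -
  assume g: "arc_param X I g"
  have "connected_space (top_of_set {0..1::real})"
    using connectedin_def[of euclidean "{0..1::real}"] by (simp add: connected_Icc)
  then have "connected_space (subtopology X I)"
    using g homeomorphic_connected_space homeomorphic_map_imp_homeomorphic_space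
    unfolding arc_param_def by blast
  then show ?thesis using g by (simp add: connectedin_def arc_param_def)
qed

lemma arc_param_props:
  assumes "arc_param X I g"
  shows "g ` {0..1} = I" "inj_on g {0..1}" "continuous_map (top_of_set {0..1}) X g" "g 0 \<noteq> g 1"
    "g 0 \<in> I" "g 1 \<in> I" "I \<subseteq> T"
proof -
  have h: "homeomorphic_map (top_of_set {0..1}) (subtopology X I) g" and I: "I \<subseteq> T"
    using assms by (auto simp: arc_param_def)
  show "I \<subseteq> T" by (rule I)
  show im: "g ` {0..1} = I"
    using homeomorphic_imp_surjective_map[OF h] I by auto
  show inj: "inj_on g {0..1}"
    using homeomorphic_imp_injective_map[OF h] by simp
  show "continuous_map (top_of_set {0..1}) X g"
    using homeomorphic_imp_continuous_map[OF h] continuous_map_in_subtopology by blast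
  show "g 0 \<noteq> g 1" using inj_onD[OF inj, of 0 1] by auto
  show "g 0 \<in> I" "g 1 \<in> I" using im by auto
qed

lemma connectedin_arc_param_image:
  assumes "arc_param X I g" "connected S" "S \<subseteq> {0..1}"
  shows "connectedin X (g ` S)"
  using arc_param_props(3)[OF assms(1)]
  by (rule connectedin_continuous_map_image) (use assms in \<open>simp add: connectedin_subtopology\<close>)

text \<open>In the parameter interval a connected set that contains 0 and 1 is everything.\<close>

lemma connected_subset_arc_eq:
  assumes g: "arc_param X I g" and C: "connectedin X C" "C \<subseteq> I" "g 0 \<in> C" "g 1 \<in> C"
  shows "C = I"
proof -
  obtain k where k: "homeomorphic_maps (top_of_set {0..1}) (subtopology X I) g k"
    using g homeomorphic_map_maps unfolding arc_param_def by blast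
  then have "continuous_map (subtopology X I) (top_of_set {0..1}) k"
    by (simp add: homeomorphic_maps_def)
  moreover have "connectedin (subtopology X I) C" using C by (simp add: connectedin_subtopology)
  ultimately have "connectedin (top_of_set {0..1}) (k ` C)"
    by (rule connectedin_continuous_map_image)
  then have conn: "connected (k ` C)" by (simp add: connectedin_subtopology)
  have kg: "k (g t) = t" if "t \<in> {0..1}" for t using k that by (simp add: homeomorphic_maps_def)
  have "0 \<in> k ` C" "1 \<in> k ` C" using C(3,4) kg[of 0] kg[of 1] by force+
  then have sub: "{0..1} \<subseteq> k ` C" using conn connected_contains_Icc by blast
  have "I \<subseteq> C"
  proof
    fix x assume "x \<in> I"
    then obtain t where t: "t \<in> {0..1}" "x = g t" using arc_param_props(1)[OF g] by blast
    then obtain c where c: "c \<in> C" "k c = t" using sub by blast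
    then obtain s where "s \<in> {0..1}" "c = g s" using C(2) arc_param_props(1)[OF g] by blast
    then show "x \<in> C" using kg c t by metis
  qed
  then show ?thesis using C(2) by blast
qed

lemma arc_eq_seg:
  assumes "arc_param X I g" shows "I = seg (g 0) (g 1)"
proof -
  have ends: "g 0 \<in> T" "g 1 \<in> T" "g 0 \<noteq> g 1" using arc_param_props[OF assms] by auto
  obtain J k where J: "arc_param X J k" "k 0 = g 0" "k 1 = g 1"
      "\<And>C. \<lbrakk>connectedin X C; g 0 \<in> C; g 1 \<in> C\<rbrakk> \<Longrightarrow> J \<subseteq> C"
    using dendrite_arcs[OF dendrite_X ends] by blast
  have "J \<subseteq> I" using J(4) connectedin_arc[OF assms] arc_param_props(5,6)[OF assms] by blast
  then have "J = I"
    using connected_subset_arc_eq[OF assms connectedin_arc[OF J(1)]] J(2,3) arc_param_props(5,6)[OF J(1)]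
    by simp
  then show ?thesis
    using J(4) connectedin_arc[OF assms] arc_param_props(5,6)[OF assms]
    by (intro equalityI seg_subset_connected) (auto simp: seg_def)
qed

lemma seg_arc:
  assumes "x \<in> T" "y \<in> T" "x \<noteq> y"
  obtains g where "arc_param X (seg x y) g" "g 0 = x" "g 1 = y"
  using dendrite_arcs[OF dendrite_X assms] arc_eq_seg by metis

lemma connectedin_seg: "\<lbrakk>x \<in> T; y \<in> T\<rbrakk> \<Longrightarrow> connectedin X (seg x y)"
  by (cases "x = y") (auto simp: seg_refl elim: seg_arc intro: connectedin_arc)

lemma seg_subset_T: "\<lbrakk>x \<in> T; y \<in> T\<rbrakk> \<Longrightarrow> seg x y \<subseteq> T"
  using connectedin_seg connectedin_subset_topspace by blast

lemma in_T_if_in_seg: "\<lbrakk>z \<in> seg x y; x \<in> T; y \<in> T\<rbrakk> \<Longrightarrow> z \<in> T"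
  using seg_subset_T by blast

lemma compactin_seg: "\<lbrakk>x \<in> T; y \<in> T\<rbrakk> \<Longrightarrow> compactin X (seg x y)"
proof (cases "x = y")
  case False
  assume "x \<in> T" "y \<in> T"
  then obtain g where g: "arc_param X (seg x y) g" using seg_arc False by metis
  have "compactin X (g ` {0..1})"
    by (rule image_compactin[OF _ arc_param_props(3)[OF g]]) (simp add: compactin_subtopology)
  then show ?thesis using arc_param_props(1)[OF g] by simp
qed (simp add: seg_refl)

lemma closedin_seg: "\<lbrakk>x \<in> T; y \<in> T\<rbrakk> \<Longrightarrow> closedin X (seg x y)"
  using compactin_seg compactin_imp_closedin Hausdorff_X by blast

lemma connectedin_if_segs:
  assumes "S \<subseteq> T" "\<And>x y. \<lbrakk>x \<in> S; y \<in> S\<rbrakk> \<Longrightarrow> seg x y \<subseteq> S"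
  shows "connectedin X S"
proof -
  have "connected_space (subtopology X S)"
    unfolding connected_space_subconnected
  proof (intro ballI)
    fix x y assume "x \<in> topspace (subtopology X S)" "y \<in> topspace (subtopology X S)"
    then have xy: "x \<in> S" "y \<in> S" "x \<in> T" "y \<in> T" by auto
    with assms(2) connectedin_seg show "\<exists>C. connectedin (subtopology X S) C \<and> x \<in> C \<and> y \<in> C"
      by (intro exI[of _ "seg x y"]) (simp add: connectedin_subtopology)
  qed
  then show ?thesis using assms(1) by (simp add: connectedin_def)
qed

text \<open>Hereditary unicoherence in a strong form: with two points, both sets contain the segment between them.\<close>

lemma connectedin_Int:
  assumes "connectedin X C" "connectedin X D" shows "connectedin X (C \<inter> D)"
  using assms connectedin_subset_topspace seg_subset_connected
  by (intro connectedin_if_segs) (blast, simp)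

lemma connectedin_Inter:
  assumes "\<And>C. C \<in> \<C> \<Longrightarrow> connectedin X C" "\<C> \<noteq> {}" shows "connectedin X (\<Inter>\<C>)"
  using assms connectedin_subset_topspace seg_subset_connected
  by (intro connectedin_if_segs Inter_greatest) (blast, blast)

lemma seg_triangle:
  assumes "x \<in> T" "y \<in> T" "z \<in> T" shows "seg x z \<subseteq> seg x y \<union> seg y z"
proof (rule seg_subset_connected)
  show "connectedin X (seg x y \<union> seg y z)"
  proof (intro connectedin_Un connectedin_seg assms)
    have "y \<in> seg x y \<inter> seg y z" by simp
    then show "seg x y \<inter> seg y z \<noteq> {}" by blast
  qed
qed auto

lemma seg_mono:
  assumes "y \<in> seg x z" "x \<in> T" "z \<in> T" shows "seg x y \<subseteq> seg x z"
  using assms by (intro seg_subset_connected connectedin_seg) auto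

text \<open>Betweenness as seen from \<open>x\<close> is a partial order: on the arc from \<open>x\<close> to \<open>z\<close>, the segment from \<open>x\<close> to
  an earlier point does not reach \<open>z\<close>.\<close>

lemma seg_antisym:
  assumes "y \<in> seg x z" "z \<in> seg x y" "x \<in> T" "z \<in> T" shows "y = z"
proof (cases "x = z")
  case False
  then obtain g where g: "arc_param X (seg x z) g" "g 0 = x" "g 1 = z" using assms seg_arc by metis
  then obtain t where t: "t \<in> {0..1}" "y = g t" using assms(1) arc_param_props(1) by blast
  have "seg x y \<subseteq> g ` {0..t}"
    using t g by (intro seg_subset_connected connectedin_arc_param_image[OF g(1)]) auto
  then obtain s where "s \<in> {0..t}" "g 1 = g s" using assms(2) g by blast
  then have "s = 1" using inj_onD[OF arc_param_props(2)[OF g(1)], of 1 s] t by auto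
  then show ?thesis using \<open>s \<in> {0..t}\<close> t g by simp
qed (use assms seg_refl in auto)

text \<open>The connected set \<open>seg x y\<close> is covered by the closed sets \<open>seg x z\<close> and \<open>seg z y\<close>, each of which meets
  it, so all three have a common point.\<close>

lemma seg_median:
  assumes "x \<in> T" "y \<in> T" "z \<in> T"
  obtains r where "r \<in> seg x y" "r \<in> seg x z" "r \<in> seg y z"
proof -
  have c: "connectedin X (seg x y)" "closedin X (seg x z)" "closedin X (seg z y)"
    using assms connectedin_seg closedin_seg by auto
  have sub: "seg x y \<subseteq> seg x z \<union> seg z y" using seg_triangle assms by blast
  have "seg x z \<inter> seg z y \<inter> seg x y \<noteq> {}"
  proof (rule ccontr)
    assume empty: "\<not> ?thesis"
    have "seg x z \<inter> seg x y \<noteq> {}" "seg z y \<inter> seg x y \<noteq> {}"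
      using ends_in_seg by fast+
    moreover have "\<not> (\<exists>E1 E2. closedin X E1 \<and> closedin X E2 \<and> seg x y \<subseteq> E1 \<union> E2 \<and>
        E1 \<inter> E2 \<inter> seg x y = {} \<and> E1 \<inter> seg x y \<noteq> {} \<and> E2 \<inter> seg x y \<noteq> {})"
      using c(1) by (simp add: connectedin_closedin)
    ultimately show False using empty c(2,3) sub by blast
  qed
  then show ?thesis using that seg_commute by blast
qed

lemma seg_split_order:
  assumes "r \<in> seg x y" "t \<in> seg x r" "t \<noteq> r" "x \<in> T" "y \<in> T"
  shows "r \<in> seg t y"
proof -
  have T: "r \<in> T" "t \<in> T" using assms in_T_if_in_seg by blast+
  have "r \<notin> seg x t" using seg_antisym[of r x t] seg_antisym[of t x r] assms T by blast
  then show ?thesis using seg_triangle[of x t y] assms T by blast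
qed

text \<open>For \<open>r \<noteq> w\<close> these are \<open>r\<close> and the points that \<open>r\<close> separates from \<open>w\<close>, so the complement of the
  component of \<open>T - {r}\<close> that contains \<open>w\<close>. Components of open sets are open by local connectedness.\<close>

lemma closedin_beyond:
  assumes "r \<in> T" "w \<in> T" shows "closedin X {s \<in> T. r \<in> seg w s}"
proof (cases "r = w")
  case False
  have "openin X {s \<in> T. r \<notin> seg w s}"
  proof (subst openin_subopen, intro ballI)
    fix s assume "s \<in> {s \<in> T. r \<notin> seg w s}"
    then have s: "s \<in> T" "r \<notin> seg w s" by auto
    then have "s \<in> T - {r}" using ends_in_seg by blast
    moreover have "openin X (T - {r})"
      using Hausdorff_X assms by (intro openin_diff closedin_Hausdorff_singleton) auto
    ultimately obtain N where N: "openin X N" "connectedin X N" "s \<in> N" "N \<subseteq> T - {r}"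
      using locally_connected_X unfolding locally_connected_space by blast
    have "r \<notin> seg w n" if "n \<in> N" for n
    proof -
      have "seg w n \<subseteq> seg w s \<union> seg s n" using seg_triangle[of w s n] assms s N that by blast
      moreover have "seg s n \<subseteq> N" using N that by (intro seg_subset_connected)
      ultimately show ?thesis using s N by blast
    qed
    then show "\<exists>N. openin X N \<and> s \<in> N \<and> N \<subseteq> {s \<in> T. r \<notin> seg w s}" using N by blast
  qed
  moreover have "T - {s \<in> T. r \<notin> seg w s} = {s \<in> T. r \<in> seg w s}" by blast
  ultimately show ?thesis using openin_closedin_eq[of X "{s \<in> T. r \<notin> seg w s}"] by simp
qed (simp add: Collect_conj_eq)

corollary openin_component:
  assumes "r \<in> T" "w \<in> T" shows "openin X {s \<in> T. r \<notin> seg w s}"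
proof -
  have "T - {s \<in> T. r \<in> seg w s} = {s \<in> T. r \<notin> seg w s}" by blast
  then show ?thesis using closedin_beyond[OF assms] by (metis openin_topspace openin_diff)
qed

text \<open>From each point of the component the segment to \<open>r\<close> stays in the component until it reaches \<open>r\<close>.\<close>

lemma connectedin_component_insert:
  assumes "r \<in> T" "w \<in> T" shows "connectedin X (insert r {s \<in> T. r \<notin> seg w s})" (is "connectedin X ?D")
proof (rule connectedin_if_segs)
  have ray: "seg s r \<subseteq> ?D" if "s \<in> T" "r \<notin> seg w s" for s
  proof
    fix t assume t: "t \<in> seg s r"
    then have "t \<in> T" using assms that in_T_if_in_seg by blast
    show "t \<in> ?D"
    proof (cases "t = r")
      case False
      then have "r \<notin> seg s t" using seg_antisym[of t s r] t that assms by blast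
      then have "r \<notin> seg w t" using seg_triangle[of w s t] that assms \<open>t \<in> T\<close> by blast
      then show ?thesis using \<open>t \<in> T\<close> by blast
    qed simp
  qed
  fix s t assume st: "s \<in> ?D" "t \<in> ?D"
  have "seg u r \<subseteq> ?D" if "u \<in> ?D" for u
  proof (cases "u = r")
    case True then show ?thesis using seg_refl[OF assms(1)] by simp
  next
    case False then show ?thesis using that by (intro ray) auto
  qed
  from this[OF st(1)] this[OF st(2)] have "seg s r \<subseteq> ?D" "seg r t \<subseteq> ?D"
    by (simp_all only: seg_commute[of r])
  moreover have "s \<in> T" "t \<in> T" using st assms by blast+
  then have "seg s t \<subseteq> seg s r \<union> seg r t" using assms by (intro seg_triangle)
  ultimately show "seg s t \<subseteq> ?D" by blast
qed (use assms in auto)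

definition oseg :: "'a \<Rightarrow> 'a \<Rightarrow> 'a set" where
  "oseg x y = seg x y - {x, y}"

lemma oseg_param:
  assumes "arc_param X I g"
  shows "oseg (g 0) (g 1) = g ` {0<..<1}" "I - {g 0, g 1} = oseg (g 0) (g 1)"
proof -
  note p = arc_param_props[OF assms]
  show 1: "I - {g 0, g 1} = oseg (g 0) (g 1)" using arc_eq_seg[OF assms] by (simp add: oseg_def)
  have "g ` {0..1} - {g 0, g 1} = g ` ({0..1} - {0, 1})"
    using p(2) by (subst inj_on_image_set_diff[of g "{0..1}"]) auto
  moreover have "{0..1} - {0, 1} = {0<..<1::real}" by auto
  ultimately show "oseg (g 0) (g 1) = g ` {0<..<1}" using p(1) 1 by simp
qed

lemma connectedin_oseg: "\<lbrakk>x \<in> T; y \<in> T; x \<noteq> y\<rbrakk> \<Longrightarrow> connectedin X (oseg x y)"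
  by (metis seg_arc oseg_param(1) connectedin_arc_param_image connected_Ioo greaterThanLessThan_subseteq_atLeastAtMost_iff order_refl)

lemma oseg_nonempty: "\<lbrakk>x \<in> T; y \<in> T; x \<noteq> y\<rbrakk> \<Longrightarrow> \<exists>z. z \<in> oseg x y"
  by (metis seg_arc oseg_param(1) greaterThanLessThan_empty_iff imageI ex_in_conv not_one_le_zero)

lemma seg_subset_closure_oseg:
  assumes "x \<in> T" "y \<in> T" "x \<noteq> y" shows "seg x y \<subseteq> X closure_of (oseg x y)"
proof -
  obtain g where g: "arc_param X (seg x y) g" "g 0 = x" "g 1 = y" using assms seg_arc by metis
  have "top_of_set {0..1} closure_of {0<..<1} = {0..1::real}"
    by (simp add: closure_of_subtopology inf_absorb2 greaterThanLessThan_subseteq_atLeastAtMost_iff)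
  then show ?thesis
    using continuous_map_image_closure_subset[OF arc_param_props(3)[OF g(1)], of "{0<..<1}"]
      oseg_param(1)[OF g(1)] arc_param_props(1)[OF g(1)] g by simp
qed

lemma infinite_seg:
  assumes "x \<in> T" "y \<in> T" "x \<noteq> y" shows "infinite (seg x y)"
proof -
  obtain g where g: "arc_param X (seg x y) g" using assms seg_arc by metis
  then show ?thesis
    using arc_param_props(1,2)[OF g] finite_image_iff[of g "{0..1}"] by (auto simp: infinite_Icc)
qed

text \<open>Free arcs in terms of segments, without parametrisations.\<close>

lemma free_arc_iff:
  "free_arc X I \<longleftrightarrow> (\<exists>x\<in>T. \<exists>y\<in>T. x \<noteq> y \<and> I = seg x y \<and> openin X (oseg x y))"
proof
  assume "free_arc X I"
  then obtain g where g: "arc_param X I g" "openin X (I - {g 0, g 1})" unfolding free_arc_def by blast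
  note p = arc_param_props[OF g(1)]
  have "g 0 \<in> T" "g 1 \<in> T" using p by auto
  moreover have "openin X (oseg (g 0) (g 1))" using g(2) oseg_param(2)[OF g(1)] by simp
  ultimately show "\<exists>x\<in>T. \<exists>y\<in>T. x \<noteq> y \<and> I = seg x y \<and> openin X (oseg x y)"
    using p(4) arc_eq_seg[OF g(1)] by blast
next
  assume "\<exists>x\<in>T. \<exists>y\<in>T. x \<noteq> y \<and> I = seg x y \<and> openin X (oseg x y)"
  then obtain x y where xy: "x \<in> T" "y \<in> T" "x \<noteq> y" and I: "I = seg x y" and "openin X (oseg x y)"
    by (elim bexE conjE)
  moreover obtain g where "arc_param X (seg x y) g" "g 0 = x" "g 1 = y" using seg_arc[OF xy] .
  ultimately have "arc_param X I g \<and> openin X (I - {g 0, g 1})"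
    by (simp add: oseg_def)
  then show "free_arc X I" unfolding free_arc_def by (rule exI[where x=g])
qed

section \<open>Maximal free arcs\<close>

lemma oseg_subset_T: "\<lbrakk>x \<in> T; y \<in> T\<rbrakk> \<Longrightarrow> oseg x y \<subseteq> T"
  using seg_subset_T by (auto simp: oseg_def)

lemma homeo_seg:
  assumes h: "homeomorphic_map X X h" and xy: "x \<in> T" "y \<in> T"
  shows "h ` seg x y = seg (h x) (h y)"
proof
  obtain k where k: "homeomorphic_maps X X h k" using h homeomorphic_map_maps by blast
  then have kh: "k (h z) = z" "h (k z) = z" if "z \<in> T" for z
    using that by (simp_all add: homeomorphic_maps_def)
  have ck: "continuous_map X X k" using k by (simp add: homeomorphic_maps_def)
  have hT: "h z \<in> T" if "z \<in> T" for z
    using homeomorphic_imp_surjective_map[OF h] that by blast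
  have "connectedin X (k ` seg (h x) (h y))"
    using ck by (rule connectedin_continuous_map_image) (intro connectedin_seg hT xy)
  moreover have "x \<in> k ` seg (h x) (h y)" using kh(1)[OF xy(1)] ends_in_seg(1) by (metis imageI)
  moreover have "y \<in> k ` seg (h x) (h y)" using kh(1)[OF xy(2)] ends_in_seg(2) by (metis imageI)
  ultimately have "seg x y \<subseteq> k ` seg (h x) (h y)" by (rule seg_subset_connected)
  then have "h ` seg x y \<subseteq> h ` k ` seg (h x) (h y)" by (rule image_mono)
  also have "\<dots> = (\<lambda>z. h (k z)) ` seg (h x) (h y)" by (simp add: image_image)
  also have "\<dots> = (\<lambda>z. z) ` seg (h x) (h y)"
    using seg_subset_T[OF hT[OF xy(1)] hT[OF xy(2)]] kh(2) by (intro image_cong) auto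
  finally show "h ` seg x y \<subseteq> seg (h x) (h y)" by simp
  show "seg (h x) (h y) \<subseteq> h ` seg x y"
  proof (rule seg_subset_connected)
    show "connectedin X (h ` seg x y)"
      using homeomorphic_imp_continuous_map[OF h] connectedin_seg[OF xy] by (rule connectedin_continuous_map_image)
  qed auto
qed

text \<open>The segment from \<open>r\<close> to \<open>w\<close> leaves \<open>r\<close> inside the open set \<open>oseg x y\<close>, hence towards \<open>x\<close> or towards \<open>y\<close>.
  So \<open>w\<close> is on the same side of \<open>r\<close> as one of the ends.\<close>

lemma no_branch_in_free_arc:
  assumes xy: "x \<in> T" "y \<in> T" and op: "openin X (oseg x y)" and r: "r \<in> oseg x y"
    and w: "w \<in> T" "w \<noteq> r"
  shows "r \<notin> seg w x \<or> r \<notin> seg w y"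
proof -
  have rT: "r \<in> T" and rxy: "r \<in> seg x y" using r oseg_subset_T[OF xy] by (auto simp: oseg_def)
  \<comment> \<open>Otherwise \<open>r\<close> would be isolated in the connected set \<open>seg r w\<close>.\<close>
  have "\<exists>w1. w1 \<in> seg r w \<and> w1 \<in> oseg x y \<and> w1 \<noteq> r"
  proof (rule ccontr)
    assume contra: "\<not> ?thesis"
    have "openin X (T - {r})"
      using Hausdorff_X rT by (intro openin_diff closedin_Hausdorff_singleton) auto
    moreover have "seg r w \<subseteq> oseg x y \<union> (T - {r})" using r seg_subset_T[OF rT w(1)] by blast
    moreover have "oseg x y \<inter> (T - {r}) \<inter> seg r w = {}" using contra by blast
    moreover have "r \<in> oseg x y \<inter> seg r w" "w \<in> (T - {r}) \<inter> seg r w" using r w by simp_all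
    ultimately show False
      using connectedin_seg[OF rT w(1)] op unfolding connectedin by blast
  qed
  then obtain w1 where w1: "w1 \<in> seg r w" "w1 \<in> oseg x y" "w1 \<noteq> r" by blast
  have w1T: "w1 \<in> T" using w1(2) oseg_subset_T[OF xy] by blast
  have a: "r \<notin> seg w w1"
    using seg_antisym[of r w w1] seg_antisym[of w1 w r] w1 w rT w1T seg_commute[of r w] by blast
  have "w1 \<in> seg x r \<or> w1 \<in> seg y r"
    using seg_triangle[OF xy(1) rT xy(2)] w1(2) seg_commute[of r y] by (auto simp: oseg_def)
  then have "r \<notin> seg w1 x \<or> r \<notin> seg w1 y"
    using seg_antisym[of w1 x r] seg_antisym[of w1 y r] w1(3) xy rT seg_commute[of w1] by metis
  then show ?thesis
    using a seg_triangle[OF w(1) w1T xy(1)] seg_triangle[OF w(1) w1T xy(2)] by blast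
qed

text \<open>Of three points other than \<open>r\<close>, two are on the same side of \<open>r\<close>.\<close>

lemma two_directions_in_free_arc:
  assumes "x \<in> T" "y \<in> T" "openin X (oseg x y)" "r \<in> oseg x y"
    and "p \<in> T" "q \<in> T" "s \<in> T" "p \<noteq> r" "q \<noteq> r" "s \<noteq> r"
  shows "r \<notin> seg p q \<or> r \<notin> seg p s \<or> r \<notin> seg q s"
proof -
  have join: "r \<notin> seg u v" if "u \<in> T" "v \<in> T" "z \<in> T" "r \<notin> seg u z" "r \<notin> seg v z" for u v z
    using seg_triangle[of u z v] that seg_commute[of v z] by blast
  have "r \<notin> seg p x \<or> r \<notin> seg p y" "r \<notin> seg q x \<or> r \<notin> seg q y" "r \<notin> seg s x \<or> r \<notin> seg s y"
    using no_branch_in_free_arc[OF assms(1-4)] assms by blast+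
  then show ?thesis using join assms by meson
qed

text \<open>The median of \<open>x\<close>, \<open>y\<close> and \<open>s\<close> is an end of the free arc, since nothing branches off inside.\<close>

lemma end_separates_outside_free_arc:
  assumes "x \<in> T" "y \<in> T" "openin X (oseg x y)" "s \<in> T" "s \<notin> oseg x y"
  shows "x \<in> seg y s \<or> y \<in> seg x s"
proof -
  obtain r where r: "r \<in> seg x y" "r \<in> seg x s" "r \<in> seg y s" using seg_median assms by metis
  show ?thesis
  proof (cases "r \<in> oseg x y")
    case True
    then have "s \<noteq> r" using assms by blast
    then show ?thesis
      using no_branch_in_free_arc[OF assms(1-3) True assms(4)] r seg_commute[of s] by blast
  next
    case False then show ?thesis using r by (auto simp: oseg_def)
  qed
qed

text \<open>Outside the interior of the free arc, \<open>X\<close> consists of two disjoint closed pieces, one attached at each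
  end. The set \<open>J\<close> lies in one of them, and \<open>h\<close> exchanges them.\<close>

lemma swap_moves_connected_set:
  assumes xy: "x \<in> T" "y \<in> T" "x \<noteq> y" and op: "openin X (oseg x y)"
    and h: "homeomorphic_map X X h" "h x = y" "h y = x"
    and J: "connectedin X J" "J \<noteq> {}" "J \<inter> oseg x y = {}"
  shows "h ` J \<noteq> J"
proof
  assume hJ: "h ` J = J"
  define A where "A = {s \<in> T. x \<in> seg y s}"
  define B where "B = {s \<in> T. y \<in> seg x s}"
  have JT: "J \<subseteq> T" using J connectedin_subset_topspace by blast
  have cl: "closedin X A" "closedin X B" unfolding A_def B_def using closedin_beyond xy by blast+
  have "J \<subseteq> A \<union> B"
    unfolding A_def B_def using end_separates_outside_free_arc[OF xy(1,2) op] JT J(3) by blast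
  moreover have AB: "A \<inter> B = {}"
    unfolding A_def B_def using seg_antisym[of x _ y] xy seg_commute by blast
  ultimately have "J \<inter> A = {} \<or> J \<inter> B = {}"
    using J(1) cl unfolding connectedin_closedin by blast
  moreover have "h s \<in> J \<inter> B" if "s \<in> J \<inter> A" for s
  proof -
    have s: "s \<in> T" "x \<in> seg y s" using that by (auto simp: A_def)
    have "h x \<in> seg (h y) (h s)" using homeo_seg[OF h(1) xy(2) s(1)] s(2) by blast
    then show ?thesis using h that hJ JT unfolding B_def by auto
  qed
  moreover have "h s \<in> J \<inter> A" if "s \<in> J \<inter> B" for s
  proof -
    have s: "s \<in> T" "y \<in> seg x s" using that by (auto simp: B_def)
    have "h y \<in> seg (h x) (h s)" using homeo_seg[OF h(1) xy(1) s(1)] s(2) by blast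
    then show ?thesis using h that hJ JT unfolding A_def by auto
  qed
  moreover obtain s where "s \<in> J" using J(2) by blast
  ultimately show False using \<open>J \<subseteq> A \<union> B\<close> AB by blast
qed

text \<open>Zorn's lemma for the order of betweenness as seen from \<open>z\<close>, in which \<open>p\<close> precedes \<open>q\<close> if
  \<open>p \<in> seg z q\<close>. Chains have upper bounds by compactness.\<close>

lemma maximal_point_exists:
  assumes Y: "closedin X Y" and z: "z \<in> T" and u: "u \<in> Y"
  obtains p where "p \<in> Y" "u \<in> seg z p" "\<And>p'. \<lbrakk>p' \<in> Y; p \<in> seg z p'\<rbrakk> \<Longrightarrow> p' = p"
proof -
  define P where "P p q \<longleftrightarrow> p \<in> seg z q" for p q
  define A where "A = {p \<in> Y. u \<in> seg z p}"
  have YT: "Y \<subseteq> T" using Y closedin_subset by blast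
  have trans: "P p r" if "P p q" "P q r" "r \<in> Y" for p q r
    using that seg_mono[of q z r] z YT unfolding P_def by blast
  have "\<exists>m\<in>A. \<forall>a\<in>A. P m a \<longrightarrow> a = m"
  proof (rule predicate_Zorn)
    show "partial_order_on A (relation_of P A)"
      unfolding partial_order_on_def preorder_on_def relation_of_def
    proof (intro conjI)
      show "refl_on A {(a, b) \<in> A \<times> A. P a b}" by (auto simp: refl_on_def P_def)
      show "trans {(a, b) \<in> A \<times> A. P a b}" using trans unfolding trans_def A_def by blast
      show "antisym {(a, b) \<in> A \<times> A. P a b}"
        using seg_antisym[of _ z] z YT unfolding antisym_def A_def P_def by blast
    qed auto
  next
    fix C assume C: "C \<in> Chains (relation_of P A)"
    then have CA: "C \<subseteq> A" and tot: "\<And>a b. \<lbrakk>a \<in> C; b \<in> C\<rbrakk> \<Longrightarrow> P a b \<or> P b a"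
      unfolding Chains_def relation_of_def by blast+
    show "\<exists>q\<in>A. \<forall>a\<in>C. P a q"
    proof (cases "C = {}")
      case True
      have "u \<in> A" using u by (simp add: A_def)
      with True show ?thesis by blast
    next
      case False
      \<comment> \<open>The upper bounds of \<open>c\<close> form a closed set, and these sets are nested along the chain.\<close>
      define U where "U c = Y \<inter> {q \<in> T. c \<in> seg z q}" for c
      have "closedin X D" if "D \<in> U ` C" for D
        using that Y closedin_beyond z CA YT unfolding U_def A_def by blast
      moreover have "\<Inter>\<F> \<noteq> {}" if F: "finite \<F>" "\<F> \<subseteq> U ` C" for \<F>
      proof -
        obtain D where D: "D \<subseteq> C" "finite D" "\<F> = U ` D" using finite_subset_image[OF F] by blast
        have "\<exists>m\<in>C. \<forall>c\<in>D. P c m" using D(2,1)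
        proof (induction D rule: finite_induct)
          case empty then show ?case using False by blast
        next
          case (insert c D)
          then obtain m where m: "m \<in> C" "\<forall>c\<in>D. P c m" by blast
          show ?case
          proof (cases "P c m")
            case True with m show ?thesis by blast
          next
            case F: False
            then have "P m c" using tot m(1) insert.prems by blast
            moreover have "P c c" by (simp add: P_def)
            ultimately have "\<forall>d\<in>insert c D. P d c" using m trans CA insert.prems unfolding A_def by blast
            then show ?thesis using insert.prems by blast
          qed
        qed
        then obtain m where "m \<in> C" "\<forall>c\<in>D. P c m" by blast
        then have "m \<in> \<Inter>\<F>" using CA YT D(3) unfolding U_def A_def P_def by blast
        then show ?thesis by blast
      qed
      ultimately have "\<Inter>(U ` C) \<noteq> {}"
        using compact_X[unfolded compact_space_fip, rule_format, of "U ` C"] by blast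
      then obtain q where q: "\<forall>c\<in>C. q \<in> U c" by blast
      obtain c where "c \<in> C" using False by blast
      then have "q \<in> Y" "c \<in> seg z q" "u \<in> seg z c" using q CA unfolding U_def A_def by blast+
      then have "u \<in> seg z q" using trans[of u c q] unfolding P_def by blast
      then have "q \<in> A" using \<open>q \<in> Y\<close> by (simp add: A_def)
      moreover have "\<forall>c\<in>C. P c q" using q unfolding U_def P_def by blast
      ultimately show ?thesis by blast
    qed
  qed
  then obtain p where p: "p \<in> A" "\<forall>a\<in>A. P p a \<longrightarrow> a = p" by blast
  show ?thesis
  proof (rule that)
    show "p \<in> Y" "u \<in> seg z p" using p by (auto simp: A_def)
    fix p' assume p': "p' \<in> Y" "p \<in> seg z p'"
    then have "P p p'" "p' \<in> A" using p(1) trans[of u p p'] by (auto simp: P_def A_def)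
    then show "p' = p" using p(2) by blast
  qed
qed

lemma component_of_open_set:
  assumes U: "openin X U" and z: "z \<in> U"
  obtains C where "openin X C" "connectedin X C" "z \<in> C" "C \<subseteq> U"
    "\<And>D. \<lbrakk>connectedin X D; D \<subseteq> U; D \<inter> C \<noteq> {}\<rbrakk> \<Longrightarrow> D \<subseteq> C"
proof -
  define C where "C = connected_component_of_set (subtopology X U) z"
  have UT: "U \<subseteq> T" using U openin_subset by blast
  have con: "connectedin (subtopology X U) C"
    unfolding C_def by (rule connectedin_connected_component_of)
  have zC: "z \<in> C" unfolding C_def using connected_component_of_refl[of "subtopology X U" z] z UT by auto
  show ?thesis
  proof (rule that)
    show "openin X C"
      using locally_connected_B[OF locally_connected_X] U z unfolding C_def by blast
    show "connectedin X C" "C \<subseteq> U" using con by (simp_all add: connectedin_subtopology)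
    show "z \<in> C" by (rule zC)
    fix D assume D: "connectedin X D" "D \<subseteq> U" "D \<inter> C \<noteq> {}"
    have "connectedin (subtopology X U) (D \<union> C)"
      using D con by (intro connectedin_Un) (simp_all add: connectedin_subtopology)
    then have "D \<union> C \<subseteq> C"
      unfolding C_def by (rule connected_component_of_maximal) (use zC in \<open>simp add: C_def\<close>)
    then show "D \<subseteq> C" by blast
  qed
qed

text \<open>The last property of \<open>M\<close> makes \<open>M\<close> maximal and also keeps it away from the interiors of all other
  maximal free arcs. For \<open>M\<close> one takes the closure of a component of the set of interior points of free
  arcs. Its ends are found by first going from some point \<open>z\<close> as far as possible to a point \<open>p\<close>, and
  then from \<open>p\<close> back through \<open>z\<close> as far as possible to a point \<open>q\<close>.\<close>

lemma free_arc_in_absorbing_free_arc: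
  assumes "free_arc X I"
  obtains M where "free_arc X M" "I \<subseteq> M"
    "\<And>a b. \<lbrakk>a \<in> T; b \<in> T; openin X (oseg a b); oseg a b \<inter> M \<noteq> {}\<rbrakk> \<Longrightarrow> seg a b \<subseteq> M"
proof -
  define \<E> where "\<E> = {oseg a b | a b. a \<in> T \<and> b \<in> T \<and> a \<noteq> b \<and> openin X (oseg a b)}"
  obtain x0 y0 where I: "x0 \<in> T" "y0 \<in> T" "x0 \<noteq> y0" "I = seg x0 y0" "openin X (oseg x0 y0)"
    using assms unfolding free_arc_iff by blast
  have opE: "openin X (\<Union>\<E>)" by (rule openin_Union) (auto simp: \<E>_def)
  obtain z where z: "z \<in> oseg x0 y0" using oseg_nonempty I by blast
  have I\<E>: "oseg x0 y0 \<in> \<E>" using I unfolding \<E>_def by blast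
  have "z \<in> \<Union>\<E>" using z I\<E> by blast
  then obtain O' where opO: "openin X O'" and conO: "connectedin X O'" and zO: "z \<in> O'" and OE: "O' \<subseteq> \<Union>\<E>"
    and compO: "\<And>C. \<lbrakk>connectedin X C; C \<subseteq> \<Union>\<E>; C \<inter> O' \<noteq> {}\<rbrakk> \<Longrightarrow> C \<subseteq> O'"
    using component_of_open_set[OF opE] by metis
  have maxO: "C \<subseteq> O'" if "C \<in> \<E>" "C \<inter> O' \<noteq> {}" for C
  proof (rule compO[OF _ _ that(2)])
    show "connectedin X C" using that(1) connectedin_oseg unfolding \<E>_def by blast
    show "C \<subseteq> \<Union>\<E>" using that(1) by blast
  qed
  define Y where "Y = X closure_of O'"
  have OT: "O' \<subseteq> T" using opO openin_subset by blast
  have Y: "closedin X Y" "connectedin X Y" "O' \<subseteq> Y"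
    unfolding Y_def using connectedin_closure_of[OF conO] closure_of_subset[OF OT] by simp_all
  have YT: "Y \<subseteq> T" using Y(1) closedin_subset by blast
  have zT: "z \<in> T" and zY: "z \<in> Y" using zO OT Y(3) by blast+
  obtain p where p: "p \<in> Y" "\<And>p'. \<lbrakk>p' \<in> Y; p \<in> seg z p'\<rbrakk> \<Longrightarrow> p' = p"
    using maximal_point_exists[OF Y(1) zT zY] by metis
  have pT: "p \<in> T" using p YT by blast
  obtain q where q: "q \<in> Y" "z \<in> seg p q" "\<And>q'. \<lbrakk>q' \<in> Y; q \<in> seg p q'\<rbrakk> \<Longrightarrow> q' = q"
    using maximal_point_exists[OF Y(1) pT zY] by metis
  have qT: "q \<in> T" using q YT by blast
  \<comment> \<open>A point of \<open>O'\<close> off \<open>seg p q\<close> would branch off at a point \<open>r\<close> that also lies in \<open>O'\<close>, hence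
      inside a free arc, where there are only two directions.\<close>
  have O_sub: "O' \<subseteq> seg p q"
  proof
    fix y assume y: "y \<in> O'"
    show "y \<in> seg p q"
    proof (rule ccontr)
      assume not: "y \<notin> seg p q"
      have yT: "y \<in> T" and yY: "y \<in> Y" using y OT Y(3) by blast+
      obtain r where r: "r \<in> seg p q" "r \<in> seg p y" "r \<in> seg q y" using seg_median[OF pT qT yT] .
      have rT: "r \<in> T" using r(1) pT qT in_T_if_in_seg by blast
      have "r \<noteq> y" using r(1) not by blast
      have rzy: "r \<in> seg z y"
      proof (cases "z = r")
        case True then show ?thesis by simp
      next
        case False
        have "z \<in> seg p r \<or> z \<in> seg q r"
          using seg_triangle[OF pT rT qT] q(2) seg_commute[of r q] by blast
        then have "r \<notin> seg p z \<or> r \<notin> seg q z"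
          using seg_antisym[of z p r] seg_antisym[of z q r] False pT qT rT by blast
        then show ?thesis
          using seg_triangle[OF pT zT yT] seg_triangle[OF qT zT yT] r by blast
      qed
      then have "r \<in> O'" using seg_subset_connected[OF conO zO y] by blast
      then obtain a b where ab: "a \<in> T" "b \<in> T" "openin X (oseg a b)" "r \<in> oseg a b"
        using OE unfolding \<E>_def by blast
      have "p \<noteq> r" using p(2)[OF yY] rzy not by auto
      moreover have "q \<noteq> r" using q(3)[OF yY] r(2) not by auto
      ultimately show False
        using two_directions_in_free_arc[OF ab pT qT yT] r \<open>r \<noteq> y\<close> by blast
    qed
  qed
  have "p \<noteq> q"
  proof
    assume "p = q"
    then have "oseg x0 y0 \<subseteq> {p}"
      using O_sub maxO[OF I\<E>] z zO seg_refl[OF pT] by blast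
    then have "finite (seg x0 y0)"
      unfolding oseg_def by (metis finite.emptyI finite_insert finite_Diff2 finite_subset)
    then show False using infinite_seg I by blast
  qed
  have Y_eq: "Y = seg p q"
  proof
    show "Y \<subseteq> seg p q" unfolding Y_def using O_sub closedin_seg[OF pT qT] by (rule closure_of_minimal)
    show "seg p q \<subseteq> Y" using Y(2) p(1) q(1) by (rule seg_subset_connected)
  qed
  \<comment> \<open>A point outside \<open>O'\<close> cannot separate \<open>z\<close> from any other point of \<open>Y\<close>, since \<open>Y\<close> is the
      closure of the connected set \<open>O'\<close>.\<close>
  have "oseg p q \<subseteq> O'"
  proof
    fix r assume r: "r \<in> oseg p q"
    then have rT: "r \<in> T" using oseg_subset_T pT qT by blast
    show "r \<in> O'"
    proof (rule ccontr)
      assume rO: "r \<notin> O'"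
      have far: "r \<notin> seg e z" if e: "e \<in> Y" "e \<noteq> r" for e
      proof -
        have eT: "e \<in> T" using e YT by blast
        have "openin X {s \<in> T. r \<notin> seg e s}" using openin_component rT eT by blast
        moreover have "e \<in> {s \<in> T. r \<notin> seg e s}" using seg_refl[OF eT] e eT by auto
        moreover have "\<forall>N. e \<in> N \<and> openin X N \<longrightarrow> (\<exists>s. s \<in> O' \<and> s \<in> N)"
          using e(1) unfolding Y_def by (simp add: in_closure_of)
        ultimately have "\<exists>s. s \<in> O' \<and> s \<in> {s \<in> T. r \<notin> seg e s}" by metis
        then obtain s where s: "s \<in> O'" "s \<in> T" "r \<notin> seg e s" by blast
        have "seg s z \<subseteq> O'" using seg_subset_connected[OF conO s(1) zO] .
        then show ?thesis using seg_triangle[OF eT s(2) zT] rO s(3) by blast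
      qed
      have "r \<notin> seg p z" "r \<notin> seg q z" using far p(1) q(1) r by (auto simp: oseg_def)
      moreover have "r \<in> seg p q" using r by (simp add: oseg_def)
      ultimately show False using seg_triangle[OF pT zT qT] seg_commute[of z q] by blast
    qed
  qed
  then have "oseg p q = O' - {p, q}" using O_sub by (auto simp: oseg_def)
  then have "openin X (oseg p q)"
    using opO Hausdorff_X pT qT
    by (metis openin_diff Hausdorff_imp_t1_space t1_space_closedin_finite empty_subsetI finite.emptyI finite.insertI insert_subset)
  then have "free_arc X (seg p q)" unfolding free_arc_iff using pT qT \<open>p \<noteq> q\<close> by blast
  moreover have sub: "seg a b \<subseteq> seg p q" if "a \<in> T" "b \<in> T" "openin X (oseg a b)" "oseg a b \<inter> seg p q \<noteq> {}" for a b
  proof -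
    have "a \<noteq> b" using that(1,4) by (auto simp: oseg_def seg_refl)
    have "oseg a b \<inter> O' \<noteq> {}"
      using that(4) openin_Int_closure_of_eq_empty[OF that(3), of O'] unfolding Y_eq[symmetric] Y_def by blast
    then have "oseg a b \<subseteq> O'" using maxO that \<open>a \<noteq> b\<close> unfolding \<E>_def by blast
    then have "X closure_of oseg a b \<subseteq> Y" unfolding Y_def by (rule closure_of_mono)
    then show ?thesis using seg_subset_closure_oseg that \<open>a \<noteq> b\<close> Y_eq by blast
  qed
  moreover have "I \<subseteq> seg p q" using sub[OF I(1,2,5)] z zO O_sub I(4) by blast
  ultimately show ?thesis using that by metis
qed

lemma max_free_arcs_seg:
  assumes "I \<in> max_free_arcs X"
  obtains x y where "x \<in> T" "y \<in> T" "x \<noteq> y" "I = seg x y" "openin X (oseg x y)"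
  using assms unfolding max_free_arcs_def free_arc_iff by blast

lemma free_arc_in_max_free_arc:
  assumes "free_arc X I"
  obtains M where "M \<in> max_free_arcs X" "I \<subseteq> M"
    "\<And>a b. \<lbrakk>a \<in> T; b \<in> T; openin X (oseg a b); oseg a b \<inter> M \<noteq> {}\<rbrakk> \<Longrightarrow> seg a b \<subseteq> M"
proof -
  obtain M where M: "free_arc X M" "I \<subseteq> M"
    "\<And>a b. \<lbrakk>a \<in> T; b \<in> T; openin X (oseg a b); oseg a b \<inter> M \<noteq> {}\<rbrakk> \<Longrightarrow> seg a b \<subseteq> M"
    using free_arc_in_absorbing_free_arc[OF assms] by metis
  have "J = M" if J: "free_arc X J" "M \<subseteq> J" for J
  proof -
    obtain c d where cd: "c \<in> T" "d \<in> T" "c \<noteq> d" "J = seg c d" "openin X (oseg c d)"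
      using J(1) unfolding free_arc_iff by blast
    obtain p q where "p \<in> T" "q \<in> T" "p \<noteq> q" "M = seg p q" using M(1) unfolding free_arc_iff by blast
    then have "infinite M" using infinite_seg by blast
    then have "\<not> M \<subseteq> {c, d}" using finite_subset by blast
    then have "oseg c d \<inter> M \<noteq> {}" using J(2) cd(4) by (auto simp: oseg_def)
    then show ?thesis using M(3) cd J(2) by blast
  qed
  then have "M \<in> max_free_arcs X" using M(1) unfolding max_free_arcs_def by blast
  then show ?thesis using that M by blast
qed

lemma oseg_disjoint_max_free_arc:
  assumes I: "seg a b \<in> max_free_arcs X" "a \<in> T" "b \<in> T" "openin X (oseg a b)"
    and J: "J \<in> max_free_arcs X" and ne: "seg a b \<noteq> J"
  shows "oseg a b \<inter> J = {}"
proof (rule ccontr)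
  assume meet: "oseg a b \<inter> J \<noteq> {}"
  have fJ: "free_arc X J" using J by (simp add: max_free_arcs_def)
  obtain M where M: "M \<in> max_free_arcs X" "J \<subseteq> M"
    "\<And>a b. \<lbrakk>a \<in> T; b \<in> T; openin X (oseg a b); oseg a b \<inter> M \<noteq> {}\<rbrakk> \<Longrightarrow> seg a b \<subseteq> M"
    using free_arc_in_max_free_arc[OF fJ] by metis
  then have "M = J" using J unfolding max_free_arcs_def by blast
  then have "seg a b \<subseteq> J" using M(3) I meet by blast
  then show False using I(1) fJ ne unfolding max_free_arcs_def by blast
qed

section \<open>Null families of connected sets\<close>

lemma separated_connected_neighbourhoods:
  assumes "x \<in> T" "y \<in> T" "x \<noteq> y"
  obtains V W where "openin X V" "openin X W" "connectedin X V" "connectedin X W" "x \<in> V" "y \<in> W"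
    "X closure_of V \<inter> X closure_of W = {}"
proof -
  obtain A B where AB: "openin X A" "openin X B" "x \<in> A" "y \<in> B" "A \<inter> B = {}"
    using Hausdorff_X assms unfolding Hausdorff_space_def disjnt_def by metis
  have reg: "neighbourhood_base_of (closedin X) X"
    using compact_X Hausdorff_X compact_Hausdorff_imp_regular_space neighbourhood_base_of_closedin by blast
  have small: "\<exists>V. openin X V \<and> connectedin X V \<and> z \<in> V \<and> X closure_of V \<subseteq> S"
    if S: "openin X S" "z \<in> S" for z S
  proof -
    obtain U C where U: "openin X U" "closedin X C" "z \<in> U" "U \<subseteq> C" "C \<subseteq> S"
      using reg S unfolding neighbourhood_base_of by metis
    obtain V where V: "openin X V" "connectedin X V" "z \<in> V" "V \<subseteq> U"
      using locally_connected_X U unfolding locally_connected_space by metis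
    have "X closure_of V \<subseteq> C" using U V by (intro closure_of_minimal) auto
    then show ?thesis using V U by blast
  qed
  from small[OF AB(1,3)] small[OF AB(2,4)] AB(5) show ?thesis
    using that by (metis (no_types, lifting) Int_mono subset_empty)
qed

text \<open>If two connected sets with at most one common point both join \<open>V\<close> to \<open>W\<close>, then the intersection of
  \<open>V \<union> D \<union> W\<close> and \<open>V \<union> D' \<union> W\<close> is connected. But it consists of \<open>V\<close>, \<open>W\<close> and at most one further point,
  and this does not connect \<open>V\<close> to \<open>W\<close>, since their closures are disjoint.\<close>

lemma at_most_one_joins:
  assumes VW: "openin X V" "openin X W" "connectedin X V" "connectedin X W"
    "X closure_of V \<inter> X closure_of W = {}"
    and D: "connectedin X D" "D \<inter> V \<noteq> {}" "D \<inter> W \<noteq> {}"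
    and D': "connectedin X D'" "D' \<inter> V \<noteq> {}" "D' \<inter> W \<noteq> {}"
    and p: "D \<inter> D' \<subseteq> {p}"
  shows False
proof -
  have con: "connectedin X (V \<union> C \<union> W)" if "connectedin X C" "C \<inter> V \<noteq> {}" "C \<inter> W \<noteq> {}" for C
    using that VW by (intro connectedin_Un) auto
  define Z where "Z = (V \<union> D \<union> W) \<inter> (V \<union> D' \<union> W)"
  have Z: "connectedin X Z" unfolding Z_def using con D D' by (intro connectedin_Int) blast+
  have VT: "V \<subseteq> X closure_of V" "W \<subseteq> X closure_of W"
    using VW(1,2) by (auto intro!: closure_of_subset openin_subset)
  \<comment> \<open>The closed set \<open>E\<close> also takes the common point of \<open>D\<close> and \<open>D'\<close>, unless that point lies in the
      closure of \<open>V\<close>.\<close>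
  define E where "E = X closure_of W \<union> (D \<inter> D' - X closure_of V)"
  have "closedin X (D \<inter> D' - X closure_of V)"
  proof -
    have "D \<inter> D' - X closure_of V \<subseteq> T" "finite (D \<inter> D' - X closure_of V)"
      using connectedin_subset_topspace[OF D(1)] p finite_subset[of "D \<inter> D' - X closure_of V" "{p}"] by auto
    then show ?thesis using Hausdorff_imp_t1_space[OF Hausdorff_X] t1_space_closedin_finite by blast
  qed
  then have "closedin X E" unfolding E_def by (intro closedin_Un closedin_closure_of)
  moreover have "Z \<subseteq> X closure_of V \<union> E" unfolding Z_def E_def using VT by blast
  moreover have "X closure_of V \<inter> E \<inter> Z = {}" unfolding E_def using VW(5) by blast
  moreover have "X closure_of V \<inter> Z \<noteq> {}" using VT D(2) unfolding Z_def by blast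
  moreover have "E \<inter> Z \<noteq> {}" using VT D(3) unfolding Z_def E_def by blast
  ultimately show False using Z closedin_closure_of[of X V] unfolding connectedin_closedin by blast
qed

text \<open>Cover the compact complement of \<open>U\<close> by finitely many connected open sets \<open>W y\<close>, each accompanied by a
  connected neighbourhood \<open>V y\<close> of \<open>x\<close> with disjoint closure. A member that comes close to \<open>x\<close> and leaves
  \<open>U\<close> joins some \<open>V y\<close> to \<open>W y\<close>, and by \<open>at_most_one_joins\<close> there is at most one such member for each \<open>y\<close>.\<close>

lemma null_family:
  assumes con: "\<And>D. D \<in> \<D> \<Longrightarrow> connectedin X D"
    and small: "\<And>D D'. \<lbrakk>D \<in> \<D>; D' \<in> \<D>; D \<noteq> D'\<rbrakk> \<Longrightarrow> \<exists>p. D \<inter> D' \<subseteq> {p}"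
    and U: "openin X U" "x \<in> U"
  obtains V where "openin X V" "x \<in> V" "V \<subseteq> U" "finite {D \<in> \<D>. D \<inter> V \<noteq> {} \<and> \<not> D \<subseteq> U}"
proof -
  have xT: "x \<in> T" using U openin_subset by blast
  have "\<forall>y\<in>T - U. \<exists>V W. openin X V \<and> openin X W \<and> connectedin X V \<and> connectedin X W \<and> x \<in> V \<and> y \<in> W
     \<and> X closure_of V \<inter> X closure_of W = {}"
    using separated_connected_neighbourhoods[OF xT] U(2) by (metis Diff_iff)
  then obtain V W where VW: "\<And>y. y \<in> T - U \<Longrightarrow> openin X (V y) \<and> openin X (W y) \<and> connectedin X (V y) \<and>
     connectedin X (W y) \<and> x \<in> V y \<and> y \<in> W y \<and> X closure_of (V y) \<inter> X closure_of (W y) = {}"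
    by metis
  have "closedin X (T - U)" using U(1) by blast
  then have K: "compactin X (T - U)" by (rule closedin_compact_space[OF compact_X])
  have "\<exists>\<F>. finite \<F> \<and> \<F> \<subseteq> W ` (T - U) \<and> T - U \<subseteq> \<Union>\<F>"
  proof (rule compactinD[OF K])
    show "openin X S" if "S \<in> W ` (T - U)" for S using that VW by blast
    show "T - U \<subseteq> \<Union>(W ` (T - U))" using VW by blast
  qed
  then obtain \<F> where \<F>: "finite \<F>" "\<F> \<subseteq> W ` (T - U)" "T - U \<subseteq> \<Union>\<F>" by blast
  obtain F where F: "F \<subseteq> T - U" "finite F" "\<F> = W ` F" using finite_subset_image[OF \<F>(1,2)] by blast
  have F: "finite F" "F \<subseteq> T - U" "T - U \<subseteq> \<Union>(W ` F)" using F \<F>(3) by simp_all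
  define N where "N = U \<inter> \<Inter>(insert U (V ` F))"
  have "openin X (\<Inter>(insert U (V ` F)))" using F VW U(1) by (intro openin_Inter) auto
  then have N: "openin X N" unfolding N_def using U(1) by (rule openin_Int[rotated])
  have xN: "x \<in> N" unfolding N_def using U(2) F VW by auto
  have "finite {D \<in> \<D>. D \<inter> V y \<noteq> {} \<and> D \<inter> W y \<noteq> {}}" (is "finite ?S") if "y \<in> F" for y
  proof -
    have uniq: "D = D'" if "D \<in> ?S" "D' \<in> ?S" for D D'
    proof (rule ccontr)
      assume "D \<noteq> D'"
      then obtain p where "D \<inter> D' \<subseteq> {p}" using small \<open>D \<in> ?S\<close> \<open>D' \<in> ?S\<close> by blast
      moreover have "y \<in> T - U" using \<open>y \<in> F\<close> F(2) by blast
      ultimately show False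
        using at_most_one_joins[of "V y" "W y" D D' p] VW[of y] con \<open>D \<in> ?S\<close> \<open>D' \<in> ?S\<close> by simp
    qed
    show ?thesis
    proof (cases "?S = {}")
      case False
      then obtain D0 where "D0 \<in> ?S" by (meson all_not_in_conv)
      have "?S \<subseteq> {D0}"
      proof
        fix D assume "D \<in> ?S"
        then have "D = D0" using \<open>D0 \<in> ?S\<close> by (rule uniq)
        then show "D \<in> {D0}" by simp
      qed
      then show ?thesis by (rule finite_subset) simp
    qed (simp only: finite.emptyI)
  qed
  then have fin: "finite (\<Union>y\<in>F. {D \<in> \<D>. D \<inter> V y \<noteq> {} \<and> D \<inter> W y \<noteq> {}})" using F(1) by blast
  have "{D \<in> \<D>. D \<inter> N \<noteq> {} \<and> \<not> D \<subseteq> U} \<subseteq> (\<Union>y\<in>F. {D \<in> \<D>. D \<inter> V y \<noteq> {} \<and> D \<inter> W y \<noteq> {}})"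
  proof
    fix D assume D: "D \<in> {D \<in> \<D>. D \<inter> N \<noteq> {} \<and> \<not> D \<subseteq> U}"
    then obtain s where "s \<in> D" "s \<notin> U" by blast
    then have "s \<in> T - U" using con D connectedin_subset_topspace by blast
    then obtain y where y: "y \<in> F" "s \<in> W y" using F(3) by blast
    have "N \<subseteq> V y" using y unfolding N_def by blast
    then show "D \<in> (\<Union>y\<in>F. {D \<in> \<D>. D \<inter> V y \<noteq> {} \<and> D \<inter> W y \<noteq> {}})" using D y \<open>s \<in> D\<close> by blast
  qed
  then have "finite {D \<in> \<D>. D \<inter> N \<noteq> {} \<and> \<not> D \<subseteq> U}" using fin by (rule finite_subset)
  then show ?thesis using that[OF N xN] unfolding N_def by blast
qed

section \<open>Density of the free arcs\<close>

lemma homeo_in_T: "\<lbrakk>homeomorphic_map X X h; x \<in> T\<rbrakk> \<Longrightarrow> h x \<in> T"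
  using homeomorphic_imp_surjective_map by blast

lemma homeo_inj: "homeomorphic_map X X h \<Longrightarrow> inj_on h T"
  by (rule homeomorphic_imp_injective_map)

lemma homeo_oseg:
  assumes h: "homeomorphic_map X X h" and xy: "x \<in> T" "y \<in> T"
  shows "h ` oseg x y = oseg (h x) (h y)"
proof -
  have "h ` (seg x y - {x, y}) = h ` seg x y - h ` {x, y}"
    using seg_subset_T[OF xy] xy by (intro inj_on_image_set_diff[OF homeo_inj[OF h]]) auto
  then show ?thesis using homeo_seg[OF assms] by (simp add: oseg_def)
qed

lemma homeo_free_arc:
  assumes h: "homeomorphic_map X X h" and I: "free_arc X I"
  shows "free_arc X (h ` I)"
proof -
  obtain x y where xy: "x \<in> T" "y \<in> T" "x \<noteq> y" "I = seg x y" "openin X (oseg x y)"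
    using I unfolding free_arc_iff by blast
  have "openin X (h ` oseg x y)"
    using h homeomorphic_imp_open_map xy(5) unfolding open_map_def by blast
  moreover have "h x \<noteq> h y" using inj_onD[OF homeo_inj[OF h] _ xy(1,2)] xy(3) by blast
  ultimately show ?thesis
    unfolding free_arc_iff using homeo_in_T[OF h] xy homeo_seg[OF h xy(1,2)] homeo_oseg[OF h xy(1,2)]
    by metis
qed

lemma homeo_inverse:
  assumes h: "homeomorphic_map X X h"
  obtains k where "homeomorphic_map X X k" "\<And>x. x \<in> T \<Longrightarrow> k (h x) = x" "\<And>x. x \<in> T \<Longrightarrow> h (k x) = x"
proof -
  obtain k where k: "homeomorphic_maps X X h k" using h homeomorphic_map_maps by blast
  then have "homeomorphic_map X X k" "\<forall>x\<in>T. k (h x) = x" "\<forall>x\<in>T. h (k x) = x"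
    by (simp_all add: homeomorphic_maps_map)
  then show ?thesis by (intro that[of k]) simp_all
qed

lemma homeo_max_free_arc:
  assumes h: "homeomorphic_map X X h" and I: "I \<in> max_free_arcs X"
  shows "h ` I \<in> max_free_arcs X"
proof -
  obtain k where k: "homeomorphic_map X X k" "\<And>x. x \<in> T \<Longrightarrow> k (h x) = x" "\<And>x. x \<in> T \<Longrightarrow> h (k x) = x"
    using homeo_inverse[OF h] by metis
  have fI: "free_arc X I" using I by (simp add: max_free_arcs_def)
  have sub: "J \<subseteq> T" if "free_arc X J" for J using that seg_subset_T unfolding free_arc_iff by blast
  have "J = h ` I" if J: "free_arc X J" "h ` I \<subseteq> J" for J
  proof -
    have "k ` h ` I = I" using k(2) sub[OF fI] by (force simp: image_image)
    then have "I \<subseteq> k ` J" using J(2) by blast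
    then have "k ` J = I" using I homeo_free_arc[OF k(1) J(1)] by (simp add: max_free_arcs_def)
    moreover have "h ` k ` J = J" using k(3) sub[OF J(1)] by (force simp: image_image)
    ultimately show ?thesis by blast
  qed
  then show ?thesis using homeo_free_arc[OF h fI] by (simp add: max_free_arcs_def)
qed

text \<open>Homeomorphisms permute the free arcs, and therefore preserve the intersection of all closed connected
  sets that contain them. By dendro-minimality this intersection is the whole space.\<close>

lemma hull_of_free_arcs:
  assumes min: "dendro_minimal X" and ex: "free_arc X I0"
    and C: "closedin X C" "connectedin X C" "\<Union>{I. free_arc X I} \<subseteq> C"
  shows "C = T"
proof -
  define A where "A = \<Union>{I. free_arc X I}"
  define \<C> where "\<C> = {C. closedin X C \<and> connectedin X C \<and> A \<subseteq> C}"
  define H where "H = \<Inter>\<C>"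
  have "C \<in> \<C>" using C by (simp add: \<C>_def A_def)
  have inv: "h ` H \<subseteq> H" if h: "homeomorphic_map X X h" for h
  proof -
    obtain k where k: "homeomorphic_map X X k" "\<And>x. x \<in> T \<Longrightarrow> k (h x) = x" "\<And>x. x \<in> T \<Longrightarrow> h (k x) = x"
      using homeo_inverse[OF h] by metis
    have "h ` H \<subseteq> D" if D: "D \<in> \<C>" for D
    proof -
      have DT: "D \<subseteq> T" using D closedin_subset[of X D] by (simp add: \<C>_def)
      have "closedin X D" "connectedin X D" using D by (simp_all add: \<C>_def)
      then have "closedin X (k ` D)" "connectedin X (k ` D)"
        using homeomorphic_map_closedness[OF k(1) DT] homeomorphic_map_connectedness[OF k(1) DT] by simp_all
      moreover have "A \<subseteq> k ` D"
      proof
        fix a assume "a \<in> A"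
        then obtain I where I: "free_arc X I" "a \<in> I" by (auto simp: A_def)
        then have "a \<in> T" using seg_subset_T unfolding free_arc_iff by blast
        have "h a \<in> A" using homeo_free_arc[OF h I(1)] I(2) unfolding A_def by blast
        then have "h a \<in> D" using D by (auto simp: \<C>_def)
        then show "a \<in> k ` D" using k(2)[OF \<open>a \<in> T\<close>] by (metis imageI)
      qed
      ultimately have "H \<subseteq> k ` D" unfolding H_def \<C>_def by blast
      then have "h ` H \<subseteq> h ` k ` D" by blast
      also have "\<dots> \<subseteq> D" using k(3) DT by (auto simp: subset_iff)
      finally show ?thesis .
    qed
    then show ?thesis unfolding H_def by blast
  qed
  have HT: "H \<subseteq> T" using \<open>C \<in> \<C>\<close> C closedin_subset unfolding H_def by blast
  have "A \<subseteq> H" unfolding H_def \<C>_def by blast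
  moreover have "A \<noteq> {}"
  proof -
    obtain x y where "I0 = seg x y" using ex unfolding free_arc_iff by blast
    then show ?thesis using ex unfolding A_def by (metis UnionI ends_in_seg(1) ex_in_conv mem_Collect_eq)
  qed
  ultimately have "H \<noteq> {}" by blast
  moreover have "closedin X H"
    unfolding H_def using \<open>C \<in> \<C>\<close> by (intro closedin_Inter) (auto simp: \<C>_def)
  moreover have "connectedin X H"
    unfolding H_def using \<open>C \<in> \<C>\<close> by (intro connectedin_Inter) (auto simp: \<C>_def)
  ultimately have "subdendrite X H" by (simp add: subdendrite_def)
  moreover have "h ` H = H" if "h \<in> carrier (homeo_group X)" for h
  proof
    have h: "homeomorphic_map X X h" using that by (simp add: homeo_group_def)
    then show "h ` H \<subseteq> H" by (rule inv)
    obtain k where k: "homeomorphic_map X X k" "\<And>x. x \<in> T \<Longrightarrow> h (k x) = x"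
      using homeo_inverse[OF h] by metis
    show "H \<subseteq> h ` H"
    proof
      fix x assume "x \<in> H"
      then have "k x \<in> H" "h (k x) = x" using inv[OF k(1)] k(2) HT by blast+
      then show "x \<in> h ` H" by (metis imageI)
    qed
  qed
  ultimately have "H = T" using min unfolding dendro_minimal_def by blast
  then show ?thesis using \<open>C \<in> \<C>\<close> C(1) closedin_subset unfolding H_def by blast
qed

lemma connectedin_beyond:
  assumes "r \<in> T" "w \<in> T" shows "connectedin X {s \<in> T. r \<in> seg w s}" (is "connectedin X ?B")
proof (rule connectedin_if_segs)
  have ray: "seg s r \<subseteq> ?B" if s: "s \<in> ?B" for s
  proof
    fix t assume t: "t \<in> seg s r"
    have sT: "s \<in> T" "r \<in> seg w s" using s by auto
    then have "t \<in> T" using t assms in_T_if_in_seg by blast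
    moreover have "r \<in> seg w t"
    proof (rule ccontr)
      assume n: "r \<notin> seg w t"
      then have "r \<in> seg s t" using seg_triangle[of w t s] sT assms \<open>t \<in> T\<close> seg_commute[of t s] by blast
      then have "t = r" using seg_antisym[of t s r] t sT assms by blast
      with n show False by simp
    qed
    ultimately show "t \<in> ?B" by simp
  qed
  fix s t assume st: "s \<in> ?B" "t \<in> ?B"
  then have "seg s t \<subseteq> seg s r \<union> seg t r"
    using seg_triangle[of s r t] assms seg_commute[of r t] by simp
  then show "seg s t \<subseteq> ?B" using ray[OF st(1)] ray[OF st(2)] by blast
qed auto

text \<open>Cut the arc at the first positive parameter at which it meets \<open>R\<close>, or at its end if there is none.\<close>

lemma seg_avoiding_finite:
  assumes "x \<in> T" "y \<in> T" "x \<noteq> y" and R: "finite R"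
  obtains y' where "y' \<in> seg x y" "y' \<noteq> x" "oseg x y' \<inter> R = {}"
proof -
  obtain g where g: "arc_param X (seg x y) g" "g 0 = x" "g 1 = y" using seg_arc[OF assms(1-3)] .
  note p = arc_param_props[OF g(1)]
  define S where "S = insert 1 {s \<in> {0<..1}. g s \<in> R}"
  have "finite (g -` R \<inter> {0..1})" using R p(2) by (rule finite_vimage_IntI)
  moreover have "{s \<in> {0<..1}. g s \<in> R} \<subseteq> g -` R \<inter> {0..1}" by auto
  ultimately have fS: "finite S" unfolding S_def using finite_subset by blast
  define b where "b = Min S"
  have "b \<in> S" unfolding b_def using fS by (intro Min_in) (auto simp: S_def)
  then have b: "0 < b" "b \<le> 1" by (auto simp: S_def)
  have "oseg x (g b) \<inter> R = {}"
  proof (rule ccontr)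
    assume "oseg x (g b) \<inter> R \<noteq> {}"
    then obtain r where r: "r \<in> seg x (g b)" "r \<noteq> x" "r \<noteq> g b" "r \<in> R" by (auto simp: oseg_def)
    have "seg x (g b) \<subseteq> g ` {0..b}"
    proof (rule seg_subset_connected)
      show "connectedin X (g ` {0..b})" using b by (intro connectedin_arc_param_image[OF g(1)]) auto
      have "0 \<in> {0..b}" "b \<in> {0..b}" using b by auto
      then show "x \<in> g ` {0..b}" "g b \<in> g ` {0..b}" using g(2) by blast+
    qed
    then obtain s where s: "s \<in> {0..b}" "r = g s" using r(1) by blast
    then have "s \<noteq> 0" "s \<noteq> b" using r g(2) by auto
    then have "s \<in> S" "s < b" using s r(4) b by (auto simp: S_def)
    then show False using fS Min_le unfolding b_def by (metis leD)
  qed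
  moreover have "g b \<in> seg x y" using b p(1) by auto
  moreover have "g b \<noteq> x" using inj_onD[OF p(2), of b 0] b g(2) by auto
  ultimately show ?thesis using that by blast
qed

text \<open>The median of \<open>x\<close>, \<open>y\<close> and a point \<open>s\<close> outside the open segment must be an end, so the complement of the
  open segment is the union of the two closed sets hanging on the ends.\<close>

lemma free_arc_if_no_branch:
  assumes xy: "x \<in> T" "y \<in> T" "x \<noteq> y"
    and nb: "\<And>r s. \<lbrakk>r \<in> oseg x y; s \<in> T; s \<noteq> r; r \<in> seg x s; r \<in> seg y s\<rbrakk> \<Longrightarrow> False"
  shows "free_arc X (seg x y)"
proof -
  define A where "A = {s \<in> T. x \<in> seg y s}"
  define B where "B = {s \<in> T. y \<in> seg x s}"
  have "closedin X (A \<union> B)" unfolding A_def B_def using closedin_beyond xy by (intro closedin_Un) auto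
  moreover have "oseg x y = T - (A \<union> B)"
  proof (intro equalityI subsetI)
    fix s assume s: "s \<in> oseg x y"
    then have sT: "s \<in> T" and s': "s \<in> seg x y" "s \<noteq> x" "s \<noteq> y" using oseg_subset_T xy by (auto simp: oseg_def)
    have "x \<notin> seg y s" using seg_antisym[of s y x] s' xy seg_commute[of y x] by blast
    moreover have "y \<notin> seg x s" using seg_antisym[of s x y] s' xy by blast
    ultimately show "s \<in> T - (A \<union> B)" using sT by (simp add: A_def B_def)
  next
    fix s assume "s \<in> T - (A \<union> B)"
    then have s: "s \<in> T" "x \<notin> seg y s" "y \<notin> seg x s" by (auto simp: A_def B_def)
    obtain r where r: "r \<in> seg x y" "r \<in> seg x s" "r \<in> seg y s" using seg_median[OF xy(1,2) s(1)] .
    then have "r \<in> oseg x y" using s by (auto simp: oseg_def)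
    then show "s \<in> oseg x y" using nb r(2,3) s(1) by blast
  qed
  ultimately have "openin X (oseg x y)" by (simp add: openin_diff)
  then show ?thesis unfolding free_arc_iff using xy by blast
qed

text \<open>If the closure \<open>F\<close> of the free arcs were not everything, some segment would avoid it. Only finitely many
  branches leave this segment, because each of them reaches \<open>F\<close> and they form a null family. Between two
  consecutive branch points the segment would be a free arc outside \<open>F\<close>.\<close>

lemma free_arcs_dense:
  assumes min: "dendro_minimal X" and ex: "free_arc X I0"
  shows "X closure_of (\<Union>{I. free_arc X I}) = T"
proof (rule ccontr)
  define F where "F = X closure_of (\<Union>{I. free_arc X I})"
  assume "X closure_of (\<Union>{I. free_arc X I}) \<noteq> T"
  then have "T - F \<noteq> {}" 
    unfolding F_def using closure_of_subset_topspace[of X "\<Union>{I. free_arc X I}"] by blast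
  then obtain x where x: "x \<in> T - F" by blast
  have clF: "closedin X F" by (simp add: F_def)
  have freeT: "\<Union>{I. free_arc X I} \<subseteq> T" using seg_subset_T unfolding free_arc_iff by blast
  have freeF: "\<Union>{I. free_arc X I} \<subseteq> F" unfolding F_def by (rule closure_of_subset[OF freeT])
  have hull: "C = T" if "closedin X C" "connectedin X C" "F \<subseteq> C" for C
    using hull_of_free_arcs[OF min ex that(1,2)] that(3) freeF by blast
  have opW: "openin X (T - F)" using clF by blast
  obtain V where V: "openin X V" "connectedin X V" "x \<in> V" "V \<subseteq> T - F"
    using locally_connected_X opW x unfolding locally_connected_space by metis
  have xT: "x \<in> T" using x by blast
  have "V \<noteq> {x}"
  proof
    assume "V = {x}"
    then have "openin X {x}" "closedin X {x}" using V(1) closedin_Hausdorff_singleton[OF Hausdorff_X xT] by auto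
    then have "T = {x}" using connected_X unfolding connected_space_clopen_in by blast
    moreover obtain p q where "p \<in> T" "q \<in> T" "p \<noteq> q" using ex unfolding free_arc_iff by blast
    ultimately show False by (metis singletonD)
  qed
  then obtain y where y: "y \<in> V" "y \<noteq> x" using V(3) by blast
  have yT: "y \<in> T" using y V(4) by blast
  have sV: "seg x y \<subseteq> T - F" using seg_subset_connected[OF V(2,3) y(1)] V(4) by blast
  \<comment> \<open>The points at which something branches off \<open>seg x y\<close>; \<open>D r\<close> below is the branch at \<open>r\<close> that
      contains \<open>b r\<close>.\<close>
  define R where "R = {r \<in> oseg x y. \<exists>b\<in>T. b \<noteq> r \<and> r \<in> seg x b \<and> r \<in> seg y b}"
  have "\<forall>r\<in>R. \<exists>b. b \<in> T \<and> b \<noteq> r \<and> r \<in> seg x b \<and> r \<in> seg y b" unfolding R_def by blast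
  then obtain b where b: "\<And>r. r \<in> R \<Longrightarrow> b r \<in> T \<and> b r \<noteq> r \<and> r \<in> seg x (b r) \<and> r \<in> seg y (b r)" by metis
  have RT: "r \<in> T" "r \<in> seg x y" if "r \<in> R" for r
    using that oseg_subset_T[OF xT yT] unfolding R_def oseg_def by auto
  define D where "D r = {s \<in> T. r \<notin> seg (b r) s}" for r
  define K where "K r = insert r (D r)" for r
  \<comment> \<open>A branch that misses \<open>F\<close> could be cut off, leaving a proper sub-dendrite that contains \<open>F\<close>.\<close>
  have DF: "D r \<inter> F \<noteq> {}" if r: "r \<in> R" for r
  proof
    assume "D r \<inter> F = {}"
    then have "F \<subseteq> {s \<in> T. r \<in> seg (b r) s}" using closedin_subset[OF clF] unfolding D_def by blast
    then have "{s \<in> T. r \<in> seg (b r) s} = T"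
      using closedin_beyond connectedin_beyond RT[OF r] b[OF r] by (intro hull) auto
    then have "r \<in> seg (b r) (b r)" using b[OF r] by blast
    then show False using seg_refl b[OF r] by auto
  qed
  have conK: "connectedin X (K r)" if "r \<in> R" for r
    unfolding K_def D_def using connectedin_component_insert RT[OF that] b[OF that] by blast
  have Kseg: "K r \<inter> seg x y \<subseteq> {r}" if r: "r \<in> R" for r
  proof
    fix t assume t: "t \<in> K r \<inter> seg x y"
    show "t \<in> {r}"
    proof (rule ccontr)
      assume "t \<notin> {r}"
      then have tr: "t \<noteq> r" and tT: "t \<in> T" and tb: "r \<notin> seg t (b r)"
        using t seg_commute[of t] unfolding K_def D_def by auto
      have br: "b r \<in> T" "r \<in> seg x (b r)" "r \<in> seg y (b r)" using b[OF r] by auto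
      have "t \<in> seg x r \<or> t \<in> seg y r"
        using t seg_triangle[OF xT RT(1)[OF r] yT] seg_commute[of r y] by blast
      then have "r \<notin> seg x t \<or> r \<notin> seg y t"
        using seg_antisym[of t x r] seg_antisym[of t y r] tr xT yT RT(1)[OF r] by blast
      then show False
        using seg_triangle[OF xT tT br(1)] seg_triangle[OF yT tT br(1)] br tb by blast
    qed
  qed
  have disj: "K r \<inter> K r' = {}" if r: "r \<in> R" "r' \<in> R" "r \<noteq> r'" for r r'
  proof (rule ccontr)
    assume "K r \<inter> K r' \<noteq> {}"
    then have "connectedin X (K r \<union> K r')" using conK r by (intro connectedin_Un) auto
    then have "seg r r' \<subseteq> K r \<union> K r'" by (rule seg_subset_connected) (auto simp: K_def)
    moreover have "seg r r' \<subseteq> seg x y"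
      using RT(2) r connectedin_seg[OF xT yT] by (intro seg_subset_connected) auto
    ultimately have "seg r r' \<subseteq> {r, r'}" using Kseg r by blast
    then have "finite (seg r r')" using finite_subset by blast
    then show False using infinite_seg RT(1) r by blast
  qed
  \<comment> \<open>No branch stays in the complement of \<open>F\<close>, so only finitely many come near a given point.\<close>
  have "\<exists>N. openin X N \<and> q \<in> N \<and> finite {C \<in> K ` R. C \<inter> N \<noteq> {}}" if q: "q \<in> seg x y" for q
  proof -
    obtain N where N: "openin X N" "q \<in> N" "finite {C \<in> K ` R. C \<inter> N \<noteq> {} \<and> \<not> C \<subseteq> T - F}"
    proof (rule null_family[of "K ` R" "T - F" q])
      show "\<exists>p. C \<inter> C' \<subseteq> {p}" if "C \<in> K ` R" "C' \<in> K ` R" "C \<noteq> C'" for C C'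
        using that disj by blast
    qed (use conK opW q sV that in blast)+
    moreover have "\<not> C \<subseteq> T - F" if "C \<in> K ` R" for C using that DF unfolding K_def by blast
    then have "{C \<in> K ` R. C \<inter> N \<noteq> {} \<and> \<not> C \<subseteq> T - F} = {C \<in> K ` R. C \<inter> N \<noteq> {}}" by blast
    ultimately show ?thesis by metis
  qed
  then obtain N where N: "\<And>q. q \<in> seg x y \<Longrightarrow> openin X (N q) \<and> q \<in> N q \<and> finite {C \<in> K ` R. C \<inter> N q \<noteq> {}}"
    by metis
  have "\<exists>\<F>. finite \<F> \<and> \<F> \<subseteq> N ` seg x y \<and> seg x y \<subseteq> \<Union>\<F>"
  proof (rule compactinD[OF compactin_seg[OF xT yT]])
    show "openin X S" if "S \<in> N ` seg x y" for S using that N by blast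
    show "seg x y \<subseteq> \<Union>(N ` seg x y)" using N by blast
  qed
  then obtain \<F> where \<F>: "finite \<F>" "\<F> \<subseteq> N ` seg x y" "seg x y \<subseteq> \<Union>\<F>" by blast
  have "finite (\<Union>S\<in>\<F>. {C \<in> K ` R. C \<inter> S \<noteq> {}})"
  proof (intro finite_UN_I \<F>(1))
    fix S assume "S \<in> \<F>"
    then obtain q where "q \<in> seg x y" "S = N q" using \<F>(2) by blast
    then show "finite {C \<in> K ` R. C \<inter> S \<noteq> {}}" using N by simp
  qed
  moreover have "K ` R \<subseteq> (\<Union>S\<in>\<F>. {C \<in> K ` R. C \<inter> S \<noteq> {}})"
  proof
    fix C assume C: "C \<in> K ` R"
    then obtain r where r: "r \<in> R" "C = K r" by blast
    then obtain S where "S \<in> \<F>" "r \<in> S" using \<F>(3) RT(2) by blast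
    moreover have "r \<in> C" using r by (simp add: K_def)
    ultimately show "C \<in> (\<Union>S\<in>\<F>. {C \<in> K ` R. C \<inter> S \<noteq> {}})" using C by blast
  qed
  ultimately have "finite (K ` R)" using finite_subset by blast
  moreover have "inj_on K R"
  proof (rule inj_onI, rule ccontr)
    fix r r' assume "r \<in> R" "r' \<in> R" "K r = K r'" "r \<noteq> r'"
    then show False using disj[of r r'] by (auto simp: K_def)
  qed
  ultimately have "finite R" using finite_imageD by blast
  then obtain y' where y': "y' \<in> seg x y" "y' \<noteq> x" "oseg x y' \<inter> R = {}"
    using seg_avoiding_finite[OF xT yT y(2)[symmetric]] by metis
  have y'T: "y' \<in> T" using y'(1) in_T_if_in_seg xT yT by blast
  have "free_arc X (seg x y')"
  proof (rule free_arc_if_no_branch[OF xT y'T y'(2)[symmetric]])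
    fix r s assume r: "r \<in> oseg x y'" and s: "s \<in> T" "s \<noteq> r" "r \<in> seg x s" "r \<in> seg y' s"
    have rT: "r \<in> T" using r oseg_subset_T xT y'T by blast
    have r1: "r \<in> seg x y'" "r \<noteq> x" "r \<noteq> y'" using r by (auto simp: oseg_def)
    have rxy: "r \<in> seg x y" using r1(1) seg_mono[OF y'(1) xT yT] by blast
    have "r \<noteq> y"
    proof
      assume "r = y"
      then have "y' = y" using seg_antisym[OF y'(1) _ xT yT] r1(1) by blast
      then show False using \<open>r = y\<close> r1(3) by simp
    qed
    have "y' \<in> seg r y" using seg_split_order[OF y'(1) r1(1,3) xT yT] .
    then have "r \<notin> seg y' y"
      using seg_antisym[of y' y r] r1(3) yT rT unfolding seg_commute[of r y] seg_commute[of y' y] by blast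
    then have "r \<in> seg y s" using s(4) seg_triangle[OF y'T yT s(1)] by blast
    then have "r \<in> R" unfolding R_def using rxy r1(2) \<open>r \<noteq> y\<close> s by (auto simp: oseg_def)
    then show False using r y'(3) by blast
  qed
  then have "x \<in> F" using freeF ends_in_seg(1)[of x y'] by blast
  then show False using x by blast
qed

corollary max_free_arcs_dense:
  assumes "dendro_minimal X" and "free_arc X I0"
  shows "X closure_of (\<Union>(max_free_arcs X)) = T"
proof -
  have "\<Union>(max_free_arcs X) = \<Union>{I. free_arc X I}"
  proof
    show "\<Union>(max_free_arcs X) \<subseteq> \<Union>{I. free_arc X I}" by (auto simp: max_free_arcs_def)
    show "\<Union>{I. free_arc X I} \<subseteq> \<Union>(max_free_arcs X)"
    proof
      fix x assume "x \<in> \<Union>{I. free_arc X I}"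
      then obtain I where I: "free_arc X I" "x \<in> I" by blast
      obtain M where "M \<in> max_free_arcs X" "I \<subseteq> M" by (rule free_arc_in_max_free_arc[OF I(1)])
      then show "x \<in> \<Union>(max_free_arcs X)" using I(2) by blast
    qed
  qed
  then show ?thesis using free_arcs_dense[OF assms] by simp
qed

section \<open>Gluing homeomorphisms of the maximal free arcs\<close>

abbreviation "Free \<equiv> max_free_arcs X"

abbreviation homeo_on :: "'a set \<Rightarrow> 'a set \<Rightarrow> ('a \<Rightarrow> 'a) \<Rightarrow> bool" where
  "homeo_on I J f \<equiv> homeomorphic_map (subtopology X I) (subtopology X J) f"

text \<open>The extremities are the points that do not cut the arc. This description refers to no parametrisation and
  is visibly preserved by homeomorphisms.\<close>

definition extremities :: "'a set \<Rightarrow> 'a set" where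
  "extremities I = {z \<in> I. connectedin X (I - {z})}"

lemma max_free_arc_subset: "I \<in> Free \<Longrightarrow> I \<subseteq> T"
  using max_free_arcs_seg seg_subset_T by metis

lemma homeo_on_inverse:
  assumes "homeo_on I J f" "I \<subseteq> T" "J \<subseteq> T"
  obtains k where "homeo_on J I k" "\<And>x. x \<in> I \<Longrightarrow> k (f x) = x" "\<And>x. x \<in> J \<Longrightarrow> f (k x) = x"
proof -
  obtain k where "homeomorphic_maps (subtopology X I) (subtopology X J) f k"
    using assms(1) homeomorphic_map_maps by blast
  then have "homeo_on J I k" "\<forall>x\<in>I. k (f x) = x" "\<forall>x\<in>J. f (k x) = x"
    using assms(2,3) by (simp_all add: homeomorphic_maps_map inf_absorb2)
  then show ?thesis by (intro that[of k]) simp_all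
qed

lemma homeo_on_image: "\<lbrakk>homeo_on I J f; I \<subseteq> T; J \<subseteq> T\<rbrakk> \<Longrightarrow> f ` I = J"
  using homeomorphic_imp_surjective_map[of "subtopology X I" "subtopology X J" f] by (simp add: inf_absorb2)

lemma homeo_on_inj: "\<lbrakk>homeo_on I J f; I \<subseteq> T\<rbrakk> \<Longrightarrow> inj_on f I"
  using homeomorphic_imp_injective_map[of "subtopology X I" "subtopology X J" f] by (simp add: inf_absorb2)

lemma homeo_on_restrict:
  assumes "homeomorphic_map X X h" "I \<subseteq> T" shows "homeo_on I (h ` I) h"
proof (rule homeomorphic_map_subtopologies[OF assms(1)])
  have "h ` I \<subseteq> T" using assms homeo_in_T by blast
  then show "h ` (T \<inter> I) = T \<inter> h ` I" using assms(2) by (simp add: inf_absorb2)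
qed

lemma extremities_seg:
  assumes "x \<in> T" "y \<in> T" "x \<noteq> y" shows "extremities (seg x y) = {x, y}"
proof -
  have half: "connectedin X (seg x y - {x})" if xy: "x \<in> T" "y \<in> T" "x \<noteq> y" for x y
  proof -
    obtain g where g: "arc_param X (seg x y) g" "g 0 = x" "g 1 = y" using seg_arc[OF xy] .
    have "g ` {0..1} - g ` {0} = g ` ({0..1} - {0})"
      using arc_param_props(2)[OF g(1)] by (subst inj_on_image_set_diff[of g "{0..1}"]) auto
    moreover have "{0..1} - {0} = {0<..1::real}" by auto
    ultimately have "seg x y - {x} = g ` {0<..1}" using arc_param_props(1)[OF g(1)] g(2) by simp
    moreover have "{0<..1} \<subseteq> {0..1::real}" by auto
    ultimately show ?thesis using connectedin_arc_param_image[OF g(1) connected_Ioc] by simp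
  qed
  have "\<not> connectedin X (seg x y - {z})" if "z \<in> seg x y" "z \<noteq> x" "z \<noteq> y" for z
  proof
    assume "connectedin X (seg x y - {z})"
    then have "seg x y \<subseteq> seg x y - {z}" by (rule seg_subset_connected) (use that in auto)
    then show False using that by blast
  qed
  moreover have "connectedin X (seg x y - {y})"
    using half[OF assms(2,1)] assms(3) seg_commute[of x y] by auto
  ultimately show ?thesis using half[OF assms] unfolding extremities_def by auto
qed

lemma extremities_homeo_on:
  assumes f: "homeo_on I J f" and IJ: "I \<subseteq> T" "J \<subseteq> T"
  shows "f ` extremities I = extremities J"
proof -
  have sub: "f ` extremities I \<subseteq> extremities J" if f: "homeo_on I J f" and IJ: "I \<subseteq> T" "J \<subseteq> T" for I J f
  proof
    fix w assume "w \<in> f ` extremities I"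
    then obtain z where z: "w = f z" "z \<in> I" "connectedin X (I - {z})" by (auto simp: extremities_def)
    have "f ` (I - {z}) = f ` I - f ` {z}"
      using z(2) by (intro inj_on_image_set_diff[OF homeo_on_inj[OF f IJ(1)]]) auto
    then have eq: "f ` (I - {z}) = J - {w}" using homeo_on_image[OF f IJ] z(1) by simp
    have "connectedin (subtopology X I) (I - {z})" using z(3) by (simp add: connectedin_subtopology)
    then have "connectedin (subtopology X J) (f ` (I - {z}))"
      by (rule connectedin_continuous_map_image[OF homeomorphic_imp_continuous_map[OF f]])
    then have "connectedin X (J - {w})" using eq by (simp add: connectedin_subtopology)
    moreover have "w \<in> J" using homeo_on_image[OF f IJ] z by blast
    ultimately show "w \<in> extremities J" by (simp add: extremities_def)
  qed
  obtain k where k: "homeo_on J I k" "\<And>x. x \<in> I \<Longrightarrow> k (f x) = x" "\<And>x. x \<in> J \<Longrightarrow> f (k x) = x"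
    using homeo_on_inverse[OF assms] by metis
  have "extremities J \<subseteq> f ` extremities I"
  proof
    fix w assume w: "w \<in> extremities J"
    then have "w \<in> J" by (simp add: extremities_def)
    have "k w \<in> extremities I" using sub[OF k(1) IJ(2,1)] w by blast
    then show "w \<in> f ` extremities I" using k(3)[OF \<open>w \<in> J\<close>] by (metis imageI)
  qed
  with sub[OF assms] show ?thesis by blast
qed

lemma max_free_arc_facts:
  assumes "I \<in> Free"
  shows "openin X (I - extremities I)" "I \<subseteq> X closure_of (I - extremities I)" "finite (extremities I)" "extremities I \<subseteq> I"
    "I - extremities I \<noteq> {}" "connectedin X I" "closedin X I"
    "\<And>J. \<lbrakk>J \<in> Free; J \<noteq> I\<rbrakk> \<Longrightarrow> (I - extremities I) \<inter> J = {}"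
proof -
  obtain x y where xy: "x \<in> T" "y \<in> T" "x \<noteq> y" "I = seg x y" "openin X (oseg x y)"
    using max_free_arcs_seg[OF assms] .
  have e: "extremities I = {x, y}" "I - extremities I = oseg x y" using extremities_seg xy by (auto simp: oseg_def)
  show "openin X (I - extremities I)" "I \<subseteq> X closure_of (I - extremities I)" "finite (extremities I)" "extremities I \<subseteq> I"
    "I - extremities I \<noteq> {}" "connectedin X I" "closedin X I"
    using e xy seg_subset_closure_oseg[OF xy(1-3)] oseg_nonempty[OF xy(1-3)]
      connectedin_seg[OF xy(1,2)] closedin_seg[OF xy(1,2)] by auto
  show "(I - extremities I) \<inter> J = {}" if "J \<in> Free" "J \<noteq> I" for J
    using oseg_disjoint_max_free_arc[of x y J] assms that xy e by auto
qed

lemma max_free_arcs_Int_extremities: "\<lbrakk>I \<in> Free; J \<in> Free; I \<noteq> J; x \<in> I; x \<in> J\<rbrakk> \<Longrightarrow> x \<in> extremities I"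
  using max_free_arc_facts(8) by blast

text \<open>The intersection is connected and consists of extremities, hence is finite.\<close>

lemma max_free_arcs_Int_subsingleton:
  assumes "I \<in> Free" "J \<in> Free" "I \<noteq> J" shows "\<exists>p. I \<inter> J \<subseteq> {p}"
proof (rule ccontr)
  assume n: "\<nexists>p. I \<inter> J \<subseteq> {p}"
  then obtain u where u: "u \<in> I \<inter> J" by blast
  then obtain v where v: "v \<in> I \<inter> J" "v \<noteq> u" using n by blast
  have "connectedin X (I \<inter> J)" using assms max_free_arc_facts(6) connectedin_Int by blast
  then have "seg u v \<subseteq> I \<inter> J" using u v(1) by (rule seg_subset_connected)
  also have "\<dots> \<subseteq> extremities I" using max_free_arcs_Int_extremities assms by blast
  finally have "finite (seg u v)" using max_free_arc_facts(3)[OF assms(1)] finite_subset by blast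
  then show False using infinite_seg u v max_free_arc_subset[OF assms(1)] by blast
qed

text \<open>If all \<open>f I\<close> fix the extremities of \<open>I\<close>, the choice of the arc \<open>I\<close> through \<open>x\<close> does not matter, because
  distinct maximal free arcs have only extremities in common.\<close>

definition glue :: "('a set \<Rightarrow> 'a \<Rightarrow> 'a) \<Rightarrow> 'a \<Rightarrow> 'a" where
  "glue f x = (if \<exists>I\<in>Free. x \<in> I then f (SOME I. I \<in> Free \<and> x \<in> I) x else x)"

lemma glue_eq:
  assumes fix_ends: "\<And>I z. \<lbrakk>I \<in> Free; z \<in> extremities I\<rbrakk> \<Longrightarrow> f I z = z" and "I \<in> Free" "x \<in> I"
  shows "glue f x = f I x"
proof -
  define J where "J = (SOME I. I \<in> Free \<and> x \<in> I)"
  have J: "J \<in> Free" "x \<in> J" using someI[of "\<lambda>I. I \<in> Free \<and> x \<in> I" I] assms(2,3) by (auto simp: J_def)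
  have "f J x = f I x"
  proof (cases "I = J")
    case False
    then have "x \<in> extremities I" "x \<in> extremities J" using max_free_arcs_Int_extremities assms(2,3) J by blast+
    then show ?thesis using fix_ends J(1) assms(2) by simp
  qed simp
  then show ?thesis using assms(2,3) unfolding glue_def J_def by auto
qed

lemma glue_outside: "(\<And>I. I \<in> Free \<Longrightarrow> x \<notin> I) \<Longrightarrow> glue f x = x"
  by (auto simp: glue_def)

lemma continuous_glue:
  assumes f: "\<And>I. I \<in> Free \<Longrightarrow> homeo_on I I (f I)"
    and fix_ends: "\<And>I z. \<lbrakk>I \<in> Free; z \<in> extremities I\<rbrakk> \<Longrightarrow> f I z = z"
  shows "continuous_map X X (glue f)"
proof -
  have eq: "glue f x = f I x" if "I \<in> Free" "x \<in> I" for I x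
    using glue_eq[of f I x] fix_ends that by blast
  have fI: "f I x \<in> I" if "I \<in> Free" "x \<in> I" for I x
    using homeo_on_image[OF f] max_free_arc_subset that by blast
  have local: "\<exists>N. openin X N \<and> x \<in> N \<and> f I ` (N \<inter> I) \<subseteq> U"
    if I: "I \<in> Free" "x \<in> I" "openin X U" "f I x \<in> U" for I x U
  proof -
    have "openin (subtopology X I) {s \<in> topspace (subtopology X I). f I s \<in> U \<inter> I}"
      using homeomorphic_imp_continuous_map[OF f[OF I(1)]] openin_subtopology_Int[OF I(3)]
      unfolding continuous_map_def by blast
    then obtain N where N: "openin X N" "{s \<in> topspace (subtopology X I). f I s \<in> U \<inter> I} = N \<inter> I"
      unfolding openin_subtopology by blast
    have "x \<in> {s \<in> topspace (subtopology X I). f I s \<in> U \<inter> I}"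
      using I(2,4) fI[OF I(1,2)] max_free_arc_subset[OF I(1)] by auto
    then have "x \<in> N" unfolding N(2) by blast
    moreover have "f I ` (N \<inter> I) \<subseteq> U" using N(2) by blast
    ultimately show ?thesis using N(1) by blast
  qed
  have nbhd: "\<exists>N. openin X N \<and> x \<in> N \<and> glue f ` N \<subseteq> U"
    if x: "x \<in> T" "openin X U" "glue f x \<in> U" for x U
  proof (cases "\<exists>I\<in>Free. x \<in> I - extremities I")
    case True
    then obtain I where I: "I \<in> Free" "x \<in> I" "x \<in> I - extremities I" by blast
    obtain N where N: "openin X N" "x \<in> N" "f I ` (N \<inter> I) \<subseteq> U"
      using local[OF I(1,2) x(2)] eq[OF I(1,2)] x(3) by auto
    have "glue f ` (N \<inter> (I - extremities I)) \<subseteq> U" using N(3) eq[OF I(1)] by force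
    moreover have "openin X (N \<inter> (I - extremities I))" using N(1) max_free_arc_facts(1)[OF I(1)] by (rule openin_Int)
    ultimately show ?thesis using N(2) I(3) by blast
  next
    case False
    \<comment> \<open>At a point that is interior to no maximal free arc the glued map fixes the
        point. Of the arcs that come close to it, all but finitely many are contained in \<open>U\<close>, whatever
        \<open>f\<close> does on them.\<close>
    have fx: "f I x = x" if "I \<in> Free" "x \<in> I" for I using False that fix_ends by blast
    have "glue f x = x" using fx eq glue_outside by metis
    then have xU: "x \<in> U" using x(3) by simp
    obtain V where V: "openin X V" "x \<in> V" "V \<subseteq> U" "finite {I \<in> Free. I \<inter> V \<noteq> {} \<and> \<not> I \<subseteq> U}"
    proof (rule null_family[of Free U x])
      show "\<And>D. D \<in> Free \<Longrightarrow> connectedin X D" by (rule max_free_arc_facts(6))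
      show "\<And>D D'. \<lbrakk>D \<in> Free; D' \<in> Free; D \<noteq> D'\<rbrakk> \<Longrightarrow> \<exists>p. D \<inter> D' \<subseteq> {p}" by (rule max_free_arcs_Int_subsingleton)
    qed (use x(2) xU in blast)+
    define B where "B = {I \<in> Free. I \<inter> V \<noteq> {} \<and> \<not> I \<subseteq> U}"
    have "\<exists>N. openin X N \<and> x \<in> N \<and> f I ` (N \<inter> I) \<subseteq> U" if "I \<in> B" for I
    proof (cases "x \<in> I")
      case True
      then show ?thesis using local[of I x U] that x(2) fx[of I] xU by (simp add: B_def)
    next
      case F: False
      have "openin X (T - I)" using that max_free_arc_facts(7) by (auto simp: B_def)
      moreover have "(T - I) \<inter> I = {}" by blast
      ultimately show ?thesis using F x(1) by (intro exI[of _ "T - I"]) simp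
    qed
    then obtain N where N: "\<And>I. I \<in> B \<Longrightarrow> openin X (N I) \<and> x \<in> N I \<and> f I ` (N I \<inter> I) \<subseteq> U" by metis
    define M where "M = \<Inter>(insert V (N ` B))"
    have "openin X M" unfolding M_def using V(1,4) N by (intro openin_Inter) (auto simp: B_def)
    moreover have "x \<in> M" unfolding M_def using V(2) N by blast
    moreover have "glue f s \<in> U" if s: "s \<in> M" for s
    proof (cases "\<exists>I\<in>Free. s \<in> I")
      case True
      then obtain I where I: "I \<in> Free" "s \<in> I" by blast
      have g: "glue f s = f I s" using eq I by blast
      show ?thesis
      proof (cases "I \<subseteq> U")
        case True then show ?thesis using g fI I by auto
      next
        case F: False
        have "s \<in> V" using s by (simp add: M_def)
        then have "I \<in> B" using F I by (auto simp: B_def)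
        then have "s \<in> N I" using s by (simp add: M_def)
        then have "f I s \<in> U" using N[OF \<open>I \<in> B\<close>] I(2) by blast
        then show ?thesis using g by simp
      qed
    next
      case F: False
      then have "glue f s = s" by (intro glue_outside) blast
      moreover have "s \<in> V" using s by (simp add: M_def)
      ultimately show ?thesis using V(3) by auto
    qed
    ultimately show ?thesis by blast
  qed
  have "glue f x \<in> T" if "x \<in> T" for x
  proof (cases "\<exists>I\<in>Free. x \<in> I")
    case True
    then obtain I where "I \<in> Free" "x \<in> I" by blast
    then show ?thesis using eq fI max_free_arc_subset by (metis subsetD)
  qed (use that glue_outside in metis)
  moreover have "openin X {x \<in> T. glue f x \<in> U}" if "openin X U" for U
  proof (subst openin_subopen, intro ballI)
    fix x assume "x \<in> {x \<in> T. glue f x \<in> U}"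
    then obtain N where "openin X N" "x \<in> N" "glue f ` N \<subseteq> U" using nbhd \<open>openin X U\<close> by blast
    moreover then have "N \<subseteq> T" using openin_subset by blast
    ultimately show "\<exists>N. openin X N \<and> x \<in> N \<and> N \<subseteq> {x \<in> T. glue f x \<in> U}" by blast
  qed
  ultimately show ?thesis unfolding continuous_map_def by blast
qed

lemma homeomorphic_map_glue:
  assumes f: "\<And>I. I \<in> Free \<Longrightarrow> homeo_on I I (f I)"
    and fix_ends: "\<And>I z. \<lbrakk>I \<in> Free; z \<in> extremities I\<rbrakk> \<Longrightarrow> f I z = z"
  shows "homeomorphic_map X X (glue f)"
proof -
  have "\<forall>I\<in>Free. \<exists>k. homeo_on I I k \<and> (\<forall>x\<in>I. k (f I x) = x) \<and> (\<forall>x\<in>I. f I (k x) = x)"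
    using homeo_on_inverse[OF f] max_free_arc_subset by metis
  then obtain k where k: "\<And>I. I \<in> Free \<Longrightarrow> homeo_on I I (k I)"
    and kf: "\<And>I x. \<lbrakk>I \<in> Free; x \<in> I\<rbrakk> \<Longrightarrow> k I (f I x) = x" "\<And>I x. \<lbrakk>I \<in> Free; x \<in> I\<rbrakk> \<Longrightarrow> f I (k I x) = x"
    by metis
  have k_ends: "k I z = z" if "I \<in> Free" "z \<in> extremities I" for I z
  proof -
    have "z \<in> I" using that(2) by (simp add: extremities_def)
    then show ?thesis using kf(1)[OF that(1)] fix_ends[OF that] by metis
  qed
  have inv: "glue g (glue h x) = x"
    if g: "\<And>I z. \<lbrakk>I \<in> Free; z \<in> extremities I\<rbrakk> \<Longrightarrow> g I z = z" and h: "\<And>I z. \<lbrakk>I \<in> Free; z \<in> extremities I\<rbrakk> \<Longrightarrow> h I z = z"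
      and hI: "\<And>I x. \<lbrakk>I \<in> Free; x \<in> I\<rbrakk> \<Longrightarrow> h I x \<in> I" and gh: "\<And>I x. \<lbrakk>I \<in> Free; x \<in> I\<rbrakk> \<Longrightarrow> g I (h I x) = x"
    for g h x
  proof (cases "\<exists>I\<in>Free. x \<in> I")
    case True
    then obtain I where I: "I \<in> Free" "x \<in> I" by blast
    then have "glue h x = h I x" using glue_eq[of h I x] h by blast
    moreover have "glue g (h I x) = g I (h I x)" using glue_eq[of g I "h I x"] g hI I by blast
    ultimately show ?thesis using gh I by simp
  next
    case False
    then have "glue h x = x" "glue g x = x" by (intro glue_outside, blast)+
    then show ?thesis by simp
  qed
  have fI: "f I x \<in> I" and kI: "k I x \<in> I" if "I \<in> Free" "x \<in> I" for I x
    using homeo_on_image[OF f] homeo_on_image[OF k] max_free_arc_subset that by blast+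
  have "glue k (glue f x) = x" for x
    by (rule inv, fact k_ends, fact fix_ends, fact fI, fact kf(1))
  moreover have "glue f (glue k x) = x" for x
    by (rule inv, fact fix_ends, fact k_ends, fact kI, fact kf(2))
  moreover have "continuous_map X X (glue f)" by (rule continuous_glue, fact f, fact fix_ends)
  moreover have "continuous_map X X (glue k)" by (rule continuous_glue, fact k, fact k_ends)
  ultimately have "homeomorphic_maps X X (glue f) (glue k)"
    by (simp add: homeomorphic_maps_def)
  then show ?thesis using homeomorphic_map_maps by blast
qed

lemma homeo_eq_if_eq_on_free_arcs:
  assumes dense: "X closure_of (\<Union>Free) = T"
    and f: "homeomorphic_map X X f" and g: "homeomorphic_map X X g"
    and eq: "\<And>I x. \<lbrakk>I \<in> Free; x \<in> I\<rbrakk> \<Longrightarrow> f x = g x" and x: "x \<in> T"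
  shows "f x = g x"
proof (rule forall_in_closure_of_eq[where X = X and Y = X and S = "\<Union>Free" and f = f and g = g and x = x])
  show "x \<in> X closure_of (\<Union>Free)" using dense x by simp
  show "continuous_map X X f" using f by (rule homeomorphic_imp_continuous_map)
  show "continuous_map X X g" using g by (rule homeomorphic_imp_continuous_map)
  show "Hausdorff_space X" by (rule Hausdorff_X)
qed (use eq in auto)

lemma second_max_free_arc:
  assumes dense: "X closure_of (\<Union>Free) = T"
    and not_arc: "\<not> X homeomorphic_space top_of_set {0..1::real}" and I: "I \<in> Free"
  obtains J where "J \<in> Free" "J \<noteq> I"
proof (rule ccontr)
  assume "\<not> thesis"
  then have "Free = {I}" using that I by blast
  then have "T = I" using dense closure_of_closedin[OF max_free_arc_facts(7)[OF I]] by simp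
  obtain g where "arc_param X I g" using I unfolding max_free_arcs_def free_arc_def by blast
  then have "homeomorphic_map (top_of_set {0..1}) X g"
    using \<open>T = I\<close> unfolding arc_param_def by (metis subtopology_topspace)
  then show False
    using not_arc homeomorphic_map_imp_homeomorphic_space homeomorphic_space_sym by blast
qed

text \<open>A homeomorphism that preserves \<open>I\<close> without fixing its extremities exchanges them. By
  \<open>swap_moves_connected_set\<close> it then moves any second maximal free arc.\<close>

lemma kernel_fixes_extremities:
  assumes dense: "X closure_of (\<Union>Free) = T"
    and not_arc: "\<not> X homeomorphic_space top_of_set {0..1::real}"
    and h: "homeomorphic_map X X h" and pres: "\<And>I. I \<in> Free \<Longrightarrow> h ` I = I"
    and I: "I \<in> Free" and z: "z \<in> extremities I"
  shows "h z = z"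
proof (rule ccontr)
  assume nz: "h z \<noteq> z"
  obtain x y where xy: "x \<in> T" "y \<in> T" "x \<noteq> y" "I = seg x y" "openin X (oseg x y)"
    using max_free_arcs_seg[OF I] .
  have e: "extremities I = {x, y}" using extremities_seg xy by simp
  have "homeo_on I I h" using homeo_on_restrict[OF h max_free_arc_subset[OF I]] pres[OF I] by simp
  then have "h ` {x, y} = {x, y}" using extremities_homeo_on max_free_arc_subset[OF I] e by metis
  then have sw: "h x = y" "h y = x" using nz z e by (auto simp: doubleton_eq_iff)
  obtain J where J: "J \<in> Free" "J \<noteq> I" using second_max_free_arc[OF dense not_arc I] .
  have "J \<noteq> {}" using max_free_arc_facts(5)[OF J(1)] by blast
  moreover have "J \<inter> oseg x y = {}" using max_free_arc_facts(8)[OF I J] e xy(4) by (auto simp: oseg_def)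
  ultimately show False
    using swap_moves_connected_set[OF xy(1-3,5) h sw max_free_arc_facts(6)[OF J(1)]] pres[OF J(1)] by blast
qed

text \<open>Read in a parametrisation, a homeomorphism of \<open>I\<close> is strictly monotone, and it is increasing exactly if
  it fixes both ends of the interval. This removes the parametrisation from the definition of
  \<open>homeo_plus\<close>.\<close>

lemma homeo_plus_carrier:
  assumes I: "I \<in> Free"
  shows "carrier (homeo_plus X I) = {h \<in> Bij I. homeo_on I I h \<and> (\<forall>z\<in>extremities I. h z = z)}"
proof -
  have IT: "I \<subseteq> T" using max_free_arc_subset[OF I] .
  have main: "strict_mono_on {0..1} (inv_into {0..1} g \<circ> h \<circ> g) \<longleftrightarrow> (\<forall>z\<in>extremities I. h z = z)"
    if h: "h \<in> Bij I" "homeo_on I I h" and g: "arc_param X I g" for h g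
  proof -
    note p = arc_param_props[OF g]
    define m where "m = inv_into {0..1} g \<circ> h \<circ> g"
    have hI: "h ` I = I" using homeo_on_image[OF h(2) IT IT] .
    have e: "extremities I = {g 0, g 1}"
    proof -
      have "g 0 \<in> T" "g 1 \<in> T" using p by auto
      then show ?thesis using extremities_seg[of "g 0" "g 1"] arc_eq_seg[OF g] p(4) by simp
    qed
    have gm: "g (m t) = h (g t)" "m t \<in> {0..1}" if "t \<in> {0..1}" for t
    proof -
      have "h (g t) \<in> g ` {0..1}" using that hI p(1) by auto
      then show "g (m t) = h (g t)" "m t \<in> {0..1}"
        unfolding m_def by (simp_all add: f_inv_into_f inv_into_into del: atLeastAtMost_iff)
    qed
    have m_im: "m ` {0..1} = {0..1}"
    proof
      show "m ` {0..1} \<subseteq> {0..1}" using gm(2) by blast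
      show "{0..1} \<subseteq> m ` {0..1}"
      proof
        fix t :: real assume t: "t \<in> {0..1}"
        then have "g t \<in> h ` g ` {0..1}" using hI p(1) by blast
        then obtain s where s: "s \<in> {0..1}" "g t = h (g s)" by blast
        then have "g (m s) = g t" using gm(1) by simp
        then have "m s = t" using inj_onD[OF p(2) _ gm(2)[OF s(1)] t] by blast
        then show "t \<in> m ` {0..1}" using s(1) by blast
      qed
    qed
    show ?thesis
    proof
      assume "strict_mono_on {0..1} (inv_into {0..1} g \<circ> h \<circ> g)"
      then have mono: "m s \<le> m t" if "s \<in> {0..1}" "t \<in> {0..1}" "s \<le> t" for s t
        using that unfolding m_def[symmetric] by (meson strict_mono_on_leD)
      have "0 \<in> m ` {0..1}" "1 \<in> m ` {0..1}" using m_im by auto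
      then obtain s t where "s \<in> {0..1}" "m s = 0" "t \<in> {0..1}" "m t = 1" by force
      then have "m 0 \<le> 0" "1 \<le> m 1" using mono[of 0 s] mono[of t 1] by auto
      then have "m 0 = 0" "m 1 = 1" using gm(2)[of 0] gm(2)[of 1] by auto
      then show "\<forall>z\<in>extremities I. h z = z" using gm(1)[of 0] gm(1)[of 1] e by auto
    next
      assume fixd: "\<forall>z\<in>extremities I. h z = z"
      obtain k where k: "homeomorphic_maps (top_of_set {0..1}) (subtopology X I) g k"
        using g homeomorphic_map_maps unfolding arc_param_def by blast
      have kg: "k (g t) = t" if "t \<in> {0..1}" for t using k that by (simp add: homeomorphic_maps_def)
      \<comment> \<open>The continuous inverse \<open>k\<close> of \<open>g\<close> replaces \<open>inv_into\<close> in order to show continuity.\<close>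
      have mk: "m t = (k \<circ> (h \<circ> g)) t" if "t \<in> {0..1}" for t
        using kg[OF gm(2)[OF that]] gm(1)[OF that] by simp
      have "continuous_map (top_of_set {0..1}) (subtopology X I) g"
           "continuous_map (subtopology X I) (top_of_set {0..1}) k"
        using k by (simp_all add: homeomorphic_maps_def)
      then have "continuous_map (top_of_set {0..1}) (top_of_set {0..1}) (k \<circ> (h \<circ> g))"
        using homeomorphic_imp_continuous_map[OF h(2)] by (meson continuous_map_compose)
      then have "continuous_on {0..1} (k \<circ> (h \<circ> g))" by simp
      then have cm: "continuous_on {0..1} m" using mk by (metis (no_types, lifting) continuous_on_cong)
      have "inj_on m {0..1}"
      proof (rule inj_onI)
        fix s t :: real assume st: "s \<in> {0..1}" "t \<in> {0..1}" "m s = m t"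
        then have "h (g s) = h (g t)" using gm(1) by metis
        then have "g s = g t" using inj_onD[OF homeo_on_inj[OF h(2) IT]] st(1,2) p(1) by blast
        then show "s = t" using inj_onD[OF p(2) _ st(1,2)] by blast
      qed
      then have "strict_mono_on {0..1} m \<or> strict_antimono_on {0..1} m"
        using injective_eq_monotone_map[OF _ cm] by (simp add: is_interval_cc)
      moreover have "m 0 = 0" "m 1 = 1"
        using mk[of 0] mk[of 1] fixd e kg[of 0] kg[of 1] by auto
      then have "\<not> strict_antimono_on {0..1} m"
        using monotone_onD[of "{0..1}" "(<)" "(>)" m 0 1] by auto
      ultimately show "strict_mono_on {0..1} (inv_into {0..1} g \<circ> h \<circ> g)" unfolding m_def by blast
    qed
  qed
  obtain g0 where "arc_param X I g0" using I unfolding max_free_arcs_def free_arc_def by blast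
  then show ?thesis using main unfolding homeo_plus_def by auto
qed

end

section \<open>Split extensions and semidirect products\<close>

text \<open>A split extension of \<open>H\<close> by \<open>N\<close> is a semidirect product. Here \<open>E\<close> embeds \<open>N\<close> as the kernel of \<open>p\<close>, \<open>s\<close> is
  the section, and \<open>\<theta> a\<close> is conjugation by \<open>s a\<close>, transported to \<open>N\<close>. The relation between \<open>E\<close> and \<open>\<theta>\<close> is
  stated without inverses, which is the form in which it is evaluated pointwise later.\<close>

lemma split_extension_semidirect:
  assumes "group G" "group H" "group N"
    and E: "E \<in> hom N G" "inj_on E (carrier N)"
    and p: "p \<in> hom G H"
    and s: "s \<in> hom H G" "\<And>a. a \<in> carrier H \<Longrightarrow> p (s a) = a"
    and ker: "E ` carrier N = kernel G H p"
  obtains \<theta> where "\<theta> \<in> hom H (AutoGroup N)"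
    "\<And>a n. \<lbrakk>a \<in> carrier H; n \<in> carrier N\<rbrakk> \<Longrightarrow> E (\<theta> a n) \<otimes>\<^bsub>G\<^esub> s a = s a \<otimes>\<^bsub>G\<^esub> E n"
    "\<And>a n. \<lbrakk>a \<in> carrier H; n \<in> carrier N\<rbrakk> \<Longrightarrow> \<theta> a n \<in> carrier N"
    "G \<cong> semidirect_product N H \<theta>"
proof -
  interpret G: group G by fact
  interpret H: group H by fact
  interpret N: group N by fact
  interpret p: group_hom G H p by unfold_locales fact
  interpret E: group_hom N G E by unfold_locales fact
  interpret s: group_hom H G s by unfold_locales fact
  have pE: "p (E n) = \<one>\<^bsub>H\<^esub>" if "n \<in> carrier N" for n
    using ker that by (auto simp: kernel_def)
  define \<theta> where "\<theta> a = (\<lambda>n\<in>carrier N. inv_into (carrier N) E (s a \<otimes>\<^bsub>G\<^esub> E n \<otimes>\<^bsub>G\<^esub> inv\<^bsub>G\<^esub> s a))" for a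
  have "s a \<otimes>\<^bsub>G\<^esub> E n \<otimes>\<^bsub>G\<^esub> inv\<^bsub>G\<^esub> s a \<in> E ` carrier N" if "a \<in> carrier H" "n \<in> carrier N" for a n
    unfolding ker kernel_def using that pE s(2) by simp
  then have \<theta>N: "\<theta> a n \<in> carrier N" and E\<theta>: "E (\<theta> a n) = s a \<otimes>\<^bsub>G\<^esub> E n \<otimes>\<^bsub>G\<^esub> inv\<^bsub>G\<^esub> s a"
    if "a \<in> carrier H" "n \<in> carrier N" for a n
    using that unfolding \<theta>_def by (simp_all add: inv_into_into f_inv_into_f)
  have E\<theta>s: "E (\<theta> a n) \<otimes>\<^bsub>G\<^esub> s a = s a \<otimes>\<^bsub>G\<^esub> E n" if "a \<in> carrier H" "n \<in> carrier N" for a n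
    using that by (simp add: E\<theta> G.m_assoc)
  have eqI: "m = n" if "m \<in> carrier N" "n \<in> carrier N" "E m = E n" for m n
    using inj_onD[OF E(2)] that by blast
  have \<theta>_mult: "\<theta> a (m \<otimes>\<^bsub>N\<^esub> n) = \<theta> a m \<otimes>\<^bsub>N\<^esub> \<theta> a n"
    if a: "a \<in> carrier H" and mn: "m \<in> carrier N" "n \<in> carrier N" for a m n
  proof (rule eqI)
    have "inv\<^bsub>G\<^esub> s a \<otimes>\<^bsub>G\<^esub> (s a \<otimes>\<^bsub>G\<^esub> (E n \<otimes>\<^bsub>G\<^esub> inv\<^bsub>G\<^esub> s a)) = E n \<otimes>\<^bsub>G\<^esub> inv\<^bsub>G\<^esub> s a"
      using a mn by (simp flip: G.m_assoc)
    then show "E (\<theta> a (m \<otimes>\<^bsub>N\<^esub> n)) = E (\<theta> a m \<otimes>\<^bsub>N\<^esub> \<theta> a n)"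
      using a mn \<theta>N by (simp add: E\<theta> G.m_assoc)
  qed (use a mn \<theta>N in auto)
  have \<theta>_comp: "\<theta> (a \<otimes>\<^bsub>H\<^esub> b) n = \<theta> a (\<theta> b n)"
    if ab: "a \<in> carrier H" "b \<in> carrier H" and n: "n \<in> carrier N" for a b n
    by (rule eqI) (use ab n \<theta>N in \<open>simp_all add: E\<theta> G.m_assoc G.inv_mult_group\<close>)
  have \<theta>_one: "\<theta> \<one>\<^bsub>H\<^esub> n = n" if "n \<in> carrier N" for n
    by (rule eqI) (use that \<theta>N in \<open>simp_all add: E\<theta>\<close>)
  have \<theta>_auto: "\<theta> a \<in> auto N" if a: "a \<in> carrier H" for a
  proof -
    have "bij_betw (\<theta> a) (carrier N) (carrier N)"
    proof (rule bij_betw_byWitness[where f' = "\<theta> (inv\<^bsub>H\<^esub> a)"])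
      show "\<forall>n\<in>carrier N. \<theta> (inv\<^bsub>H\<^esub> a) (\<theta> a n) = n" "\<forall>n\<in>carrier N. \<theta> a (\<theta> (inv\<^bsub>H\<^esub> a) n) = n"
        using a by (auto simp: \<theta>_one simp flip: \<theta>_comp)
    qed (use \<theta>N a in auto)
    moreover have "\<theta> a \<in> extensional (carrier N)" by (simp add: \<theta>_def)
    ultimately show ?thesis using \<theta>N \<theta>_mult a by (auto simp: auto_def Bij_def hom_def)
  qed
  have \<theta>_hom: "\<theta> \<in> hom H (AutoGroup N)"
  proof (rule homI)
    show "\<theta> a \<in> carrier (AutoGroup N)" if "a \<in> carrier H" for a
      using \<theta>_auto[OF that] by (simp add: AutoGroup_def)
    fix a b assume ab: "a \<in> carrier H" "b \<in> carrier H"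
    have "\<theta> (a \<otimes>\<^bsub>H\<^esub> b) = compose (carrier N) (\<theta> a) (\<theta> b)"
    proof (rule extensionalityI[of _ "carrier N"])
      show "\<theta> (a \<otimes>\<^bsub>H\<^esub> b) \<in> extensional (carrier N)" by (simp add: \<theta>_def)
      show "compose (carrier N) (\<theta> a) (\<theta> b) \<in> extensional (carrier N)" by simp
      show "\<theta> (a \<otimes>\<^bsub>H\<^esub> b) n = compose (carrier N) (\<theta> a) (\<theta> b) n" if "n \<in> carrier N" for n
        using \<theta>_comp[OF ab that] that by (simp add: compose_eq)
    qed
    moreover have "\<theta> a \<in> Bij (carrier N)" "\<theta> b \<in> Bij (carrier N)"
      using \<theta>_auto ab by (auto simp: auto_def)
    ultimately show "\<theta> (a \<otimes>\<^bsub>H\<^esub> b) = \<theta> a \<otimes>\<^bsub>AutoGroup N\<^esub> \<theta> b"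
      by (simp add: AutoGroup_def BijGroup_def)
  qed
  \<comment> \<open>The coordinates of \<open>g\<close> in the factorisation \<open>g = E n \<otimes> s a\<close> with \<open>a = p g\<close>.\<close>
  define \<Phi> where "\<Phi> g = (inv_into (carrier N) E (g \<otimes>\<^bsub>G\<^esub> inv\<^bsub>G\<^esub> s (p g)), p g)" for g
  have \<Phi>: "\<Phi> g = (n, a)" if "n \<in> carrier N" "a \<in> carrier H" "g = E n \<otimes>\<^bsub>G\<^esub> s a" for g n a
  proof -
    have "p g = a" using that pE s(2) by simp
    moreover have "g \<otimes>\<^bsub>G\<^esub> inv\<^bsub>G\<^esub> s a = E n" using that by (simp add: G.m_assoc)
    ultimately show ?thesis using that E(2) by (simp add: \<Phi>_def)
  qed
  have decomp: "\<exists>n\<in>carrier N. \<exists>a\<in>carrier H. g = E n \<otimes>\<^bsub>G\<^esub> s a" if g: "g \<in> carrier G" for g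
  proof -
    have "g \<otimes>\<^bsub>G\<^esub> inv\<^bsub>G\<^esub> s (p g) \<in> kernel G H p" using g s(2) by (simp add: kernel_def)
    then obtain n where n: "n \<in> carrier N" "E n = g \<otimes>\<^bsub>G\<^esub> inv\<^bsub>G\<^esub> s (p g)" using ker by (metis imageE)
    then have "g = E n \<otimes>\<^bsub>G\<^esub> s (p g)" using g by (simp add: G.m_assoc)
    then show ?thesis using n(1) g p.hom_closed by blast
  qed
  have "\<Phi> \<in> iso G (semidirect_product N H \<theta>)"
  proof (rule isoI)
    show "\<Phi> \<in> hom G (semidirect_product N H \<theta>)"
    proof (rule homI)
      show "\<Phi> g \<in> carrier (semidirect_product N H \<theta>)" if "g \<in> carrier G" for g
        using decomp[OF that] \<Phi> by (force simp: semidirect_product_def)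
      fix g h assume "g \<in> carrier G" "h \<in> carrier G"
      then obtain m a n b where g: "m \<in> carrier N" "a \<in> carrier H" "g = E m \<otimes>\<^bsub>G\<^esub> s a"
        and h: "n \<in> carrier N" "b \<in> carrier H" "h = E n \<otimes>\<^bsub>G\<^esub> s b"
        using decomp by metis
      have "g \<otimes>\<^bsub>G\<^esub> h = E m \<otimes>\<^bsub>G\<^esub> (s a \<otimes>\<^bsub>G\<^esub> E n) \<otimes>\<^bsub>G\<^esub> s b"
        using g h by (simp add: G.m_assoc)
      also have "\<dots> = E m \<otimes>\<^bsub>G\<^esub> (E (\<theta> a n) \<otimes>\<^bsub>G\<^esub> s a) \<otimes>\<^bsub>G\<^esub> s b"
        using E\<theta>s g(2) h(1) by simp
      also have "\<dots> = E (m \<otimes>\<^bsub>N\<^esub> \<theta> a n) \<otimes>\<^bsub>G\<^esub> s (a \<otimes>\<^bsub>H\<^esub> b)"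
        using g h \<theta>N by (simp add: G.m_assoc)
      finally have "\<Phi> (g \<otimes>\<^bsub>G\<^esub> h) = (m \<otimes>\<^bsub>N\<^esub> \<theta> a n, a \<otimes>\<^bsub>H\<^esub> b)"
        using g h \<theta>N by (intro \<Phi>) auto
      then show "\<Phi> (g \<otimes>\<^bsub>G\<^esub> h) = \<Phi> g \<otimes>\<^bsub>semidirect_product N H \<theta>\<^esub> \<Phi> h"
        using \<Phi>[OF g] \<Phi>[OF h] by (simp add: semidirect_product_def)
    qed
    show "bij_betw \<Phi> (carrier G) (carrier (semidirect_product N H \<theta>))"
    proof (rule bij_betw_byWitness[where f' = "\<lambda>(n, a). E n \<otimes>\<^bsub>G\<^esub> s a"])
      show "\<forall>g\<in>carrier G. (case \<Phi> g of (n, a) \<Rightarrow> E n \<otimes>\<^bsub>G\<^esub> s a) = g"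
        using decomp \<Phi> by fastforce
      show "\<Phi> ` carrier G \<subseteq> carrier (semidirect_product N H \<theta>)"
        using decomp \<Phi> by (fastforce simp: semidirect_product_def)
    qed (auto simp: semidirect_product_def \<Phi>)
  qed
  then have "G \<cong> semidirect_product N H \<theta>" unfolding is_iso_def by blast
  then show ?thesis using that \<theta>_hom E\<theta>s \<theta>N by blast
qed

section \<open>The groups of homeomorphisms\<close>

lemma homeomorphic_imp_bij_betw: "homeomorphic_map X Y f \<Longrightarrow> bij_betw f (topspace X) (topspace Y)"
  by (simp add: bij_betw_def homeomorphic_imp_injective_map homeomorphic_imp_surjective_map)

text \<open>The fixed set \<open>F\<close> allows this to cover both \<open>homeo_group\<close>, for empty \<open>F\<close>, and \<open>homeo_plus\<close>, for the set
  of extremities.\<close>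

lemma subgroup_homeos_fixing:
  assumes "F \<subseteq> topspace Y"
  shows "subgroup {h \<in> Bij (topspace Y). homeomorphic_map Y Y h \<and> (\<forall>z\<in>F. h z = z)} (BijGroup (topspace Y))"
    (is "subgroup ?H ?G")
proof -
  let ?S = "topspace Y"
  interpret B: group ?G by (rule group_BijGroup)
  have mult: "g \<otimes>\<^bsub>?G\<^esub> h = compose ?S g h" if "g \<in> ?H" "h \<in> ?H" for g h
    using that by (simp add: BijGroup_def)
  show ?thesis
  proof (rule B.subgroupI)
    show "?H \<subseteq> carrier ?G" by (auto simp: BijGroup_def)
    have "homeomorphic_map Y Y (\<lambda>x\<in>?S. x)" by (rule homeomorphic_map_eq[OF homeomorphic_map_id[THEN iffD2]]) auto
    then have "(\<lambda>x\<in>?S. x) \<in> ?H" using assms id_Bij by auto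
    then show "?H \<noteq> {}" by blast
  next
    fix h assume h: "h \<in> ?H"
    have "homeomorphic_maps Y Y h (inv_into ?S h)"
    proof -
      obtain k where k: "homeomorphic_maps Y Y h k" using h homeomorphic_map_maps by blast
      have "inv_into ?S h y = k y" if "y \<in> ?S" for y
      proof -
        have "k y \<in> ?S" "h (k y) = y" using k that unfolding homeomorphic_maps_def continuous_map_def by auto
        moreover have "inj_on h ?S" using h by (auto simp: Bij_def bij_betw_def)
        ultimately show ?thesis by (metis inv_into_f_f)
      qed
      then show ?thesis using homeomorphic_maps_eq[OF k, of h "inv_into ?S h"] by simp
    qed
    then have "homeomorphic_map Y Y (inv_into ?S h)" by (simp add: homeomorphic_maps_map)
    then have "homeomorphic_map Y Y (\<lambda>x\<in>?S. inv_into ?S h x)" by (rule homeomorphic_map_eq) simp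
    moreover have "inv_into ?S h z = z" if "z \<in> F" for z
    proof -
      have "h z = z" "z \<in> ?S" "inj_on h ?S" using h that assms by (auto simp: Bij_def bij_betw_def)
      then show ?thesis by (metis inv_into_f_f)
    qed
    ultimately show "inv\<^bsub>?G\<^esub> h \<in> ?H"
      using h assms by (auto simp: inv_BijGroup restrict_inv_into_Bij)
  next
    fix g h assume gh: "g \<in> ?H" "h \<in> ?H"
    then have "homeomorphic_map Y Y (g \<circ> h)" by (intro homeomorphic_map_compose) auto
    then have "homeomorphic_map Y Y (compose ?S g h)" by (rule homeomorphic_map_eq) (simp add: compose_eq)
    then show "g \<otimes>\<^bsub>?G\<^esub> h \<in> ?H"
      using gh assms by (auto simp: mult compose_Bij compose_eq)
  qed
qed

lemma group_homeo_group: "group (homeo_group X)"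
  unfolding homeo_group_def
  using subgroup.subgroup_is_group[OF subgroup_homeos_fixing[of "{}" X] group_BijGroup] by simp

lemma homeo_groupD:
  assumes "h \<in> carrier (homeo_group X)"
  shows "h \<in> Bij (topspace X)" "homeomorphic_map X X h"
  using assms by (auto simp: homeo_group_def)

lemma homeo_group_mult:
  "\<lbrakk>g \<in> carrier (homeo_group X); h \<in> carrier (homeo_group X)\<rbrakk> \<Longrightarrow> g \<otimes>\<^bsub>homeo_group X\<^esub> h = compose (topspace X) g h"
  by (simp add: homeo_group_def BijGroup_def)

lemma restrict_homeo_in_carrier:
  assumes "homeomorphic_map X X h" shows "restrict h (topspace X) \<in> carrier (homeo_group X)"
proof -
  have "homeomorphic_map X X (restrict h (topspace X))" using assms by (rule homeomorphic_map_eq) simp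
  moreover have "bij_betw h (topspace X) (topspace X)"
    using homeomorphic_imp_bij_betw[OF assms] .
  ultimately show ?thesis by (simp add: homeo_group_def Bij_def)
qed

context dendrite_space
begin

lemma topspace_max_free_arc: "I \<in> Free \<Longrightarrow> topspace (subtopology X I) = I"
  using max_free_arc_subset by (simp add: inf_absorb2)

lemma group_homeo_plus:
  assumes "I \<in> Free" shows "group (homeo_plus X I)"
proof -
  have "subgroup (carrier (homeo_plus X I)) (BijGroup I)"
    unfolding homeo_plus_carrier[OF assms]
    using subgroup_homeos_fixing[of "extremities I" "subtopology X I"] topspace_max_free_arc[OF assms]
      max_free_arc_facts(4)[OF assms] max_free_arc_subset[OF assms] by auto
  then show ?thesis
    using subgroup.subgroup_is_group[OF _ group_BijGroup] by (simp add: homeo_plus_def)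
qed

lemma homeo_plusD:
  assumes "I \<in> Free" "f \<in> carrier (homeo_plus X I)"
  shows "f \<in> Bij I" "homeo_on I I f" "\<And>z. z \<in> extremities I \<Longrightarrow> f z = z" "\<And>x. x \<in> I \<Longrightarrow> f x \<in> I"
    "f \<in> extensional I"
proof -
  show B: "f \<in> Bij I" and "homeo_on I I f" and "\<And>z. z \<in> extremities I \<Longrightarrow> f z = z"
    using assms(2) unfolding homeo_plus_carrier[OF assms(1)] by auto
  show "\<And>x. x \<in> I \<Longrightarrow> f x \<in> I" "f \<in> extensional I"
    using B by (auto simp: Bij_def bij_betw_def)
qed

lemma homeo_plus_mult:
  assumes "I \<in> Free" "f \<in> carrier (homeo_plus X I)" "g \<in> carrier (homeo_plus X I)"
  shows "f \<otimes>\<^bsub>homeo_plus X I\<^esub> g = compose I f g"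
proof -
  have "f \<in> Bij I" "g \<in> Bij I" using homeo_plusD(1) assms by blast+
  then show ?thesis by (simp add: homeo_plus_def BijGroup_def)
qed

definition arc_action :: "('a \<Rightarrow> 'a) \<Rightarrow> 'a set \<Rightarrow> 'a set" where
  "arc_action h = (\<lambda>I\<in>Free. h ` I)"

lemma arc_action_in_Bij:
  assumes "homeomorphic_map X X h" shows "arc_action h \<in> Bij Free"
proof -
  obtain k where k: "homeomorphic_map X X k" "\<And>x. x \<in> T \<Longrightarrow> k (h x) = x" "\<And>x. x \<in> T \<Longrightarrow> h (k x) = x"
    using homeo_inverse[OF assms] by metis
  have "k ` h ` I = I" "h ` k ` I = I" if "I \<in> Free" for I
    using k(2,3) max_free_arc_subset[OF that] by (force simp: image_image)+
  then have "bij_betw (\<lambda>I. h ` I) Free Free"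
    using homeo_max_free_arc[OF assms] homeo_max_free_arc[OF k(1)]
    by (intro bij_betw_byWitness[where f' = "\<lambda>I. k ` I"]) auto
  then show ?thesis by (simp add: arc_action_def Bij_def)
qed

lemma arc_action_hom: "arc_action \<in> hom (homeo_group X) (BijGroup Free)"
proof (rule homI)
  show "arc_action h \<in> carrier (BijGroup Free)" if "h \<in> carrier (homeo_group X)" for h
    using arc_action_in_Bij homeo_groupD(2)[OF that] by (simp add: BijGroup_def)
  fix g h assume gh: "g \<in> carrier (homeo_group X)" "h \<in> carrier (homeo_group X)"
  have "compose T g h ` I = g ` h ` I" if "I \<in> Free" for I
    using max_free_arc_subset[OF that] by (force simp: compose_def image_image)
  then have "arc_action (compose T g h) = compose Free (arc_action g) (arc_action h)"
    using homeo_max_free_arc homeo_groupD(2)[OF gh(2)] by (auto simp: arc_action_def compose_def fun_eq_iff)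
  moreover have "arc_action g \<in> Bij Free" "arc_action h \<in> Bij Free"
    using arc_action_in_Bij[OF homeo_groupD(2)] gh by blast+
  ultimately show "arc_action (g \<otimes>\<^bsub>homeo_group X\<^esub> h) = arc_action g \<otimes>\<^bsub>BijGroup Free\<^esub> arc_action h"
    using gh by (simp add: homeo_group_mult BijGroup_def)
qed

lemma aut_free_eq: "aut_free X = BijGroup Free \<lparr>carrier := arc_action ` carrier (homeo_group X)\<rparr>"
  by (simp add: aut_free_def arc_action_def[abs_def])

lemma group_aut_free: "group (aut_free X)"
proof -
  interpret group_hom "homeo_group X" "BijGroup Free" arc_action
    by (intro group_hom.intro group_hom_axioms.intro group_homeo_group group_BijGroup arc_action_hom)
  show ?thesis unfolding aut_free_eq by (rule subgroup.subgroup_is_group[OF img_is_subgroup group_BijGroup])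
qed

lemma arc_action_hom_aut_free: "arc_action \<in> hom (homeo_group X) (aut_free X)"
  using arc_action_hom by (simp add: hom_def aut_free_eq)

lemma group_homeo_plus_product: "group (homeo_plus_product X)"
  using group_homeo_plus by (rule product_group)

definition glue_homeo :: "('a set \<Rightarrow> 'a \<Rightarrow> 'a) \<Rightarrow> 'a \<Rightarrow> 'a" where
  "glue_homeo f = restrict (glue f) T"

lemma homeo_plus_productD: "f \<in> carrier (homeo_plus_product X) \<Longrightarrow> I \<in> Free \<Longrightarrow> f I \<in> carrier (homeo_plus X I)"
  by auto

lemma glue_homeo_on:
  assumes "f \<in> carrier (homeo_plus_product X)" "I \<in> Free" "x \<in> I"
  shows "glue_homeo f x = f I x"
proof -
  have "glue f x = f I x"
    by (rule glue_eq) (use assms homeo_plus_productD homeo_plusD(3) in blast)+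
  then show ?thesis using assms max_free_arc_subset by (auto simp: glue_homeo_def)
qed

lemma glue_homeo_carrier:
  assumes "f \<in> carrier (homeo_plus_product X)" shows "glue_homeo f \<in> carrier (homeo_group X)"
  unfolding glue_homeo_def
  by (intro restrict_homeo_in_carrier homeomorphic_map_glue)
    (use assms homeo_plus_productD homeo_plusD in blast)+

lemma extensional_homeo_eqI:
  assumes "g \<in> carrier (homeo_group X)" "h \<in> carrier (homeo_group X)" "\<And>x. x \<in> T \<Longrightarrow> g x = h x"
  shows "g = h"
  using homeo_groupD(1)[OF assms(1)] homeo_groupD(1)[OF assms(2)] assms(3)
  by (auto simp: Bij_def intro: extensionalityI)

lemma glue_homeo_hom: "glue_homeo \<in> hom (homeo_plus_product X) (homeo_group X)"
proof (rule homI)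
  fix f g assume fg: "f \<in> carrier (homeo_plus_product X)" "g \<in> carrier (homeo_plus_product X)"
  interpret P: group "homeo_plus_product X" by (rule group_homeo_plus_product)
  have fgc: "f \<otimes>\<^bsub>homeo_plus_product X\<^esub> g \<in> carrier (homeo_plus_product X)" using fg by (rule P.m_closed)
  interpret G: group "homeo_group X" by (rule group_homeo_group)
  show "glue_homeo (f \<otimes>\<^bsub>homeo_plus_product X\<^esub> g) = glue_homeo f \<otimes>\<^bsub>homeo_group X\<^esub> glue_homeo g"
  proof (rule extensional_homeo_eqI)
    fix x assume x: "x \<in> T"
    show "glue_homeo (f \<otimes>\<^bsub>homeo_plus_product X\<^esub> g) x = (glue_homeo f \<otimes>\<^bsub>homeo_group X\<^esub> glue_homeo g) x"
    proof (cases "\<exists>I\<in>Free. x \<in> I")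
      case True
      then obtain I where I: "I \<in> Free" "x \<in> I" by blast
      have "glue_homeo (f \<otimes>\<^bsub>homeo_plus_product X\<^esub> g) x = (f \<otimes>\<^bsub>homeo_plus_product X\<^esub> g) I x"
        using glue_homeo_on[OF fgc I] .
      also have "\<dots> = f I (g I x)"
        using I homeo_plus_mult[OF I(1) homeo_plus_productD[OF fg(1) I(1)] homeo_plus_productD[OF fg(2) I(1)]] by (simp add: compose_eq)
      also have "\<dots> = glue_homeo f (glue_homeo g x)"
        using glue_homeo_on[OF fg(2) I] glue_homeo_on[OF fg(1) I(1)] homeo_plusD(4)[OF I(1) homeo_plus_productD[OF fg(2) I(1)] I(2)]
        by simp
      finally show ?thesis
        using x by (simp add: homeo_group_mult[OF glue_homeo_carrier[OF fg(1)] glue_homeo_carrier[OF fg(2)]] compose_eq)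
    next
      case False
      then have "glue_homeo h x = x" for h using x glue_outside[of x h] by (simp add: glue_homeo_def)
      then show ?thesis
        using x by (simp add: homeo_group_mult[OF glue_homeo_carrier[OF fg(1)] glue_homeo_carrier[OF fg(2)]] compose_eq)
    qed
  qed (use fg fgc glue_homeo_carrier in auto)
qed (rule glue_homeo_carrier)

lemma glue_homeo_inj: "inj_on glue_homeo (carrier (homeo_plus_product X))"
proof (rule inj_onI)
  fix f g assume f: "f \<in> carrier (homeo_plus_product X)" and g: "g \<in> carrier (homeo_plus_product X)"
    and eq: "glue_homeo f = glue_homeo g"
  have "f I = g I" if I: "I \<in> Free" for I
  proof (rule extensionalityI)
    show "f I \<in> extensional I" "g I \<in> extensional I"
      using homeo_plusD(5)[OF I] homeo_plus_productD f g I by blast+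
    show "f I x = g I x" if "x \<in> I" for x
      using glue_homeo_on[OF f I that] glue_homeo_on[OF g I that] eq by simp
  qed
  then show "f = g" using f g by (auto intro: PiE_ext)
qed

definition param :: "'a set \<Rightarrow> real \<Rightarrow> 'a" where
  "param I = (SOME g. arc_param X I g)"

lemma param: "I \<in> Free \<Longrightarrow> arc_param X I (param I)"
  unfolding param_def by (rule someI_ex[where P = "arc_param X I"]) (auto simp: max_free_arcs_def free_arc_def)

lemma extremities_param: "I \<in> Free \<Longrightarrow> extremities I = {param I 0, param I 1}"
  using arc_param_props[OF param, of I] arc_eq_seg[OF param, of I] extremities_seg[of "param I 0" "param I 1"]
  by auto

text \<open>The homeomorphisms that are affine in the chosen parametrisations, on each arc separately preserving or
  reversing the direction. They form a complement of the kernel of the action on arcs.\<close>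

definition affine_homeo :: "('a \<Rightarrow> 'a) \<Rightarrow> bool" where
  "affine_homeo t \<longleftrightarrow> t \<in> carrier (homeo_group X) \<and>
     (\<forall>I\<in>Free. (\<forall>s\<in>{0..1}. t (param I s) = param (t ` I) s) \<or> (\<forall>s\<in>{0..1}. t (param I s) = param (t ` I) (1 - s)))"

lemma affine_homeo_mult:
  assumes t: "affine_homeo t" and u: "affine_homeo u" shows "affine_homeo (t \<otimes>\<^bsub>homeo_group X\<^esub> u)"
  unfolding affine_homeo_def
proof (intro conjI ballI)
  interpret G: group "homeo_group X" by (rule group_homeo_group)
  have tc: "t \<in> carrier (homeo_group X)" and uc: "u \<in> carrier (homeo_group X)"
    using t u by (auto simp: affine_homeo_def)
  then show "t \<otimes>\<^bsub>homeo_group X\<^esub> u \<in> carrier (homeo_group X)" by simp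
  fix I assume I: "I \<in> Free"
  let ?J = "u ` I"
  have J: "?J \<in> Free" using homeo_max_free_arc[OF homeo_groupD(2)[OF uc] I] .
  have im: "(t \<otimes>\<^bsub>homeo_group X\<^esub> u) ` I = t ` ?J"
    using max_free_arc_subset[OF I] by (force simp: homeo_group_mult[OF tc uc] compose_def image_image)
  have pI: "param I s \<in> T" if "s \<in> {0..1}" for s
    using arc_param_props(1)[OF param[OF I]] max_free_arc_subset[OF I] that by blast
  have val: "(t \<otimes>\<^bsub>homeo_group X\<^esub> u) (param I s) = t (u (param I s))" if "s \<in> {0..1}" for s
    using pI[OF that] by (simp add: homeo_group_mult[OF tc uc] compose_eq)
  have flip: "1 - s \<in> {0..1}" if "s \<in> {0..1}" for s :: real using that by auto
  have "(\<forall>s\<in>{0..1}. u (param I s) = param ?J s) \<or> (\<forall>s\<in>{0..1}. u (param I s) = param ?J (1 - s))"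
    using u I unfolding affine_homeo_def by blast
  moreover have "(\<forall>s\<in>{0..1}. t (param ?J s) = param (t ` ?J) s) \<or> (\<forall>s\<in>{0..1}. t (param ?J s) = param (t ` ?J) (1 - s))"
    using t J unfolding affine_homeo_def by blast
  ultimately show "(\<forall>s\<in>{0..1}. (t \<otimes>\<^bsub>homeo_group X\<^esub> u) (param I s) = param ((t \<otimes>\<^bsub>homeo_group X\<^esub> u) ` I) s) \<or>
      (\<forall>s\<in>{0..1}. (t \<otimes>\<^bsub>homeo_group X\<^esub> u) (param I s) = param ((t \<otimes>\<^bsub>homeo_group X\<^esub> u) ` I) (1 - s))"
    unfolding im using val flip by (elim disjE) simp_all
qed

text \<open>On each arc \<open>I\<close> let \<open>\<sigma> I\<close> be the affine map onto \<open>h ` I\<close> with the same orientation as \<open>h\<close>. Then \<open>\<sigma> I\<close>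
  followed by the inverse of \<open>h\<close> fixes the extremities of \<open>I\<close>, so these maps can be glued, and
  composing the glued map with \<open>h\<close> gives the required homeomorphism.\<close>

lemma affine_homeo_exists:
  assumes h: "h \<in> carrier (homeo_group X)"
  obtains t where "affine_homeo t" "arc_action t = arc_action h"
proof -
  note hh = homeo_groupD(2)[OF h]
  obtain k where k: "homeomorphic_map X X k" "\<And>x. x \<in> T \<Longrightarrow> k (h x) = x" "\<And>x. x \<in> T \<Longrightarrow> h (k x) = x"
    using homeo_inverse[OF hh] by metis
  define \<rho> where "\<rho> b s = (if b then 1 - s else s)" for b and s :: real
  have \<rho>: "homeomorphic_map (top_of_set {0..1}) (top_of_set {0..1}) (\<rho> b)" for b
  proof -
    have "homeomorphic_maps (top_of_set {0..1}) (top_of_set {0..1}) (\<rho> b) (\<rho> b)"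
      unfolding homeomorphic_maps_def \<rho>_def by (auto intro!: continuous_intros)
    then show ?thesis using homeomorphic_map_maps by blast
  qed
  have "\<forall>I\<in>Free. \<exists>d. homeomorphic_maps (top_of_set {0..1}) (subtopology X I) (param I) d"
    using param homeomorphic_map_maps unfolding arc_param_def by blast
  then obtain d where d: "\<And>I. I \<in> Free \<Longrightarrow> homeomorphic_maps (top_of_set {0..1}) (subtopology X I) (param I) (d I)"
    by metis
  have dp: "d I (param I s) = s" if "I \<in> Free" "s \<in> {0..1}" for I s
    using d[OF that(1)] that(2) by (simp add: homeomorphic_maps_def)
  \<comment> \<open>Whether \<open>h\<close> reverses the chosen parametrisations on \<open>I\<close>.\<close>
  define b where "b I \<longleftrightarrow> h (param I 0) \<noteq> param (h ` I) 0" for I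
  define \<sigma> where "\<sigma> I = param (h ` I) \<circ> (\<rho> (b I) \<circ> d I)" for I
  have hFree: "h ` I \<in> Free" if "I \<in> Free" for I using homeo_max_free_arc[OF hh that] .
  have \<sigma>: "homeo_on I (h ` I) (\<sigma> I)" if "I \<in> Free" for I
    unfolding \<sigma>_def
  proof (intro homeomorphic_map_compose)
    show "homeomorphic_map (subtopology X I) (top_of_set {0..1}) (d I)"
      using d[OF that] by (simp add: homeomorphic_maps_map)
    show "homeomorphic_map (top_of_set {0..1}) (subtopology X (h ` I)) (param (h ` I))"
      using param[OF hFree[OF that]] by (simp add: arc_param_def)
  qed (rule \<rho>)
  have \<sigma>_param: "\<sigma> I (param I s) = param (h ` I) (\<rho> (b I) s)" if "I \<in> Free" "s \<in> {0..1}" for I s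
    using dp[OF that] by (simp add: \<sigma>_def)
  have kh: "k ` h ` I = I" if "I \<in> Free" for I
    using k(2) max_free_arc_subset[OF that] by (force simp: image_image)
  define f where "f I = k \<circ> \<sigma> I" for I
  have f: "homeo_on I I (f I)" if "I \<in> Free" for I
    unfolding f_def
    using homeomorphic_map_compose[OF \<sigma>[OF that] homeo_on_restrict[OF k(1) max_free_arc_subset[OF hFree[OF that]]]] kh[OF that]
    by simp
  have \<sigma>_ends: "\<sigma> I z = h z" if I: "I \<in> Free" and z: "z \<in> extremities I" for I z
  proof -
    have "h ` extremities I = extremities (h ` I)"
      by (rule extremities_homeo_on[OF homeo_on_restrict[OF hh]]) (use max_free_arc_subset I hFree in blast)+
    then have "{h (param I 0), h (param I 1)} = {param (h ` I) 0, param (h ` I) 1}"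
      using extremities_param I hFree by simp
    then have "\<sigma> I (param I 0) = h (param I 0) \<and> \<sigma> I (param I 1) = h (param I 1)"
      using \<sigma>_param[OF I, of 0] \<sigma>_param[OF I, of 1] by (auto simp: \<rho>_def b_def doubleton_eq_iff)
    then show ?thesis using z extremities_param[OF I] by auto
  qed
  have f_ends: "f I z = z" if "I \<in> Free" "z \<in> extremities I" for I z
  proof -
    have "z \<in> T" using that max_free_arc_facts(4) max_free_arc_subset by blast
    then show ?thesis using \<sigma>_ends[OF that] k(2) by (simp add: f_def)
  qed
  have gl: "homeomorphic_map X X (glue f)" by (rule homeomorphic_map_glue) (fact f, fact f_ends)
  define t where "t = restrict (h \<circ> glue f) T"
  have tc: "t \<in> carrier (homeo_group X)"
    unfolding t_def by (intro restrict_homeo_in_carrier homeomorphic_map_compose[OF gl hh])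
  have t\<sigma>: "t x = \<sigma> I x" if I: "I \<in> Free" "x \<in> I" for I x
  proof -
    have "x \<in> T" using max_free_arc_subset I by blast
    moreover have "glue f x = f I x" by (rule glue_eq) (use f_ends I in auto)
    moreover have "\<sigma> I x \<in> T"
      using homeo_on_image[OF \<sigma>[OF I(1)]] max_free_arc_subset I hFree by blast
    ultimately show ?thesis using k(3) by (simp add: t_def f_def)
  qed
  have tI: "t ` I = h ` I" if I: "I \<in> Free" for I
    using homeo_on_image[OF \<sigma>[OF I]] max_free_arc_subset I hFree t\<sigma>[OF I] by (metis image_cong)
  have "affine_homeo t"
    unfolding affine_homeo_def
  proof (intro conjI ballI tc)
    fix I assume I: "I \<in> Free"
    have "t (param I s) = param (t ` I) (\<rho> (b I) s)" if "s \<in> {0..1}" for s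
    proof -
      have "param I s \<in> I" using arc_param_props(1)[OF param[OF I]] that by blast
      then show ?thesis using t\<sigma>[OF I] \<sigma>_param[OF I that] tI[OF I] by simp
    qed
    then show "(\<forall>s\<in>{0..1}. t (param I s) = param (t ` I) s) \<or> (\<forall>s\<in>{0..1}. t (param I s) = param (t ` I) (1 - s))"
      by (cases "b I") (simp_all add: \<rho>_def)
  qed
  moreover have "arc_action t = arc_action h" unfolding arc_action_def using tI by (intro restrict_ext) simp
  ultimately show ?thesis by (rule that)
qed

lemma conj_iso_homeo_plus:
  assumes I: "I \<in> Free" and J: "J \<in> Free" and u: "homeo_on I J u"
  shows "(\<lambda>k. \<lambda>y\<in>J. u (k (inv_into I u y))) \<in> iso (homeo_plus X I) (homeo_plus X J)"
proof -
  have main: "(\<lambda>y\<in>J. u (k (v y))) \<in> carrier (homeo_plus X J)"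
    if IJ: "I \<in> Free" "J \<in> Free" and u: "homeo_on I J u" and v: "homeo_on J I v" "\<And>x. x \<in> I \<Longrightarrow> v (u x) = x" "\<And>y. y \<in> J \<Longrightarrow> u (v y) = y"
      and k: "k \<in> carrier (homeo_plus X I)" for I J u v k
  proof -
    have "homeo_on J J (u \<circ> (k \<circ> v))"
      using u v(1) homeo_plusD(2)[OF IJ(1) k] by (intro homeomorphic_map_compose)
    then have h: "homeo_on J J (\<lambda>y\<in>J. u (k (v y)))"
      by (rule homeomorphic_map_eq) (use topspace_max_free_arc[OF IJ(2)] in simp)
    then have "bij_betw (\<lambda>y\<in>J. u (k (v y))) J J"
      using homeomorphic_imp_bij_betw[OF h] topspace_max_free_arc[OF IJ(2)] by simp
    moreover have "u (k (v z)) = z" if z: "z \<in> extremities J" for z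
    proof -
      have "v z \<in> extremities I" using extremities_homeo_on[OF v(1)] IJ max_free_arc_subset z by blast
      then show ?thesis using homeo_plusD(3)[OF IJ(1) k] v(3) z max_free_arc_facts(4)[OF IJ(2)] by auto
    qed
    ultimately show ?thesis
      using h max_free_arc_facts(4)[OF IJ(2)] unfolding homeo_plus_carrier[OF IJ(2)] by (auto simp: Bij_def)
  qed
  define v where "v = inv_into I u"
  note IT = max_free_arc_subset[OF I] and JT = max_free_arc_subset[OF J]
  have uJ: "u ` I = J" and inj: "inj_on u I" using homeo_on_image[OF u IT JT] homeo_on_inj[OF u IT] .
  have vu: "v (u x) = x" if "x \<in> I" for x using that inj by (simp add: v_def)
  have uv: "u (v y) = y" if "y \<in> J" for y using that uJ by (auto simp: v_def f_inv_into_f)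
  have vI: "v y \<in> I" if "y \<in> J" for y using that uJ by (auto simp: v_def inv_into_into)
  have v: "homeo_on J I v"
  proof -
    obtain w where w: "homeo_on J I w" "\<And>x. x \<in> I \<Longrightarrow> w (u x) = x" "\<And>x. x \<in> J \<Longrightarrow> u (w x) = x"
      using homeo_on_inverse[OF u IT JT] by metis
    show ?thesis
      by (rule homeomorphic_map_eq[OF w(1)]) (use topspace_max_free_arc[OF J] w(2) uv vI in metis)
  qed
  define C where "C k = (\<lambda>y\<in>J. u (k (v y)))" for k
  define D where "D k = (\<lambda>x\<in>I. v (k (u x)))" for k
  have C: "C k \<in> carrier (homeo_plus X J)" if "k \<in> carrier (homeo_plus X I)" for k
    unfolding C_def using main[OF I J u v vu uv that] .
  have D: "D k \<in> carrier (homeo_plus X I)" if "k \<in> carrier (homeo_plus X J)" for k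
    unfolding D_def using main[OF J I v u uv vu that] .
  have uI: "u x \<in> J" if "x \<in> I" for x using that uJ by blast
  have "C \<in> iso (homeo_plus X I) (homeo_plus X J)"
  proof (rule isoI)
    show "C \<in> hom (homeo_plus X I) (homeo_plus X J)"
    proof (rule homI)
      fix k l assume k: "k \<in> carrier (homeo_plus X I)" and l: "l \<in> carrier (homeo_plus X I)"
      have "C (compose I k l) y = compose J (C k) (C l) y" for y
        using vI homeo_plusD(4)[OF I l] uI vu by (auto simp: C_def compose_def)
      then show "C (k \<otimes>\<^bsub>homeo_plus X I\<^esub> l) = C k \<otimes>\<^bsub>homeo_plus X J\<^esub> C l"
        using homeo_plus_mult[OF I k l] homeo_plus_mult[OF J C[OF k] C[OF l]] by auto
    qed (rule C)
    have DC: "D (C k) = k" if "k \<in> carrier (homeo_plus X I)" for k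
    proof (rule extensionalityI[of _ I])
      show "D (C k) x = k x" if x: "x \<in> I" for x
        using x uI vu homeo_plusD(4)[OF I \<open>k \<in> _\<close> x] by (simp add: D_def C_def)
    qed (use homeo_plusD(5)[OF I that] in \<open>simp_all add: D_def\<close>)
    have CD: "C (D k) = k" if "k \<in> carrier (homeo_plus X J)" for k
    proof (rule extensionalityI[of _ J])
      show "C (D k) x = k x" if x: "x \<in> J" for x
        using x vI uv homeo_plusD(4)[OF J \<open>k \<in> _\<close> x] by (simp add: D_def C_def)
    qed (use homeo_plusD(5)[OF J that] in \<open>simp_all add: C_def\<close>)
    show "bij_betw C (carrier (homeo_plus X I)) (carrier (homeo_plus X J))"
      by (rule bij_betw_byWitness[where f' = D]) (use C D DC CD in auto)
  qed
  then show ?thesis by (simp add: C_def[abs_def] v_def)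
qed

section \<open>The decomposition\<close>

context
  assumes dense: "X closure_of (\<Union>Free) = T"
    and not_arc: "\<not> X homeomorphic_space top_of_set {0..1::real}"
begin

lemma kernel_arc_action:
  "kernel (homeo_group X) (aut_free X) arc_action = {h \<in> carrier (homeo_group X). \<forall>I\<in>Free. h ` I = I}"
proof -
  have "arc_action h = \<one>\<^bsub>aut_free X\<^esub> \<longleftrightarrow> (\<forall>I\<in>Free. h ` I = I)" for h
    by (auto simp: arc_action_def aut_free_eq BijGroup_def fun_eq_iff restrict_def)
  then show ?thesis by (auto simp: kernel_def)
qed

text \<open>The kernel of the action on arcs is \<open>\<Prod> Homeo\<^sub>+(I)\<close>: its elements preserve the orientation of each
  arc by \<open>kernel_fixes_extremities\<close>, and by density they are glued from their restrictions.\<close>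

lemma glue_homeo_image: "glue_homeo ` carrier (homeo_plus_product X) = kernel (homeo_group X) (aut_free X) arc_action"
proof
  show "glue_homeo ` carrier (homeo_plus_product X) \<subseteq> kernel (homeo_group X) (aut_free X) arc_action"
  proof
    fix h assume "h \<in> glue_homeo ` carrier (homeo_plus_product X)"
    then obtain f where f: "f \<in> carrier (homeo_plus_product X)" "h = glue_homeo f" by blast
    have "h ` I = I" if I: "I \<in> Free" for I
    proof -
      have "h ` I = f I ` I" unfolding f(2) using glue_homeo_on[OF f(1) I] by (rule image_cong[OF refl])
      then show ?thesis using homeo_plusD(1)[OF I homeo_plus_productD[OF f(1) I]] by (simp add: Bij_def bij_betw_def)
    qed
    then show "h \<in> kernel (homeo_group X) (aut_free X) arc_action"
      unfolding kernel_arc_action using glue_homeo_carrier f by blast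
  qed
  show "kernel (homeo_group X) (aut_free X) arc_action \<subseteq> glue_homeo ` carrier (homeo_plus_product X)"
  proof
    fix h assume "h \<in> kernel (homeo_group X) (aut_free X) arc_action"
    then have h: "h \<in> carrier (homeo_group X)" "\<And>I. I \<in> Free \<Longrightarrow> h ` I = I" unfolding kernel_arc_action by auto
    note hh = homeo_groupD(2)[OF h(1)]
    define f where "f = (\<lambda>I\<in>Free. restrict h I)"
    have "restrict h I \<in> carrier (homeo_plus X I)" if I: "I \<in> Free" for I
    proof -
      have ho: "homeo_on I I h" using homeo_on_restrict[OF hh max_free_arc_subset[OF I]] h(2)[OF I] by simp
      then have "homeo_on I I (restrict h I)" by (rule homeomorphic_map_eq) simp
      moreover have "bij_betw h I I" using homeomorphic_imp_bij_betw[OF ho] topspace_max_free_arc[OF I] by simp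
      moreover have "h z = z" if "z \<in> extremities I" for z
        using kernel_fixes_extremities[OF dense not_arc hh h(2) I that] .
      ultimately show ?thesis using max_free_arc_facts(4)[OF I] by (auto simp: homeo_plus_carrier[OF I] Bij_def)
    qed
    then have f: "f \<in> carrier (homeo_plus_product X)" by (simp add: f_def)
    have "glue_homeo f = h"
    proof (rule extensional_homeo_eqI[OF glue_homeo_carrier[OF f] h(1)])
      show "glue_homeo f x = h x" if "x \<in> T" for x
      proof (rule homeo_eq_if_eq_on_free_arcs[OF dense homeo_groupD(2)[OF glue_homeo_carrier[OF f]] hh _ that])
        show "glue_homeo f x = h x" if "I \<in> Free" "x \<in> I" for I x
          using glue_homeo_on[OF f that] that by (simp add: f_def)
      qed
    qed
    then show "h \<in> glue_homeo ` carrier (homeo_plus_product X)" using f by blast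
  qed
qed

text \<open>The two homeomorphisms differ by an element of the kernel, which fixes all extremities. Hence they have
  the same orientation on every arc, and as affine maps they coincide there.\<close>

lemma affine_homeo_unique:
  assumes t: "affine_homeo t" and u: "affine_homeo u" and eq: "arc_action t = arc_action u"
  shows "t = u"
proof -
  have tc: "t \<in> carrier (homeo_group X)" and uc: "u \<in> carrier (homeo_group X)"
    using t u by (auto simp: affine_homeo_def)
  note th = homeo_groupD(2)[OF tc] and uh = homeo_groupD(2)[OF uc]
  have im: "t ` I = u ` I" if "I \<in> Free" for I using fun_cong[OF eq, of I] that by (simp add: arc_action_def)
  obtain k where k: "homeomorphic_map X X k" "\<And>x. x \<in> T \<Longrightarrow> k (u x) = x" "\<And>x. x \<in> T \<Longrightarrow> u (k x) = x"
    using homeo_inverse[OF uh] by metis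
  have ends: "t z = u z" if I: "I \<in> Free" and z: "z \<in> extremities I" for I z
  proof -
    have "homeomorphic_map X X (k \<circ> t)" using th k(1) by (rule homeomorphic_map_compose)
    moreover have "(k \<circ> t) ` J = J" if "J \<in> Free" for J
    proof -
      have "(k \<circ> t) ` J = k ` u ` J" using im[OF that] by (metis image_comp)
      then show ?thesis using k(2) max_free_arc_subset[OF that] by (force simp: image_image)
    qed
    ultimately have "(k \<circ> t) z = z" using kernel_fixes_extremities[OF dense not_arc] I z by metis
    moreover have "t z \<in> T" using homeo_in_T[OF th] max_free_arc_facts(4)[OF I] max_free_arc_subset[OF I] z by blast
    ultimately show ?thesis using k(3) by (metis comp_apply)
  qed
  have "t x = u x" if I: "I \<in> Free" and x: "x \<in> I" for I x
  proof -
    obtain s where s: "s \<in> {0..1}" "x = param I s" using x arc_param_props(1)[OF param[OF I]] by blast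
    let ?J = "u ` I"
    have J: "?J \<in> Free" using homeo_max_free_arc[OF uh I] .
    have ne: "param ?J 0 \<noteq> param ?J 1" using arc_param_props(4)[OF param[OF J]] .
    have e: "t (param I 0) = u (param I 0)" using ends[OF I] extremities_param[OF I] by simp
    have "(\<forall>s\<in>{0..1}. t (param I s) = param ?J s) \<or> (\<forall>s\<in>{0..1}. t (param I s) = param ?J (1 - s))"
      using t I unfolding affine_homeo_def im[OF I, symmetric] by blast
    moreover have "(\<forall>s\<in>{0..1}. u (param I s) = param ?J s) \<or> (\<forall>s\<in>{0..1}. u (param I s) = param ?J (1 - s))"
      using u I unfolding affine_homeo_def by blast
    ultimately show ?thesis using s e ne by (elim disjE) force+
  qed
  then show ?thesis
    using homeo_eq_if_eq_on_free_arcs[OF dense th uh] extensional_homeo_eqI[OF tc uc] by blast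
qed

definition affine_section :: "('a set \<Rightarrow> 'a set) \<Rightarrow> 'a \<Rightarrow> 'a" where
  "affine_section a = (THE t. affine_homeo t \<and> arc_action t = a)"

lemma affine_section:
  assumes "a \<in> carrier (aut_free X)" shows "affine_homeo (affine_section a)" "arc_action (affine_section a) = a"
proof -
  obtain h where h: "h \<in> carrier (homeo_group X)" "a = arc_action h" using assms by (auto simp: aut_free_eq)
  obtain t where "affine_homeo t" "arc_action t = a" using affine_homeo_exists[OF h(1)] h(2) by metis
  then have "\<exists>!t. affine_homeo t \<and> arc_action t = a" using affine_homeo_unique by blast
  from theI'[OF this] show "affine_homeo (affine_section a)" "arc_action (affine_section a) = a"
    unfolding affine_section_def by simp_all
qed

lemma affine_section_hom: "affine_section \<in> hom (aut_free X) (homeo_group X)"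
proof (rule homI)
  show c: "affine_section a \<in> carrier (homeo_group X)" if "a \<in> carrier (aut_free X)" for a
    using affine_section(1)[OF that] by (simp add: affine_homeo_def)
  fix a b assume a: "a \<in> carrier (aut_free X)" and b: "b \<in> carrier (aut_free X)"
  interpret H: group "aut_free X" by (rule group_aut_free)
  have "arc_action (affine_section a \<otimes>\<^bsub>homeo_group X\<^esub> affine_section b) = a \<otimes>\<^bsub>aut_free X\<^esub> b"
    using hom_mult[OF arc_action_hom_aut_free c[OF a] c[OF b]] affine_section(2) a b by simp
  then show "affine_section (a \<otimes>\<^bsub>aut_free X\<^esub> b) = affine_section a \<otimes>\<^bsub>homeo_group X\<^esub> affine_section b"
    using affine_section[OF H.m_closed[OF a b]] affine_homeo_mult[OF affine_section(1)[OF a] affine_section(1)[OF b]]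
    by (intro affine_homeo_unique) auto
qed

theorem wreath_decomposition:
  "\<exists>\<theta>. factor_permuting_action X \<theta> \<and>
     homeo_group X \<cong> semidirect_product (homeo_plus_product X) (aut_free X) \<theta>"
proof -
  obtain \<theta> where \<theta>: "\<theta> \<in> hom (aut_free X) (AutoGroup (homeo_plus_product X))"
    and conj: "\<And>a f. \<lbrakk>a \<in> carrier (aut_free X); f \<in> carrier (homeo_plus_product X)\<rbrakk> \<Longrightarrow>
       glue_homeo (\<theta> a f) \<otimes>\<^bsub>homeo_group X\<^esub> affine_section a = affine_section a \<otimes>\<^bsub>homeo_group X\<^esub> glue_homeo f"
    and \<theta>N: "\<And>a f. \<lbrakk>a \<in> carrier (aut_free X); f \<in> carrier (homeo_plus_product X)\<rbrakk> \<Longrightarrow>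
       \<theta> a f \<in> carrier (homeo_plus_product X)"
    and iso: "homeo_group X \<cong> semidirect_product (homeo_plus_product X) (aut_free X) \<theta>"
    using split_extension_semidirect[OF group_homeo_group group_aut_free group_homeo_plus_product
      glue_homeo_hom glue_homeo_inj arc_action_hom_aut_free affine_section_hom affine_section(2) glue_homeo_image] by blast
  have "\<exists>\<phi> \<in> iso (homeo_plus X I) (homeo_plus X (a I)).
          \<forall>f \<in> carrier (homeo_plus_product X). \<theta> a f (a I) = \<phi> (f I)"
    if a: "a \<in> carrier (aut_free X)" and I: "I \<in> Free" for a I
  proof -
    define u where "u = affine_section a"
    have uc: "u \<in> carrier (homeo_group X)" using affine_section(1)[OF a] by (simp add: u_def affine_homeo_def)
    note uh = homeo_groupD(2)[OF uc]
    have aI: "a I = u ` I" using fun_cong[OF affine_section(2)[OF a], of I] I by (simp add: arc_action_def u_def)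
    have J: "u ` I \<in> Free" using homeo_max_free_arc[OF uh I] .
    have u: "homeo_on I (u ` I) u" using homeo_on_restrict[OF uh max_free_arc_subset[OF I]] .
    define \<phi> where "\<phi> k = (\<lambda>y\<in>u ` I. u (k (inv_into I u y)))" for k
    have "\<phi> \<in> iso (homeo_plus X I) (homeo_plus X (a I))"
      unfolding aI \<phi>_def using conj_iso_homeo_plus[OF I J u] .
    moreover have "\<theta> a f (a I) = \<phi> (f I)" if f: "f \<in> carrier (homeo_plus_product X)" for f
      unfolding aI
    proof (rule extensionalityI)
      show "\<theta> a f (u ` I) \<in> extensional (u ` I)"
        using homeo_plusD(5)[OF J homeo_plus_productD[OF \<theta>N[OF a f] J]] .
      show "\<phi> (f I) \<in> extensional (u ` I)" by (simp add: \<phi>_def)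
      fix y assume y: "y \<in> u ` I"
      then obtain x where x: "x \<in> I" "y = u x" by blast
      have xT: "x \<in> T" using x max_free_arc_subset[OF I] by blast
      have inv: "inv_into I u y = x" using x homeo_on_inj[OF u max_free_arc_subset[OF I]] by simp
      have "\<theta> a f (u ` I) y = glue_homeo (\<theta> a f) (u x)"
        using glue_homeo_on[OF \<theta>N[OF a f] J y] x by simp
      also have "\<dots> = (glue_homeo (\<theta> a f) \<otimes>\<^bsub>homeo_group X\<^esub> u) x"
        using homeo_group_mult[OF glue_homeo_carrier[OF \<theta>N[OF a f]] uc] xT by (simp add: compose_eq)
      also have "\<dots> = (u \<otimes>\<^bsub>homeo_group X\<^esub> glue_homeo f) x" using conj[OF a f] by (simp add: u_def)
      also have "\<dots> = u (f I x)"
        using homeo_group_mult[OF uc glue_homeo_carrier[OF f]] xT glue_homeo_on[OF f I x(1)] by (simp add: compose_eq)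
      finally show "\<theta> a f (u ` I) y = \<phi> (f I) y" using y inv by (simp add: \<phi>_def)
    qed
    ultimately show ?thesis by blast
  qed
  then have "factor_permuting_action X \<theta>" unfolding factor_permuting_action_def using \<theta> by blast
  with iso show ?thesis by blast
qed

end
end

theorem proposition1p2:
  fixes X :: "'a topology"
  assumes "dendrite X"
    and "dendro_minimal X"
    and "\<exists>I. free_arc X I"
    and "\<not> X homeomorphic_space top_of_set {0..1::real}"
  shows "\<exists>\<theta>. factor_permuting_action X \<theta> \<and>
           homeo_group X \<cong> semidirect_product (homeo_plus_product X) (aut_free X) \<theta>"
proof -
  interpret dendrite_space X by unfold_locales fact
  obtain I where "free_arc X I" using assms(3) by blast
  show ?thesis
    using wreath_decomposition[OF max_free_arcs_dense[OF assms(2) \<open>free_arc X I\<close>] assms(4)] .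
qed

end
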